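(* Let $n\ge2$ and let $\gamma_0\in\dot C^\infty(\mathbb{R};\mathbb{R}^n)$, with $\inf_{\mathbb{R}}|\partial_x\gamma_0|>0$, be the profile curve of either a non-scaling, an expanding, or a shrinking soliton to the elastic flow $\partial_t\gamma=-\nabla_s^2\kappa-\frac12|\kappa|^2\kappa+\kappa$. Suppose that $E[\gamma_0]<\infty$. Then $\gamma_0$ is stationary, i.e., either a straight line or a borderline elastica.
   Context: $\{e_j\}_{j=1}^n$ is the canonical basis of $\mathbb{R}^n$ and $\mathbb{N}_0=\{0,1,2,\dots\}$. For an immersed curve $\gamma$ (or each curve $\gamma(t,\cdot)$ of a family), $\partial_s=|\partial_x\gamma|^{-1}\partial_x$, $ds=|\partial_x\gamma|\,dx$, $\kappa=\partial_s^2\gamma$, and $\nabla_sf=\partial_sf-\langle\partial_sf,\partial_s\gamma\rangle\partial_s\gamma$. The energy is $$E[\gamma]=\int_\gamma\Big(\tfrac12|\kappa|^2+\tfrac12|\partial_s\gamma-e_1|^2\Big)ds.$$ Stationary means $\nabla_s^2\kappa+\frac12|\kappa|^2\kappa-\kappa=0$. A (planar) borderline elastica is a curve which, up to similarity and reparametrization, and inside a two-dimensional plane, is given by $\gamma_b(s)=(s-2\tanh s,\,2\operatorname{sech}s)$. $\dot C^\infty(\mathbb{R};\mathbb{R}^n)$ is the space of smooth maps $u:\mathbb{R}\to\mathbb{R}^n$ all of whose derivatives of order $\ge1$ are bounded on $\mathbb{R}$. $C^\infty([0,T']\times\mathbb{R})$ denotes the maps all of whose derivatives $\partial_t^\alpha\partial_x^\beta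 u$, $\alpha,\beta\in\mathbb{N}_0$, are bounded on $[0,T']\times\mathbb{R}$. Maximal existence time: $T\in(0,\infty]$ is the supremum of all $T'\in(0,\infty)$ such that there is a unique smooth solution $\gamma:[0,T']\times\mathbb{R}\to\mathbb{R}^n$ of the flow starting from $\gamma_0$ with $\gamma-\gamma_0\in C^\infty([0,T']\times\mathbb{R})$ and $\inf_{[0,T']\times\mathbb{R}}|\partial_x\gamma|>0$. Solitons: let $\gamma:[0,T)\times\mathbb{R}\to\mathbb{R}^n$ be a solution to a flow with maximal existence time $T\in(0,\infty]$ and initial datum $\gamma_0$. It is an expanding (resp. shrinking) soliton if there is an increasing (resp. decreasing) function $\alpha:[0,T)\to(0,\infty)$ with $\alpha(0)=1$ and $\lim_{t\to T}\alpha(t)=\infty$ (resp. $\lim_{t\to T}\alpha(t)=0$) such that $\gamma(t)$ is isometric to $\alpha(t)\gamma_0$ for all $t\in[0,T)$. It is a non-scaling soliton if $T=\infty$ and $\gamma(t)$ is isometric to $\gamma_0$ for all $t\ge0$. Here two curves are isometric if, up to reparametrization, one is the image of the other under an isometry of $\mathbb{R}^n$. In all cases $\gamma_0$ is called the profile curve of the soliton. *)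

theory Defs
  imports "HOL-Analysis.Analysis"
begin

section \<open>Smooth maps on the line and on space-time strips\<close>

definition Dx :: "(real \<Rightarrow> 'a::real_normed_vector) \<Rightarrow> real \<Rightarrow> 'a" where
  "Dx f = (\<lambda>x. vector_derivative f (at x))"

definition smooth :: "(real \<Rightarrow> 'a::real_normed_vector) \<Rightarrow> bool" where
  "smooth f \<longleftrightarrow> (\<forall>k x. (Dx ^^ k) f differentiable (at x))"

text \<open>The space \<open>\<dot>C\<^sup>\<infinity>(\<real>)\<close>: the map itself may be unbounded.\<close>

definition dot_Cinf :: "(real \<Rightarrow> 'a::real_normed_vector) set" where
  "dot_Cinf = {f. smooth f \<and> (\<forall>k\<ge>1. bounded (range ((Dx ^^ k) f)))}"

text \<open>Time derivative of a map \<open>u t x\<close>, taken within the time interval \<open>J\<close>, hence one-sided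
  at the end points of \<open>J\<close>.\<close>

definition Dt :: "real set \<Rightarrow> (real \<Rightarrow> real \<Rightarrow> 'a::real_normed_vector) \<Rightarrow> real \<Rightarrow> real \<Rightarrow> 'a" where
  "Dt J u = (\<lambda>t x. vector_derivative (\<lambda>\<tau>. u \<tau> x) (at t within J))"

definition Dtx :: "real set \<Rightarrow> nat \<Rightarrow> nat \<Rightarrow> (real \<Rightarrow> real \<Rightarrow> 'a::real_normed_vector) \<Rightarrow> real \<Rightarrow> real \<Rightarrow> 'a" where
  "Dtx J a b u = (Dt J ^^ a) (\<lambda>t. (Dx ^^ b) (u t))"

text \<open>Smoothness up to the boundary of \<open>J \<times> \<real>\<close>: all \<open>\<partial>\<^sub>t\<^sup>a \<partial>\<^sub>x\<^sup>b u\<close> exist, are jointly continuous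
  and are again differentiable in each variable; the order of differentiation is then
  immaterial.\<close>

definition smooth_strip :: "real set \<Rightarrow> (real \<Rightarrow> real \<Rightarrow> 'a::real_normed_vector) \<Rightarrow> bool" where
  "smooth_strip J u \<longleftrightarrow>
     (\<forall>a b. continuous_on (J \<times> UNIV) (\<lambda>(t, x). Dtx J a b u t x) \<and>
        (\<forall>t\<in>J. \<forall>x. (\<lambda>\<tau>. Dtx J a b u \<tau> x) differentiable (at t within J) \<and>
                    (\<lambda>\<xi>. Dtx J a b u t \<xi>) differentiable (at x)))"

definition Cinf_strip :: "real set \<Rightarrow> (real \<Rightarrow> real \<Rightarrow> 'a::real_normed_vector) set" where
  "Cinf_strip J = {u. smooth_strip J u \<and>
     (\<forall>a b. bounded ((\<lambda>(t, x). Dtx J a b u t x) ` (J \<times> UNIV)))}"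

section \<open>Geometry of immersed curves\<close>

text \<open>\<open>Ds \<gamma> f\<close> is \<open>\<partial>\<^sub>s f\<close>, the arclength derivative along \<open>\<gamma>\<close>.\<close>

definition Ds :: "(real \<Rightarrow> 'a::real_inner) \<Rightarrow> (real \<Rightarrow> 'a) \<Rightarrow> real \<Rightarrow> 'a" where
  "Ds \<gamma> f = (\<lambda>x. inverse (norm (Dx \<gamma> x)) *\<^sub>R Dx f x)"

definition curvature :: "(real \<Rightarrow> 'a::real_inner) \<Rightarrow> real \<Rightarrow> 'a" where
  "curvature \<gamma> = Ds \<gamma> (Ds \<gamma> \<gamma>)"

definition nabla_s :: "(real \<Rightarrow> 'a::real_inner) \<Rightarrow> (real \<Rightarrow> 'a) \<Rightarrow> real \<Rightarrow> 'a" where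
  "nabla_s \<gamma> f = (\<lambda>x. Ds \<gamma> f x - (Ds \<gamma> f x \<bullet> Ds \<gamma> \<gamma> x) *\<^sub>R Ds \<gamma> \<gamma> x)"

definition energy :: "'a::real_inner \<Rightarrow> (real \<Rightarrow> 'a) \<Rightarrow> ennreal" where
  "energy e \<gamma> = (\<integral>\<^sup>+x. ennreal
     ((1/2 * (norm (curvature \<gamma> x))\<^sup>2 + 1/2 * (norm (Ds \<gamma> \<gamma> x - e))\<^sup>2) * norm (Dx \<gamma> x)) \<partial>lborel)"

definition stationary :: "(real \<Rightarrow> 'a::real_inner) \<Rightarrow> bool" where
  "stationary \<gamma> \<longleftrightarrow>
     (\<forall>x. nabla_s \<gamma> (nabla_s \<gamma> (curvature \<gamma>)) x
        + (1/2 * (norm (curvature \<gamma> x))\<^sup>2) *\<^sub>R curvature \<gamma> x - curvature \<gamma> x = 0)"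

text \<open>Smooth diffeomorphisms of \<open>\<real>\<close>; they may reverse the orientation.\<close>

definition reparametrization :: "(real \<Rightarrow> real) \<Rightarrow> bool" where
  "reparametrization \<phi> \<longleftrightarrow> smooth \<phi> \<and> bij \<phi> \<and> (\<forall>x. Dx \<phi> x \<noteq> 0)"

definition isometric_curves :: "(real \<Rightarrow> 'a::euclidean_space) \<Rightarrow> (real \<Rightarrow> 'a) \<Rightarrow> bool" where
  "isometric_curves c d \<longleftrightarrow>
     (\<exists>F \<phi>. (\<forall>p q. dist (F p) (F q) = dist p q) \<and> reparametrization \<phi> \<and>
            (\<forall>x. c x = F (d (\<phi> x))))"

definition straight_line :: "(real \<Rightarrow> 'a::real_normed_vector) \<Rightarrow> bool" where
  "straight_line \<gamma> \<longleftrightarrow>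
     (\<exists>p v \<phi>. v \<noteq> 0 \<and> reparametrization \<phi> \<and> (\<forall>x. \<gamma> x = p + \<phi> x *\<^sub>R v))"

definition gamma_b :: "real \<Rightarrow> real ^ 2" where
  "gamma_b s = vector [s - 2 * tanh s, 2 / cosh s]"

text \<open>A map \<open>F\<close> of \<open>\<real>\<^sup>2\<close> that multiplies all distances by \<open>c > 0\<close> is a similarity onto an affine
  two-dimensional plane.\<close>

definition borderline_elastica :: "(real \<Rightarrow> 'a::euclidean_space) \<Rightarrow> bool" where
  "borderline_elastica \<gamma> \<longleftrightarrow>
     (\<exists>F c \<phi>. c > 0 \<and> (\<forall>p q :: real ^ 2. dist (F p) (F q) = c * dist p q) \<and>
              reparametrization \<phi> \<and> (\<forall>x. \<gamma> x = F (gamma_b (\<phi> x))))"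

section \<open>The elastic flow and its solitons\<close>

definition elastic_flow_on ::
  "(real \<Rightarrow> 'a::euclidean_space) \<Rightarrow> real \<Rightarrow> (real \<Rightarrow> real \<Rightarrow> 'a) \<Rightarrow> bool" where
  "elastic_flow_on \<gamma>0 T' \<gamma> \<longleftrightarrow>
     smooth_strip {0..T'} \<gamma> \<and>
     (\<forall>t\<in>{0..T'}. \<forall>x. Dt {0..T'} \<gamma> t x =
        - nabla_s (\<gamma> t) (nabla_s (\<gamma> t) (curvature (\<gamma> t))) x
        - (1/2 * (norm (curvature (\<gamma> t) x))\<^sup>2) *\<^sub>R curvature (\<gamma> t) x
        + curvature (\<gamma> t) x) \<and>
     (\<forall>x. \<gamma> 0 x = \<gamma>0 x) \<and>
     (\<lambda>t x. \<gamma> t x - \<gamma>0 x) \<in> Cinf_strip {0..T'} \<and>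
     (INF (t, x)\<in>{0..T'} \<times> UNIV. norm (Dx (\<gamma> t) x)) > 0"

text \<open>Curve families are total functions, so uniqueness means agreement on \<open>[0,T'] \<times> \<real>\<close>.\<close>

definition uniquely_solvable :: "(real \<Rightarrow> 'a::euclidean_space) \<Rightarrow> real \<Rightarrow> bool" where
  "uniquely_solvable \<gamma>0 T' \<longleftrightarrow>
     (\<exists>\<gamma>. elastic_flow_on \<gamma>0 T' \<gamma> \<and>
        (\<forall>\<eta>. elastic_flow_on \<gamma>0 T' \<eta> \<longrightarrow> (\<forall>t\<in>{0..T'}. \<forall>x. \<eta> t x = \<gamma> t x)))"

definition maximal_time :: "(real \<Rightarrow> 'a::euclidean_space) \<Rightarrow> ereal" where
  "maximal_time \<gamma>0 = Sup (ereal ` {T'. T' > 0 \<and> uniquely_solvable \<gamma>0 T'})"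

definition maximal_solution ::
  "(real \<Rightarrow> 'a::euclidean_space) \<Rightarrow> ereal \<Rightarrow> (real \<Rightarrow> real \<Rightarrow> 'a) \<Rightarrow> bool" where
  "maximal_solution \<gamma>0 T \<gamma> \<longleftrightarrow>
     T > 0 \<and> T = maximal_time \<gamma>0 \<and> (\<forall>T'>0. ereal T' < T \<longrightarrow> elastic_flow_on \<gamma>0 T' \<gamma>)"

definition times_before :: "ereal \<Rightarrow> real set" where
  "times_before T = {t. 0 \<le> t \<and> ereal t < T}"

definition towards :: "ereal \<Rightarrow> real filter" where
  "towards T = (if T = \<infinity> then at_top else at_left (real_of_ereal T))"

definition expanding_profile :: "(real \<Rightarrow> 'a::euclidean_space) \<Rightarrow> bool" where
  "expanding_profile \<gamma>0 \<longleftrightarrow>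
     (\<exists>T \<gamma> \<alpha>. maximal_solution \<gamma>0 T \<gamma> \<and>
        mono_on (times_before T) \<alpha> \<and> (\<forall>t\<in>times_before T. \<alpha> t > 0) \<and> \<alpha> 0 = 1 \<and>
        filterlim \<alpha> at_top (towards T) \<and>
        (\<forall>t\<in>times_before T. isometric_curves (\<gamma> t) (\<lambda>x. (\<alpha> t :: real) *\<^sub>R \<gamma>0 x)))"

definition shrinking_profile :: "(real \<Rightarrow> 'a::euclidean_space) \<Rightarrow> bool" where
  "shrinking_profile \<gamma>0 \<longleftrightarrow>
     (\<exists>T \<gamma> \<alpha>. maximal_solution \<gamma>0 T \<gamma> \<and>
        antimono_on (times_before T) \<alpha> \<and> (\<forall>t\<in>times_before T. \<alpha> t > 0) \<and> \<alpha> 0 = 1 \<and>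
        (\<alpha> \<longlongrightarrow> 0) (towards T) \<and>
        (\<forall>t\<in>times_before T. isometric_curves (\<gamma> t) (\<lambda>x. (\<alpha> t :: real) *\<^sub>R \<gamma>0 x)))"

definition non_scaling_profile :: "(real \<Rightarrow> 'a::euclidean_space) \<Rightarrow> bool" where
  "non_scaling_profile \<gamma>0 \<longleftrightarrow>
     (\<exists>\<gamma>. maximal_solution \<gamma>0 \<infinity> \<gamma> \<and> (\<forall>t\<ge>0. isometric_curves (\<gamma> t) \<gamma>0))"

end

theory Submission
  imports Defs
begin

text \<open>
  The energy is a Lyapunov function of the flow, although it is neither invariant under all
  isometries nor known to be finite at positive times. Write \<open>\<tau>\<close>, \<open>\<kappa>\<close>, \<open>g\<close> for tangent, curvature and
  speed, \<open>D = \<partial>\<^sub>s\<close>, and \<open>W = \<nabla>\<^sub>s\<kappa> + (|\<kappa>|\<^sup>2/2 - 1) \<tau>\<close>. The velocity is \<open>V = - D W\<close>, and since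
  \<open>|\<tau> - e|\<^sup>2/2 = 1 - \<langle>\<tau>,e\<rangle>\<close>, the energy density \<open>\<rho>\<close> (per unit of the parameter) satisfies
  \<open>\<partial>\<^sub>t \<rho> = g D(\<langle>\<kappa>,DV\<rangle> - \<langle>V, W + e\<rangle>) - g |V|\<^sup>2\<close>.

  On the whole line the flux has to be shown not to carry energy in from infinity. Multiply by a weight
  \<open>\<eta>\<close> with \<open>|\<eta>'| \<le> \<epsilon>\<eta>\<close> and \<open>|\<eta>''| \<le> 10\<epsilon>\<eta>\<close>. After integrations by parts every flux term is
  \<open>\<epsilon>\<eta>\<close> times a quadratic expression in \<open>V\<close>, \<open>\<kappa>\<close>, \<open>\<nabla>\<^sub>s\<kappa>\<close>, \<open>\<tau> - e\<close>; the integral of \<open>\<eta>|\<nabla>\<^sub>s\<kappa>|\<^sup>2\<close> is in turn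
  controlled by those of \<open>\<eta>|V|\<^sup>2\<close> and \<open>\<eta>|\<kappa>|\<^sup>2\<close> because \<open>\<nabla>\<^sub>s\<^sup>2\<kappa> = - V - |\<kappa>|\<^sup>2\<kappa>/2 + \<kappa>\<close>
  (\<open>weighted_dissipation\<close>). Gronwall's inequality and \<open>\<epsilon> \<rightarrow> 0\<close> give: the energy at time \<open>t\<close> is at most
  the initial energy minus the dissipated amount (\<open>energy_dissipation\<close>).

  If \<open>\<gamma>(t)\<close> is an isometric image of \<open>\<alpha> \<gamma>\<^sub>0\<close>, both curves have finite energy, so both tangents are close to
  \<open>e\<close> on most of the line. Hence the linear part of the isometry maps \<open>e\<close> to \<open>\<plusminus>e\<close>, and the curvature
  and tangent parts of the energy of \<open>\<gamma>(t)\<close> are those of \<open>\<gamma>\<^sub>0\<close> divided and multiplied by \<open>\<alpha>\<close>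
  (\<open>scaled_energy_le\<close>). As the sum stays bounded, \<open>\<alpha> \<rightarrow> \<infinity>\<close> forces \<open>\<tau> = e\<close> and \<open>\<alpha> \<rightarrow> 0\<close> forces
  \<open>\<kappa> = 0\<close>: the curve is a line. For \<open>\<alpha> = 1\<close> no energy is dissipated, so \<open>V = 0\<close>.

  For a stationary curve \<open>W\<close> is constant. Finite energy makes \<open>\<tau> - e\<close> and \<open>\<kappa>\<close> vanish at infinity, so
  \<open>W = - e\<close>, which reads \<open>\<tau>'' = (3\<langle>\<tau>,e\<rangle> - 2) \<tau> - e\<close> together with \<open>|\<kappa>|\<^sup>2 = 2v\<close>, \<open>v = 1 - \<langle>\<tau>,e\<rangle>\<close>.
  From \<open>v'\<^sup>2 = 2v\<^sup>2(2 - v)\<close> a maximum of \<open>v\<close> has \<open>v = 0\<close>, and the curve is a line, or \<open>v = 2\<close>. In the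
  latter case \<open>\<tau> = - e\<close> and \<open>|\<kappa>| = 2\<close> there, which are data of the borderline elastica, and
  uniqueness for the ordinary differential equation concludes (\<open>line_or_elastica\<close>).
\<close>

section \<open>Calculus of smooth maps on the line\<close>

text \<open>Smoothness speaks of all orders at once; products and reciprocals need an induction on the
  order of differentiability.\<close>

primrec diff_times :: "nat \<Rightarrow> (real \<Rightarrow> 'a::real_normed_vector) \<Rightarrow> bool" where
  "diff_times 0 f \<longleftrightarrow> True"
| "diff_times (Suc k) f \<longleftrightarrow> (\<forall>x. f differentiable (at x)) \<and> diff_times k (Dx f)"

lemma diff_times_iff: "diff_times k f \<longleftrightarrow> (\<forall>j<k. \<forall>x. (Dx ^^ j) f differentiable (at x))"
proof (induction k arbitrary: f)
  case (Suc k)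
  have "(\<forall>j<Suc k. \<forall>x. (Dx ^^ j) f differentiable (at x)) \<longleftrightarrow>
     (\<forall>x. f differentiable (at x)) \<and> (\<forall>j<k. \<forall>x. (Dx ^^ Suc j) f differentiable (at x))"
    by (simp only: All_less_Suc2) simp
  then show ?case by (simp only: diff_times.simps Suc funpow_Suc_right o_apply)
qed simp

lemma smooth_iff_diff_times: "smooth f \<longleftrightarrow> (\<forall>k. diff_times k f)"
  unfolding smooth_def diff_times_iff by blast

lemma smooth_rec: "smooth f \<longleftrightarrow> (\<forall>x. f differentiable (at x)) \<and> smooth (Dx f)"
  unfolding smooth_iff_diff_times
  by (metis diff_times.simps(1,2) not0_implies_Suc)

lemma Dx_eqI: "(\<And>x. (f has_vector_derivative f' x) (at x)) \<Longrightarrow> Dx f = f'"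
  unfolding Dx_def by (auto intro!: vector_derivative_at)

lemma Dx_eq: "(f has_vector_derivative f') (at x) \<Longrightarrow> Dx f x = f'"
  unfolding Dx_def by (rule vector_derivative_at)

lemma diff_times_SucI:
  assumes "\<And>x. (f has_vector_derivative f' x) (at x)" "diff_times k f'"
  shows "diff_times (Suc k) f"
  using assms Dx_eqI[OF assms(1)] differentiableI_vector[OF assms(1)] by simp

lemma diff_times_SucD: "diff_times (Suc k) f \<Longrightarrow> (f has_vector_derivative Dx f x) (at x)"
  by (simp add: Dx_def vector_derivative_works)

lemma diff_times_mono: "diff_times (Suc k) f \<Longrightarrow> diff_times k f"
  by (simp add: diff_times_iff)

lemma diff_times_const: "diff_times k (\<lambda>x. c)"
proof (induction k arbitrary: c)
  case (Suc k)
  show ?case by (rule diff_times_SucI[where f' = "\<lambda>x. 0"]) (auto intro: Suc)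
qed simp

lemma diff_times_add: "diff_times k f \<Longrightarrow> diff_times k g \<Longrightarrow> diff_times k (\<lambda>x. f x + g x)"
proof (induction k arbitrary: f g)
  case (Suc k)
  show ?case
    by (rule diff_times_SucI[where f' = "\<lambda>x. Dx f x + Dx g x"])
      (use Suc in \<open>auto intro!: derivative_eq_intros diff_times_SucD\<close>)
qed simp

lemma (in bounded_bilinear) diff_times_prod:
  "diff_times k f \<Longrightarrow> diff_times k g \<Longrightarrow> diff_times k (\<lambda>x. prod (f x) (g x))"
proof (induction k arbitrary: f g)
  case (Suc k)
  have d: "(f has_vector_derivative Dx f x) (at x)" "(g has_vector_derivative Dx g x) (at x)" for x
    using Suc.prems diff_times_SucD by blast+
  have "diff_times k (\<lambda>x. prod (f x) (Dx g x) + prod (Dx f x) (g x))"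
    using Suc.prems by (intro diff_times_add Suc.IH diff_times_mono[of k f] diff_times_mono[of k g])
      simp_all
  then show ?case
    by (rule diff_times_SucI[rotated]) (rule has_vector_derivative[OF d])
qed simp

lemma smooth_const [simp, intro]: "smooth (\<lambda>x. c)"
  by (simp add: smooth_iff_diff_times diff_times_const)

lemma smooth_add [intro]: "smooth f \<Longrightarrow> smooth g \<Longrightarrow> smooth (\<lambda>x. f x + g x)"
  by (simp add: smooth_iff_diff_times diff_times_add)

lemma smooth_scaleR [intro]: "smooth f \<Longrightarrow> smooth g \<Longrightarrow> smooth (\<lambda>x. f x *\<^sub>R g x)"
  by (simp add: smooth_iff_diff_times bounded_bilinear.diff_times_prod[OF bounded_bilinear_scaleR])

lemma smooth_mult [intro]:
  fixes f g :: "real \<Rightarrow> real"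
  shows "smooth f \<Longrightarrow> smooth g \<Longrightarrow> smooth (\<lambda>x. f x * g x)"
  using smooth_scaleR[of f g] by simp

lemma smooth_inner [intro]: "smooth f \<Longrightarrow> smooth g \<Longrightarrow> smooth (\<lambda>x. f x \<bullet> g x)"
  by (simp add: smooth_iff_diff_times bounded_bilinear.diff_times_prod[OF bounded_bilinear_inner])

lemma smooth_diff [intro]: "smooth f \<Longrightarrow> smooth g \<Longrightarrow> smooth (\<lambda>x. f x - g x)"
  using smooth_add[of f "\<lambda>x. (-1) *\<^sub>R g x"] smooth_scaleR[OF smooth_const[of "-1"], of g] by simp

lemma smooth_Dx [intro]: "smooth f \<Longrightarrow> smooth (Dx f)"
  using smooth_rec by blast

lemma smooth_has_derivative: "smooth f \<Longrightarrow> (f has_vector_derivative Dx f x) (at x)"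
  using diff_times_SucD smooth_iff_diff_times by blast

lemma smooth_continuous: "smooth f \<Longrightarrow> continuous_on S f"
  by (meson continuous_at_imp_continuous_on differentiable_imp_continuous_within smooth_rec)

lemma smoothI:
  assumes "\<And>x. (f has_vector_derivative f' x) (at x)" "smooth f'"
  shows "smooth f"
  using assms Dx_eqI[OF assms(1)] differentiableI_vector[OF assms(1)]
  by (subst smooth_rec) simp

lemma inverse_norm_derivative:
  fixes p :: "real \<Rightarrow> 'a::real_inner"
  assumes "(p has_vector_derivative p') (at x within S)" "p x \<noteq> 0"
  shows "((\<lambda>x. inverse (norm (p x))) has_vector_derivative
           - (inverse (norm (p x)) ^ 3 * (p x \<bullet> p'))) (at x within S)"
  using assms unfolding norm_eq_sqrt_inner has_vector_derivative_def
  apply (auto intro!: derivative_eq_intros ext)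
  apply (simp add: field_simps inner_commute power3_eq_cube)
  done

text \<open>The function \<open>r = 1/|p|\<close> satisfies \<open>r' = - r\<^sup>3 \<langle>p, p'\<rangle>\<close>, which contains no derivative of \<open>r\<close>,
  so its regularity bootstraps.\<close>

lemma smooth_inverse_norm:
  fixes p :: "real \<Rightarrow> 'a::real_inner"
  assumes p: "smooth p" and nz: "\<And>x. p x \<noteq> 0"
  shows "smooth (\<lambda>x. inverse (norm (p x)))" (is "smooth ?r")
proof -
  have d: "(?r has_vector_derivative (-1) * (?r x * (?r x * (?r x * (p x \<bullet> Dx p x))))) (at x)" for x
    using inverse_norm_derivative[OF smooth_has_derivative[OF p] nz] 
    by (simp add: power3_eq_cube mult.assoc)
  note bm = bounded_bilinear.diff_times_prod[OF bounded_bilinear_mult]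
  have q: "diff_times k (\<lambda>x. p x \<bullet> Dx p x)" for k
    using smooth_inner[OF p smooth_Dx[OF p]] smooth_iff_diff_times by blast
  have "diff_times k ?r" for k
  proof (induction k)
    case (Suc k)
    show ?case
      by (rule diff_times_SucI[OF d]) (intro bm diff_times_const Suc q)
  qed simp
  then show ?thesis by (simp add: smooth_iff_diff_times)
qed

lemma smooth_norm:
  fixes p :: "real \<Rightarrow> 'a::real_inner"
  assumes p: "smooth p" and nz: "\<And>x. p x \<noteq> 0"
  shows "smooth (\<lambda>x. norm (p x))"
proof -
  have "(\<lambda>x. norm (p x)) = (\<lambda>x. (p x \<bullet> p x) * inverse (norm (p x)))"
    using nz by (auto simp: fun_eq_iff dot_square_norm power2_eq_square)
  then show ?thesis using smooth_inverse_norm[OF assms] p by auto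
qed

section \<open>Arclength calculus along an immersed curve\<close>

locale immersed_curve =
  fixes c :: "real \<Rightarrow> 'a::euclidean_space"
  assumes smooth_c: "smooth c" and immersed: "\<And>x. Dx c x \<noteq> 0"
begin

abbreviation "g \<equiv> \<lambda>x. norm (Dx c x)"
abbreviation "tau \<equiv> Ds c c"
abbreviation "kap \<equiv> curvature c"
abbreviation "nk \<equiv> nabla_s c (curvature c)"

text \<open>The force in an elastic rod with unit tension, which is the first integral that translation
  invariance yields for stationary curves.\<close>

definition force :: "real \<Rightarrow> 'a" where
  "force x = nk x + (1/2 * (kap x \<bullet> kap x) - 1) *\<^sub>R tau x"

lemma g_pos: "g x > 0" using immersed by simp

lemma smooth_g: "smooth g" by (rule smooth_norm) (use smooth_c immersed in auto)

lemma smooth_Ds: "smooth f \<Longrightarrow> smooth (Ds c f)"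
  unfolding Ds_def using smooth_inverse_norm[OF smooth_Dx[OF smooth_c] immersed] by auto

lemma smooth_tau: "smooth tau" by (intro smooth_Ds smooth_c)
lemma smooth_kap: "smooth kap" unfolding curvature_def by (intro smooth_Ds smooth_c)
lemma smooth_nabla: "smooth f \<Longrightarrow> smooth (nabla_s c f)"
  unfolding nabla_s_def by (intro smooth_diff smooth_scaleR smooth_inner smooth_Ds smooth_c)
lemma smooth_nk: "smooth nk" by (intro smooth_nabla smooth_kap)
lemma smooth_force: "smooth force"
  unfolding force_def
  by (intro smooth_add smooth_scaleR smooth_diff smooth_mult smooth_inner smooth_nk smooth_kap smooth_tau smooth_const)

lemma Dx_eq_g_Ds: "Dx f x = g x *\<^sub>R Ds c f x"
  using immersed by (simp add: Ds_def)

lemma arclength_derivative: "smooth f \<Longrightarrow> (f has_vector_derivative g x *\<^sub>R Ds c f x) (at x)"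
  using smooth_has_derivative Dx_eq_g_Ds by metis

lemma Ds_eqI: "(f has_vector_derivative g x *\<^sub>R f') (at x) \<Longrightarrow> Ds c f x = f'"
  using immersed by (simp add: Ds_def Dx_def vector_derivative_at)

lemma Dx_c: "Dx c x = g x *\<^sub>R tau x" by (rule Dx_eq_g_Ds)

lemma tau_unit: "tau x \<bullet> tau x = 1"
  using immersed by (simp add: Ds_def dot_square_norm power2_eq_square)

lemma norm_tau: "norm (tau x) = 1" by (simp add: norm_eq_sqrt_inner tau_unit)

lemma tau_derivative: "(tau has_vector_derivative g x *\<^sub>R kap x) (at x)"
  using arclength_derivative[OF smooth_tau] by (simp add: curvature_def)

lemma inner_derivative:
  assumes f: "smooth f" and h: "smooth h"
  shows "((\<lambda>x. f x \<bullet> h x) has_vector_derivative g x * (Ds c f x \<bullet> h x + f x \<bullet> Ds c h x)) (at x)"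
  using bounded_bilinear.has_vector_derivative[OF bounded_bilinear_inner
      arclength_derivative[OF f, of x] arclength_derivative[OF h, of x]]
  by (simp add: algebra_simps)

lemma inner_constant:
  assumes f: "smooth f" and h: "smooth h" and const: "\<And>x. f x \<bullet> h x = k"
  shows "Ds c f x \<bullet> h x = - (f x \<bullet> Ds c h x)"
proof -
  have "((\<lambda>x. k) has_vector_derivative g x * (Ds c f x \<bullet> h x + f x \<bullet> Ds c h x)) (at x)"
    using inner_derivative[OF f h] unfolding const .
  then have "g x * (Ds c f x \<bullet> h x + f x \<bullet> Ds c h x) = 0"
    using vector_derivative_unique_at[OF _ has_vector_derivative_const] by blast
  then show ?thesis using immersed by simp
qed

lemma Ds_tau: "Ds c tau = kap" by (simp add: curvature_def)

lemma kap_tau: "kap x \<bullet> tau x = 0"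
  using inner_constant[OF smooth_tau smooth_tau tau_unit, of x] by (simp add: Ds_tau inner_commute)

lemma nabla_tau: "nabla_s c f x \<bullet> tau x = 0"
  by (simp add: nabla_s_def inner_diff_left tau_unit)

lemma Ds_normal:
  assumes f: "smooth f" and n: "\<And>x. f x \<bullet> tau x = 0"
  shows "Ds c f x = nabla_s c f x - (f x \<bullet> kap x) *\<^sub>R tau x"
  using inner_constant[OF f smooth_tau n, of x] by (simp add: nabla_s_def Ds_tau)

lemma Ds_kap: "Ds c kap x = nk x - (kap x \<bullet> kap x) *\<^sub>R tau x"
  by (rule Ds_normal[OF smooth_kap kap_tau])

lemma Ds_nk: "Ds c nk x = nabla_s c nk x - (nk x \<bullet> kap x) *\<^sub>R tau x"
  by (rule Ds_normal[OF smooth_nk nabla_tau])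

lemma kap_sq_derivative: "((\<lambda>x. kap x \<bullet> kap x) has_vector_derivative g x * (2 * (kap x \<bullet> nk x))) (at x)"
  using inner_derivative[OF smooth_kap smooth_kap, of x]
  by (simp add: Ds_kap inner_diff_left inner_diff_right kap_tau inner_commute)

text \<open>The tangential component \<open>- \<langle>\<nabla>\<^sub>s\<kappa>,\<kappa>\<rangle>\<close> of \<open>\<partial>\<^sub>s \<nabla>\<^sub>s\<kappa>\<close> cancels the derivative of \<open>|\<kappa>|\<^sup>2/2\<close>.\<close>

lemma Ds_force:
  "Ds c force x = nabla_s c nk x + (1/2 * (kap x \<bullet> kap x) - 1) *\<^sub>R kap x"
  unfolding force_def
  apply (rule Ds_eqI)
  apply (rule derivative_eq_intros arclength_derivative[OF smooth_nk] tau_derivative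
       kap_sq_derivative[unfolded has_real_derivative_iff_has_vector_derivative[symmetric]] refl)+
  apply (simp add: Ds_nk algebra_simps inner_commute)
  done

text \<open>The curvature in terms of the first two derivatives alone: it is controlled by bounds on
  these, and its time derivative involves only theirs.\<close>

lemma kap_formula: "kap x = (1 / (g x)\<^sup>2) *\<^sub>R (Dx (Dx c) x - (Dx (Dx c) x \<bullet> tau x) *\<^sub>R tau x)"
proof -
  have "Dx c = (\<lambda>x. g x *\<^sub>R tau x)" by (rule ext) (rule Dx_c)
  then have "Dx (Dx c) x = Dx (\<lambda>x. g x *\<^sub>R tau x) x" by simp
  also have "\<dots> = g x *\<^sub>R (g x *\<^sub>R kap x) + Dx g x *\<^sub>R tau x"
    unfolding Dx_def
    by (rule vector_derivative_at)
      (use tau_derivative smooth_has_derivative[OF smooth_g, of x] in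
        \<open>auto intro!: derivative_eq_intros simp: Dx_def has_real_derivative_iff_has_vector_derivative\<close>)
  finally have eq: "Dx (Dx c) x = (g x)\<^sup>2 *\<^sub>R kap x + Dx g x *\<^sub>R tau x"
    by (simp add: power2_eq_square)
  show ?thesis using immersed unfolding eq by (simp add: inner_add_left kap_tau tau_unit)
qed

end

section \<open>Production of energy\<close>

context immersed_curve
begin

text \<open>The right-hand side of the elastic flow, written as a total derivative.\<close>

definition vel :: "real \<Rightarrow> 'a" where
  "vel x = - Ds c force x"

lemma smooth_vel: "smooth vel"
proof -
  have "vel = (\<lambda>x. (-1) *\<^sub>R Ds c force x)" by (auto simp: vel_def)
  then show ?thesis using smooth_scaleR[OF smooth_const[of "-1"] smooth_Ds[OF smooth_force]] by simp
qed

lemma vel_tau: "vel x \<bullet> tau x = 0"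
  unfolding vel_def Ds_force by (simp add: inner_add_left inner_diff_left nabla_tau kap_tau)

lemma force_derivative: "(force has_vector_derivative - (g x *\<^sub>R vel x)) (at x)"
  using arclength_derivative[OF smooth_force] by (simp add: vel_def)

lemma Ds_Ds: 
  assumes "smooth f"
  shows "Ds c (Ds c f) x = (1 / (g x)\<^sup>2) *\<^sub>R Dx (Dx f) x - ((Dx c x \<bullet> Dx (Dx c) x) / (g x)^4) *\<^sub>R Dx f x"
proof -
  have "(Ds c f has_vector_derivative
     inverse (g x) *\<^sub>R Dx (Dx f) x + (- (inverse (g x) ^ 3 * (Dx c x \<bullet> Dx (Dx c) x))) *\<^sub>R Dx f x) (at x)"
    unfolding Ds_def
    by (rule bounded_bilinear.has_vector_derivative[OF bounded_bilinear_scaleR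
          inverse_norm_derivative[OF smooth_has_derivative] smooth_has_derivative])
      (use assms smooth_c immersed in auto)
  then have "Dx (Ds c f) x = 
     inverse (g x) *\<^sub>R Dx (Dx f) x + (- (inverse (g x) ^ 3 * (Dx c x \<bullet> Dx (Dx c) x))) *\<^sub>R Dx f x"
    unfolding Dx_def[of "Ds c f"] by (rule vector_derivative_at)
  then show ?thesis using immersed
    by (simp add: Ds_def[of c "Ds c f"] scaleR_right_diff_distrib scaleR_right_distrib divide_inverse power2_eq_square
        power3_eq_cube power4_eq_xxxx mult.assoc)
qed

text \<open>The factor \<open>g\<close> makes this the density with respect to the parameter \<open>x\<close>.\<close>

definition density :: "'a \<Rightarrow> real \<Rightarrow> real" where
  "density e x = (1/2 * (norm (kap x))\<^sup>2 + 1/2 * (norm (tau x - e))\<^sup>2) * g x"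

lemma density_nonneg: "density e x \<ge> 0"
  by (simp add: density_def)

lemma half_norm_tau_diff: "norm e = 1 \<Longrightarrow> 1/2 * (norm (tau x - e))\<^sup>2 = 1 - tau x \<bullet> e"
  using tau_unit[of x] by (simp add: power2_norm_eq_inner inner_diff_left inner_diff_right inner_commute
      norm_eq_1)

lemma kap_kap_formula:
  "kap x \<bullet> kap x = inverse (g x) ^ 4 * (Dx (Dx c) x \<bullet> Dx (Dx c) x)
     - inverse (g x) ^ 6 * (Dx (Dx c) x \<bullet> Dx c x)\<^sup>2"
proof -
  define q T r where "q = Dx (Dx c) x" and "T = tau x" and "r = inverse (g x)"
  have k: "kap x = r^2 *\<^sub>R (q - (q \<bullet> T) *\<^sub>R T)"
    using kap_formula by (simp add: q_def T_def r_def divide_inverse power_inverse)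
  have TT: "T \<bullet> T = 1" by (simp add: T_def tau_unit)
  have qT: "q \<bullet> T = r * (q \<bullet> Dx c x)" by (simp add: T_def r_def Ds_def)
  have "kap x \<bullet> kap x = r^4 * (q \<bullet> q - (q \<bullet> T)^2)"
    unfolding k by (simp add: inner_diff_left inner_diff_right TT inner_commute algebra_simps power2_eq_square power4_eq_xxxx)
  then show ?thesis unfolding qT by (simp add: q_def r_def algebra_simps power_mult_distrib flip: power_add)
qed

end

text \<open>The energy density as a function of the first two derivatives \<open>p\<close>, \<open>q\<close> of a curve, and its
  derivative when \<open>p\<close>, \<open>q\<close> vary with velocities \<open>p'\<close>, \<open>q'\<close>. In this form the density can be
  differentiated in time at a fixed parameter.\<close>

definition density_pq :: "'a::euclidean_space \<Rightarrow> 'a \<Rightarrow> 'a \<Rightarrow> real" where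
  "density_pq e p q = 1/2 * (inverse (norm p) ^ 3 * (q \<bullet> q) - inverse (norm p) ^ 5 * (q \<bullet> p)\<^sup>2)
     + norm p - p \<bullet> e"

definition density_pq' :: "'a::euclidean_space \<Rightarrow> 'a \<Rightarrow> 'a \<Rightarrow> 'a \<Rightarrow> 'a \<Rightarrow> real" where
  "density_pq' e p q p' q' = (let r = inverse (norm p) in
     1/2 * (- 3 * r ^ 5 * (p \<bullet> p') * (q \<bullet> q) + 2 * r ^ 3 * (q \<bullet> q')
       + 5 * r ^ 7 * (p \<bullet> p') * (q \<bullet> p)\<^sup>2 - 2 * r ^ 5 * (q \<bullet> p) * (q' \<bullet> p + q \<bullet> p'))
     + r * (p \<bullet> p') - p' \<bullet> e)"

lemma density_pq_derivative:
  fixes p q :: "real \<Rightarrow> 'a::euclidean_space"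
  assumes p: "(p has_vector_derivative p') (at t within S)" and q: "(q has_vector_derivative q') (at t within S)"
    and nz: "p t \<noteq> 0"
  shows "((\<lambda>t. density_pq e (p t) (q t)) has_vector_derivative density_pq' e (p t) (q t) p' q') (at t within S)"
proof -
  define r where "r = (\<lambda>t. inverse (norm (p t)))"
  have r: "(r has_real_derivative - (r t ^ 3 * (p t \<bullet> p'))) (at t within S)"
    unfolding r_def has_real_derivative_iff_has_vector_derivative
    by (rule inverse_norm_derivative[OF p nz])
  have n: "((\<lambda>t. norm (p t)) has_real_derivative r t * (p t \<bullet> p')) (at t within S)"
    using DERIV_inverse'[OF r] nz unfolding r_def
    by (simp add: field_simps power2_eq_square power3_eq_cube)
  note ip = bounded_bilinear.has_vector_derivative[OF bounded_bilinear_inner, 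
      folded has_real_derivative_iff_has_vector_derivative]
  have pe: "((\<lambda>t. p t \<bullet> e) has_real_derivative p' \<bullet> e) (at t within S)"
    using ip[OF p has_vector_derivative_const[of e]] by simp
  show ?thesis
    unfolding density_pq_def density_pq'_def Let_def r_def[symmetric]
      has_real_derivative_iff_has_vector_derivative[symmetric] fun_cong[OF r_def, symmetric]
    apply (rule derivative_eq_intros r n ip[OF q q] ip[OF q p] pe refl)+
    apply (simp add: inner_commute)
    apply algebra
    done
qed

context immersed_curve
begin

lemma density_eq_pq: "norm e = 1 \<Longrightarrow> density e x = density_pq e (Dx c x) (Dx (Dx c) x)"
proof -
  assume e: "norm e = 1"
  define r where "r = inverse (g x)"
  have rg: "r * g x = 1" using immersed by (simp add: r_def)
  have "density e x = (1/2 * (kap x \<bullet> kap x) + 1 - tau x \<bullet> e) * g x"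
    unfolding density_def half_norm_tau_diff[OF e] by (simp add: power2_norm_eq_inner)
  also have "\<dots> = 1/2 * ((r * g x) * r ^ 3 * (Dx (Dx c) x \<bullet> Dx (Dx c) x) - (r * g x) * r ^ 5 * (Dx (Dx c) x \<bullet> Dx c x)\<^sup>2)
     + g x - (r * g x) * (Dx c x \<bullet> e)"
    unfolding kap_kap_formula r_def[symmetric] by (simp add: Ds_def r_def[symmetric] algebra_simps eval_nat_numeral)
  finally show ?thesis unfolding rg by (simp add: density_pq_def r_def)
qed

text \<open>Along the flow \<open>p' = \<partial>\<^sub>x V\<close> and \<open>q' = \<partial>\<^sub>x\<^sup>2 V\<close>. Then the change of the density equals
  \<open>g (\<langle>\<kappa>,D\<^sup>2V\<rangle> + (1 - 3/2 |\<kappa>|\<^sup>2) \<langle>DV,\<tau>\<rangle> - \<langle>DV,e\<rangle>)\<close>, and \<open>D\<kappa> - W = (1 - 3/2 |\<kappa>|\<^sup>2) \<tau>\<close> for the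
  force \<open>W\<close>, so that it is the derivative of the following flux minus \<open>g |V|\<^sup>2\<close>.\<close>

definition flux :: "'a \<Rightarrow> real \<Rightarrow> real" where
  "flux e x = kap x \<bullet> Ds c vel x - vel x \<bullet> (force x + e)"

lemma flux_derivative:
  "(flux e has_vector_derivative
      density_pq' e (Dx c x) (Dx (Dx c) x) (Dx vel x) (Dx (Dx vel) x) + g x * (vel x \<bullet> vel x)) (at x)"
proof -
  note ip = bounded_bilinear.has_vector_derivative[OF bounded_bilinear_inner]
  have "(flux e has_vector_derivative
      (kap x \<bullet> (g x *\<^sub>R Ds c (Ds c vel) x) + (g x *\<^sub>R Ds c kap x) \<bullet> Ds c vel x)
     - (vel x \<bullet> (- (g x *\<^sub>R vel x)) + (g x *\<^sub>R Ds c vel x) \<bullet> (force x + e))) (at x)"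
    unfolding flux_def
    by (rule has_vector_derivative_diff ip arclength_derivative smooth_kap smooth_vel smooth_Ds
        has_vector_derivative_add_const[THEN iffD2] force_derivative)+
  moreover have "(kap x \<bullet> (g x *\<^sub>R Ds c (Ds c vel) x) + (g x *\<^sub>R Ds c kap x) \<bullet> Ds c vel x)
     - (vel x \<bullet> (- (g x *\<^sub>R vel x)) + (g x *\<^sub>R Ds c vel x) \<bullet> (force x + e))
    = density_pq' e (Dx c x) (Dx (Dx c) x) (Dx vel x) (Dx (Dx vel) x) + g x * (vel x \<bullet> vel x)"
  proof -
    define r p q p' q' where "r = inverse (g x)" and "p = Dx c x" and "q = Dx (Dx c) x"
      and "p' = Dx vel x" and "q' = Dx (Dx vel) x"
    have rg: "r * g x = 1" using immersed by (simp add: r_def)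
    have T: "tau x = r *\<^sub>R p" by (simp add: Ds_def r_def p_def)
    have k: "kap x = r^2 *\<^sub>R (q - (r^2 * (q \<bullet> p)) *\<^sub>R p)"
      using kap_formula[of x, unfolded T, folded q_def] 
      by (simp add: r_def divide_inverse power_inverse power2_eq_square mult_ac)
    have V1: "Ds c vel x = r *\<^sub>R p'" by (simp add: Ds_def r_def p'_def)
    have V2: "Ds c (Ds c vel) x = r^2 *\<^sub>R q' - (r^4 * (p \<bullet> q)) *\<^sub>R p'"
      unfolding Ds_Ds[OF smooth_vel] by (simp add: r_def p_def q_def p'_def q'_def divide_inverse power_inverse mult_ac)
    have kk: "kap x \<bullet> kap x = r^4 * (q \<bullet> q) - r^6 * (q \<bullet> p)\<^sup>2"
      unfolding kap_kap_formula by (simp add: r_def p_def q_def)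
    have tang: "Ds c kap x - force x = (1 - 3/2 * (kap x \<bullet> kap x)) *\<^sub>R tau x"
      unfolding force_def Ds_kap by (simp add: algebra_simps flip: scaleR_add_left) 
    have "kap x \<bullet> (g x *\<^sub>R Ds c (Ds c vel) x) + (g x *\<^sub>R Ds c kap x) \<bullet> Ds c vel x
        - (vel x \<bullet> (- (g x *\<^sub>R vel x)) + (g x *\<^sub>R Ds c vel x) \<bullet> (force x + e))
      = g x * (kap x \<bullet> Ds c (Ds c vel) x + Ds c vel x \<bullet> (Ds c kap x - force x) - Ds c vel x \<bullet> e) + g x * (vel x \<bullet> vel x)"
      by (simp add: algebra_simps inner_commute)
    also have "\<dots> = g x * (r^2 * (r^2 * (q \<bullet> q') - r^4 * (p \<bullet> q) * (q \<bullet> p') - r^2 * (q \<bullet> p) * (r^2 * (p \<bullet> q') - r^4 * (p \<bullet> q) * (p \<bullet> p')))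
        + r * (1 - 3/2 * (r^4 * (q \<bullet> q) - r^6 * (q \<bullet> p)\<^sup>2)) * r * (p \<bullet> p') - r * (p' \<bullet> e)) + g x * (vel x \<bullet> vel x)"
      unfolding tang kk unfolding V1 V2 T k
      by (simp add: inner_diff_left inner_diff_right inner_commute, rule disjI2, algebra)
    also have "\<dots> = (r * g x) * (1/2 * (- 3 * r ^ 5 * (p \<bullet> p') * (q \<bullet> q) + 2 * r ^ 3 * (q \<bullet> q')
       + 5 * r ^ 7 * (p \<bullet> p') * (q \<bullet> p)\<^sup>2 - 2 * r ^ 5 * (q \<bullet> p) * (q' \<bullet> p + q \<bullet> p'))
     + r * (p \<bullet> p') - p' \<bullet> e) + g x * (vel x \<bullet> vel x)"
      by (simp add: inner_commute, rule disjI2, simp add: field_simps, algebra)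
    finally show ?thesis
      unfolding rg density_pq'_def Let_def by (simp add: p_def q_def r_def p'_def q'_def)
  qed
  ultimately show ?thesis by (simp only:)
qed

end

section \<open>The weighted dissipation inequality\<close>

context immersed_curve
begin

lemma Dx2_decomposition: "Dx (Dx c) x = (g x)\<^sup>2 *\<^sub>R kap x + Dx g x *\<^sub>R tau x"
  and Dx_g: "Dx g x = Dx (Dx c) x \<bullet> tau x"
proof -
  have k: "Dx (Dx c) x = (g x)\<^sup>2 *\<^sub>R kap x + (Dx (Dx c) x \<bullet> tau x) *\<^sub>R tau x"
    using immersed by (simp add: kap_formula)
  have "norm (Dx c y) = Dx c y \<bullet> tau y" for y
    using arg_cong[OF Dx_c[of y], of "\<lambda>v. v \<bullet> tau y"] by (simp add: tau_unit)
  then have "g = (\<lambda>x. Dx c x \<bullet> tau x)" by (rule ext)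
  then have "Dx g x = Dx (\<lambda>x. Dx c x \<bullet> tau x) x" by (rule arg_cong)
  moreover have "((\<lambda>x. Dx c x \<bullet> tau x) has_vector_derivative
      g x * (Ds c (Dx c) x \<bullet> tau x + Dx c x \<bullet> kap x)) (at x)"
    using inner_derivative[OF smooth_Dx[OF smooth_c] smooth_tau, of x] by (simp add: Ds_tau)
  ultimately have "Dx g x = g x * (Ds c (Dx c) x \<bullet> tau x + Dx c x \<bullet> kap x)"
    by (simp only: Dx_eq)
  also have "\<dots> = Dx (Dx c) x \<bullet> tau x"
    using immersed arg_cong[OF Dx_c[of x], of "\<lambda>v. v \<bullet> kap x"] kap_tau[of x]
    by (simp add: inner_commute Ds_def[of c "Dx c"])
  finally show "Dx g x = Dx (Dx c) x \<bullet> tau x" .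
  with k show "Dx (Dx c) x = (g x)\<^sup>2 *\<^sub>R kap x + Dx g x *\<^sub>R tau x" by simp
qed

text \<open>The normal part of the third derivative isolates \<open>\<nabla>\<^sub>s\<kappa>\<close>, which is how bounds on the derivatives of
  the curve pass to it.\<close>

lemma Dx3_decomposition:
  "Dx (Dx (Dx c)) x - (Dx (Dx (Dx c)) x \<bullet> tau x) *\<^sub>R tau x = (3 * g x * Dx g x) *\<^sub>R kap x + (g x)^3 *\<^sub>R nk x"
proof -
  note gd = smooth_has_derivative[OF smooth_g, of x]
  have "((\<lambda>x. (g x * g x) *\<^sub>R kap x + Dx g x *\<^sub>R tau x) has_vector_derivative
      ((g x * g x) *\<^sub>R (g x *\<^sub>R Ds c kap x) + (g x * Dx g x + Dx g x * g x) *\<^sub>R kap x)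
      + (Dx g x *\<^sub>R (g x *\<^sub>R kap x) + Dx (Dx g) x *\<^sub>R tau x)) (at x)"
    by (rule has_vector_derivative_add bounded_bilinear.has_vector_derivative[OF bounded_bilinear_scaleR]
       has_vector_derivative_mult gd arclength_derivative smooth_kap tau_derivative 
       smooth_has_derivative smooth_Dx smooth_g)+
  moreover have "Dx (Dx c) = (\<lambda>x. (g x * g x) *\<^sub>R kap x + Dx g x *\<^sub>R tau x)"
    using Dx2_decomposition by (auto simp: power2_eq_square)
  then have "Dx (Dx (Dx c)) x = Dx (\<lambda>x. (g x * g x) *\<^sub>R kap x + Dx g x *\<^sub>R tau x) x" by (rule arg_cong)
  ultimately have "Dx (Dx (Dx c)) x = 
     ((g x * g x) *\<^sub>R (g x *\<^sub>R Ds c kap x) + (g x * Dx g x + Dx g x * g x) *\<^sub>R kap x)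
      + (Dx g x *\<^sub>R (g x *\<^sub>R kap x) + Dx (Dx g) x *\<^sub>R tau x)"
    by (simp only: Dx_eq)
  then have d: "Dx (Dx (Dx c)) x = (Dx (Dx g) x - (g x)^3 * (kap x \<bullet> kap x)) *\<^sub>R tau x
      + ((3 * g x * Dx g x) *\<^sub>R kap x + (g x)^3 *\<^sub>R nk x)"
    unfolding Ds_kap by (simp add: algebra_simps power3_eq_cube flip: scaleR_add_left)
  show ?thesis unfolding d by (simp add: inner_add_left kap_tau nabla_tau tau_unit)
qed

lemma norm_tangential_part_le: "norm (v - (v \<bullet> tau x) *\<^sub>R tau x) \<le> norm v"
proof -
  have "(norm (v - (v \<bullet> tau x) *\<^sub>R tau x))\<^sup>2 = v \<bullet> v - (v \<bullet> tau x)\<^sup>2"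
    unfolding power2_norm_eq_inner
    by (simp add: inner_diff_left inner_diff_right tau_unit inner_commute power2_eq_square)
  also have "\<dots> \<le> (norm v)\<^sup>2" by (simp add: power2_norm_eq_inner)
  finally show ?thesis by (rule power2_le_imp_le) simp
qed

lemma norm_kap_le:
  assumes M: "1 \<le> M * g x" "norm (Dx (Dx c) x) \<le> M"
  shows "norm (kap x) \<le> M ^ 3"
proof -
  have "(g x)\<^sup>2 * norm (kap x) = norm (Dx (Dx c) x - (Dx (Dx c) x \<bullet> tau x) *\<^sub>R tau x)"
    using immersed by (simp add: kap_formula)
  also have "\<dots> \<le> M" using norm_tangential_part_le M(2) by (rule order_trans)
  finally have 1: "(g x)\<^sup>2 * norm (kap x) \<le> M" .
  have "norm (kap x) = 1\<^sup>2 * norm (kap x)" by simp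
  also have "\<dots> \<le> (M * g x)\<^sup>2 * norm (kap x)"
    by (intro mult_right_mono power_mono M) auto
  also have "\<dots> = M\<^sup>2 * ((g x)\<^sup>2 * norm (kap x))" by (simp add: power_mult_distrib)
  also have "\<dots> \<le> M\<^sup>2 * M" by (intro mult_left_mono 1) auto
  finally show ?thesis by (simp add: power2_eq_square power3_eq_cube)
qed

lemma norm_nk_le:
  assumes M: "1 \<le> M * g x" "g x \<le> M" "norm (Dx (Dx c) x) \<le> M" "norm (Dx (Dx (Dx c)) x) \<le> M" and M1: "M \<ge> 1"
  shows "norm (nk x) \<le> 4 * M ^ 8"
proof -
  have dg: "\<bar>Dx g x\<bar> \<le> M"
    unfolding Dx_g using Cauchy_Schwarz_ineq2[of "Dx (Dx c) x" "tau x"] M(3) by (simp add: norm_tau)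
  have "(g x)^3 *\<^sub>R nk x = Dx (Dx (Dx c)) x - (Dx (Dx (Dx c)) x \<bullet> tau x) *\<^sub>R tau x - (3 * g x * Dx g x) *\<^sub>R kap x"
    unfolding Dx3_decomposition by simp
  then have "(g x)^3 * norm (nk x) = norm (Dx (Dx (Dx c)) x - (Dx (Dx (Dx c)) x \<bullet> tau x) *\<^sub>R tau x - (3 * g x * Dx g x) *\<^sub>R kap x)"
    by (metis abs_norm_cancel norm_scaleR power_abs)
  also have "\<dots> \<le> norm (Dx (Dx (Dx c)) x - (Dx (Dx (Dx c)) x \<bullet> tau x) *\<^sub>R tau x) + norm ((3 * g x * Dx g x) *\<^sub>R kap x)"
    by (rule norm_triangle_ineq4)
  also have "\<dots> \<le> M + 3 * M * M * M ^ 3"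
    using norm_tangential_part_le[of "Dx (Dx (Dx c)) x" x] M(4) norm_kap_le[OF M(1,3)] dg M M1
    by (auto intro!: add_mono mult_mono simp: abs_mult)
  also have "\<dots> \<le> 4 * M ^ 5"
    using power_increasing[of 1 5 M] M1 by (simp add: eval_nat_numeral)
  finally have 1: "(g x)^3 * norm (nk x) \<le> 4 * M ^ 5" .
  have "norm (nk x) = 1^3 * norm (nk x)" by simp
  also have "\<dots> \<le> (M * g x)^3 * norm (nk x)"
    by (intro mult_right_mono power_mono M) auto
  also have "\<dots> = M^3 * ((g x)^3 * norm (nk x))" by (simp add: power_mult_distrib)
  also have "\<dots> \<le> M^3 * (4 * M^5)" using M1 by (intro mult_left_mono 1) auto
  also have "\<dots> = 4 * M ^ 8" by (simp add: flip: power_add)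
  finally show ?thesis .
qed

text \<open>The first two terms collect what becomes an exact derivative when the weight is moved past
  \<open>\<partial>\<^sub>x\<close> twice, so that no derivative of \<open>V\<close> is left next to \<open>\<eta>'\<close>. Differentiating the last term,
  \<open>\<eta> \<langle>\<kappa>,\<nabla>\<^sub>s\<kappa>\<rangle> - \<eta>'/(2g) |\<kappa>|\<^sup>2\<close>, produces \<open>\<eta> g |\<nabla>\<^sub>s\<kappa>|\<^sup>2\<close> up to lower order; the factor \<open>\<epsilon>B\<close> is just
  large enough for this to absorb the mixed term \<open>2 \<eta>' \<langle>V,\<nabla>\<^sub>s\<kappa>\<rangle>\<close> when \<open>1 \<le> B g\<close>.\<close>

definition weighted_flux :: "real \<Rightarrow> real \<Rightarrow> 'a \<Rightarrow> (real \<Rightarrow> real) \<Rightarrow> (real \<Rightarrow> real) \<Rightarrow> real \<Rightarrow> real" where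
  "weighted_flux B \<epsilon> e \<eta> \<eta>' x =
     \<eta> x * flux e x - (\<eta>' x * inverse (g x)) * (kap x \<bullet> vel x)
     + \<epsilon> * B * (\<eta> x * (kap x \<bullet> nk x) - 1/2 * ((\<eta>' x * inverse (g x)) * (kap x \<bullet> kap x)))"

lemma weighted_dissipation_identity:
  assumes h: "(\<eta> has_real_derivative \<eta>' x) (at x)" "(\<eta>' has_real_derivative \<eta>'') (at x)"
  defines "a1 \<equiv> \<eta>'' * inverse (g x) - \<eta>' x * (inverse (g x) ^ 3 * (Dx c x \<bullet> Dx (Dx c) x))"
  shows "(weighted_flux B \<epsilon> e \<eta> \<eta>' has_real_derivative
      \<eta> x * density_pq' e (Dx c x) (Dx (Dx c) x) (Dx vel x) (Dx (Dx vel) x) + \<eta> x * g x * (vel x \<bullet> vel x)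
      - a1 * (kap x \<bullet> vel x) - \<eta>' x * (2 * (vel x \<bullet> nk x) + vel x \<bullet> (e - tau x))
      + \<epsilon> * B * (\<eta> x * g x * (nk x \<bullet> nk x) - 1/2 * (a1 * (kap x \<bullet> kap x))
          - \<eta> x * g x * (kap x \<bullet> vel x + 1/2 * (kap x \<bullet> kap x)\<^sup>2 - kap x \<bullet> kap x))) (at x)"
proof -
  have a: "((\<lambda>x. \<eta>' x * inverse (g x)) has_real_derivative a1) (at x)"
    unfolding a1_def
    by (rule derivative_eq_intros h inverse_norm_derivative[folded has_real_derivative_iff_has_vector_derivative]
      smooth_has_derivative smooth_Dx smooth_c immersed refl)+ simp
  note fl = flux_derivative[folded has_real_derivative_iff_has_vector_derivative]
  note ip = inner_derivative[folded has_real_derivative_iff_has_vector_derivative]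
  have rg: "inverse (g x) * g x = 1" using immersed by simp
  have nn: "nabla_s c nk x = - vel x - (1/2 * (kap x \<bullet> kap x) - 1) *\<^sub>R kap x"
    unfolding vel_def Ds_force by simp
  have z: "kap x \<bullet> tau x = 0" "tau x \<bullet> kap x = 0" "nk x \<bullet> tau x = 0" "tau x \<bullet> nk x = 0" "vel x \<bullet> tau x = 0" "tau x \<bullet> vel x = 0"
    using kap_tau[of x] nabla_tau[of kap x] vel_tau[of x] by (auto simp: inner_commute)
  have 1: "g x * (Ds c kap x \<bullet> vel x + kap x \<bullet> Ds c vel x) = g x * (nk x \<bullet> vel x + kap x \<bullet> Ds c vel x)"
    unfolding Ds_kap by (simp add: z inner_diff_left)
  have 2: "g x * (Ds c kap x \<bullet> nk x + kap x \<bullet> Ds c nk x)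
     = g x * (nk x \<bullet> nk x) - g x * (kap x \<bullet> vel x + 1/2 * (kap x \<bullet> kap x)\<^sup>2 - kap x \<bullet> kap x)"
    unfolding Ds_kap Ds_nk nn by (simp add: z inner_diff_left inner_diff_right algebra_simps power2_eq_square)
  have 3: "g x * (Ds c kap x \<bullet> kap x + kap x \<bullet> Ds c kap x) = g x * (2 * (kap x \<bullet> nk x))"
    unfolding Ds_kap by (simp add: z inner_diff_left inner_diff_right inner_commute)
  have 4: "flux e x = kap x \<bullet> Ds c vel x - vel x \<bullet> nk x - vel x \<bullet> (e - tau x) - vel x \<bullet> tau x * (1/2 * (kap x \<bullet> kap x))"
    unfolding flux_def force_def by (simp add: algebra_simps inner_commute)
  have "(weighted_flux B \<epsilon> e \<eta> \<eta>' has_real_derivative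
      (\<eta>' x * flux e x + (density_pq' e (Dx c x) (Dx (Dx c) x) (Dx vel x) (Dx (Dx vel) x) + g x * (vel x \<bullet> vel x)) * \<eta> x)
      - (a1 * (kap x \<bullet> vel x) + (g x * (Ds c kap x \<bullet> vel x + kap x \<bullet> Ds c vel x)) * (\<eta>' x * inverse (g x)))
      + \<epsilon> * B * ((\<eta>' x * (kap x \<bullet> nk x) + (g x * (Ds c kap x \<bullet> nk x + kap x \<bullet> Ds c nk x)) * \<eta> x)
        - 1/2 * (a1 * (kap x \<bullet> kap x) + (g x * (Ds c kap x \<bullet> kap x + kap x \<bullet> Ds c kap x)) * (\<eta>' x * inverse (g x))))) (at x)"
    unfolding weighted_flux_def
    by (intro DERIV_add DERIV_diff DERIV_cmult DERIV_mult[OF h(1) fl] DERIV_mult[OF a ip] DERIV_mult[OF h(1) ip]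
        smooth_kap smooth_vel smooth_nk)
  moreover have "(\<eta>' x * flux e x + (density_pq' e (Dx c x) (Dx (Dx c) x) (Dx vel x) (Dx (Dx vel) x) + g x * (vel x \<bullet> vel x)) * \<eta> x)
      - (a1 * (kap x \<bullet> vel x) + (g x * (Ds c kap x \<bullet> vel x + kap x \<bullet> Ds c vel x)) * (\<eta>' x * inverse (g x)))
      + \<epsilon> * B * ((\<eta>' x * (kap x \<bullet> nk x) + (g x * (Ds c kap x \<bullet> nk x + kap x \<bullet> Ds c nk x)) * \<eta> x)
        - 1/2 * (a1 * (kap x \<bullet> kap x) + (g x * (Ds c kap x \<bullet> kap x + kap x \<bullet> Ds c kap x)) * (\<eta>' x * inverse (g x)))) =
      \<eta> x * density_pq' e (Dx c x) (Dx (Dx c) x) (Dx vel x) (Dx (Dx vel) x) + \<eta> x * g x * (vel x \<bullet> vel x)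
      - a1 * (kap x \<bullet> vel x) - \<eta>' x * (2 * (vel x \<bullet> nk x) + vel x \<bullet> (e - tau x))
      + \<epsilon> * B * (\<eta> x * g x * (nk x \<bullet> nk x) - 1/2 * (a1 * (kap x \<bullet> kap x))
          - \<eta> x * g x * (kap x \<bullet> vel x + 1/2 * (kap x \<bullet> kap x)\<^sup>2 - kap x \<bullet> kap x))"
  proof -
    have m: "g x * p * (\<eta>' x * inverse (g x)) = p * \<eta>' x" for p
      using immersed[of x] by simp
    show ?thesis unfolding 1 2 3 4 m z by (simp add: algebra_simps inner_commute)
  qed
  ultimately show ?thesis by (simp only:)
qed

text \<open>By Young's inequality the remaining terms are at most a multiple of \<open>\<epsilon> Y\<close>, where
  \<open>Y = \<eta> g ((|\<kappa>|\<^sup>2 + |\<tau> - e|\<^sup>2)/2 + |V|\<^sup>2)\<close> is the weighted density of energy and dissipation. A factor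
  \<open>1 \<le> B g\<close> is inserted wherever \<open>g\<close> is missing.\<close>

lemma weighted_dissipation:
  assumes e: "norm e = 1" and B1: "B \<ge> 1"
    and B: "1 \<le> B * g x" "norm (Dx (Dx c) x) \<le> B" "norm (kap x) \<le> B"
    and h: "(\<eta> has_real_derivative \<eta>' x) (at x)" "(\<eta>' has_real_derivative \<eta>'') (at x)"
    and \<epsilon>: "0 < \<epsilon>" "\<epsilon> \<le> 1"
    and hb: "0 \<le> \<eta> x" "\<bar>\<eta>' x\<bar> \<le> \<epsilon> * \<eta> x" "\<bar>\<eta>''\<bar> \<le> 10 * \<epsilon> * \<eta> x"
  obtains \<Psi>' where "(weighted_flux B \<epsilon> e \<eta> \<eta>' has_real_derivative \<Psi>') (at x)"
    "\<eta> x * density_pq' e (Dx c x) (Dx (Dx c) x) (Dx vel x) (Dx (Dx vel) x)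
       \<le> \<Psi>' - (1 - 30 * B ^ 5 * \<epsilon>) * (\<eta> x * (g x * (vel x \<bullet> vel x))) + 30 * B ^ 5 * \<epsilon> * (\<eta> x * density e x)"
proof -
  define a1 where "a1 = \<eta>'' * inverse (g x) - \<eta>' x * (inverse (g x) ^ 3 * (Dx c x \<bullet> Dx (Dx c) x))"
  define K v N d kv Vn Vd where "K = kap x \<bullet> kap x" and "v = vel x \<bullet> vel x" and "N = nk x \<bullet> nk x"
    and "d = (tau x - e) \<bullet> (tau x - e)" and "kv = kap x \<bullet> vel x" and "Vn = vel x \<bullet> nk x" and "Vd = vel x \<bullet> (e - tau x)"
  have half: "\<bar>p \<bullet> q\<bar> \<le> 1/2 * (p \<bullet> p + q \<bullet> q)" for p q :: 'a
    using inner_ge_zero[of "p - q"] inner_ge_zero[of "p + q"]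
    by (simp add: inner_diff_left inner_diff_right inner_add_left inner_add_right inner_commute)
  have kv: "\<bar>kv\<bar> \<le> 1/2 * (K + v)" and Vn: "\<bar>Vn\<bar> \<le> 1/2 * (v + N)"
    unfolding kv_def Vn_def K_def v_def N_def by (rule half)+
  have Vd: "\<bar>Vd\<bar> \<le> 1/2 * (v + d)"
    using half[of "vel x" "e - tau x"] unfolding Vd_def v_def d_def
    by (simp add: inner_diff_left inner_diff_right inner_commute)
  have nn: "K \<ge> 0" "v \<ge> 0" "N \<ge> 0" "d \<ge> 0" by (simp_all add: K_def v_def N_def d_def)
  have KB: "K \<le> B\<^sup>2" unfolding K_def power2_norm_eq_inner[symmetric] by (intro power_mono B) simp
  have r: "inverse (g x) \<le> B" using B(1) immersed[of x] by (simp add: field_simps)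
  have r0: "inverse (g x) \<ge> 0" by simp
  define h0 where "h0 = \<eta> x"
  have h0: "h0 \<ge> 0" using hb by (simp add: h0_def)
  have a1_le: "\<bar>a1\<bar> \<le> \<bar>\<eta>''\<bar> * inverse (g x) + \<bar>\<eta>' x\<bar> * (inverse (g x) ^ 3 * \<bar>Dx c x \<bullet> Dx (Dx c) x\<bar>)"
    unfolding a1_def by (rule order_trans[OF abs_triangle_ineq4]) (simp add: abs_mult)
  have "inverse (g x) ^ 3 * \<bar>Dx c x \<bullet> Dx (Dx c) x\<bar> \<le> inverse (g x) ^ 3 * (g x * norm (Dx (Dx c) x))"
    by (intro mult_left_mono Cauchy_Schwarz_ineq2) simp
  also have "\<dots> = inverse (g x) ^ 2 * norm (Dx (Dx c) x)"
    using immersed[of x] by (simp add: field_simps eval_nat_numeral)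
  also have "\<dots> \<le> B ^ 2 * B" using B r B1 by (intro mult_mono power_mono) auto
  finally have pq: "inverse (g x) ^ 3 * \<bar>Dx c x \<bullet> Dx (Dx c) x\<bar> \<le> B ^ 2 * B" .
  note a1_le
  also have "\<bar>\<eta>''\<bar> * inverse (g x) + \<bar>\<eta>' x\<bar> * (inverse (g x) ^ 3 * \<bar>Dx c x \<bullet> Dx (Dx c) x\<bar>)
     \<le> (10 * \<epsilon> * h0) * B + (\<epsilon> * h0) * (B ^ 2 * B)"
    using hb[folded h0_def] h0 \<epsilon> by (intro add_mono mult_mono r pq) auto
  also have "\<dots> \<le> (10 * \<epsilon> * h0) * B^3 + (\<epsilon> * h0) * B^3"
    using B1 \<epsilon> h0 power_increasing[of 1 3 B] by (intro add_mono mult_left_mono) (auto simp: eval_nat_numeral)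
  finally have a1: "\<bar>a1\<bar> \<le> 11 * B^3 * \<epsilon> * h0" by (simp add: mult_ac)
  define Y where "Y = h0 * g x * (1/2 * (K + d) + v)"
  have Y_ge: "h0 * g x * p \<le> Y" if "p \<le> 1/2 * (K + d) + v" for p
    unfolding Y_def by (rule mult_left_mono[OF that]) (use h0 in simp)
  have Y: "h0 * g x * (1/2 * K) \<le> Y" "h0 * g x * (1/2 * (K + v)) \<le> Y" "h0 * g x * v \<le> Y"
      "h0 * g x * (1/2 * (v + d)) \<le> Y" "h0 * g x * 0 \<le> Y"
    by - (rule Y_ge, use nn in \<open>simp add: add_divide_distrib\<close>)+
  have gB: "p \<le> B * (p * g x)" if "p \<ge> 0" for p
    using mult_left_mono[OF B(1) that] by (simp add: mult_ac)
  have Y0: "0 \<le> Y" using Y(5) by simp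
  have 1: "a1 * kv \<le> \<epsilon> * (11 * B ^ 4 * Y)"
  proof -
    have "a1 * kv \<le> \<bar>a1\<bar> * \<bar>kv\<bar>" by (simp flip: abs_mult)
    also have "\<dots> \<le> (11 * B^3 * \<epsilon> * h0) * (1/2 * (K + v))" by (intro mult_mono a1 kv) (use B1 \<epsilon> h0 in auto)
    also have "\<dots> = 11 * B^3 * \<epsilon> * (h0 * (1/2 * (K + v)))" by simp
    also have "\<dots> \<le> 11 * B^3 * \<epsilon> * (B * (h0 * (1/2 * (K + v)) * g x))"
      using nn h0 B1 \<epsilon> by (intro mult_left_mono gB) auto
    also have "\<dots> = 11 * B^3 * \<epsilon> * B * (h0 * g x * (1/2 * (K + v)))" by simp
    also have "\<dots> \<le> 11 * B^3 * \<epsilon> * B * Y" using B1 \<epsilon> by (intro mult_left_mono Y) auto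
    finally show ?thesis by (simp add: eval_nat_numeral mult_ac)
  qed
  have 2: "\<eta>' x * (2 * Vn) \<le> \<epsilon> * (B * Y) + \<epsilon> * B * (h0 * g x * N)"
  proof -
    have "\<eta>' x * (2 * Vn) \<le> \<bar>\<eta>' x\<bar> * \<bar>2 * Vn\<bar>" by (simp flip: abs_mult)
    also have "\<dots> \<le> (\<epsilon> * h0) * (v + N)" using Vn by (intro mult_mono hb[folded h0_def]) (use \<epsilon> h0 in auto)
    also have "\<dots> = \<epsilon> * (h0 * (v + N))" by simp
    also have "\<dots> \<le> \<epsilon> * (B * (h0 * (v + N) * g x))"
      using nn h0 B1 \<epsilon> by (intro mult_left_mono gB) auto
    also have "\<dots> = \<epsilon> * B * (h0 * g x * v) + \<epsilon> * B * (h0 * g x * N)" by (simp add: algebra_simps)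
    also have "\<dots> \<le> \<epsilon> * B * Y + \<epsilon> * B * (h0 * g x * N)" using B1 \<epsilon> by (intro add_right_mono mult_left_mono Y) auto
    finally show ?thesis by (simp add: mult_ac)
  qed
  have 3: "\<eta>' x * Vd \<le> \<epsilon> * (B * Y)"
  proof -
    have "\<eta>' x * Vd \<le> \<bar>\<eta>' x\<bar> * \<bar>Vd\<bar>" by (simp flip: abs_mult)
    also have "\<dots> \<le> (\<epsilon> * h0) * (1/2 * (v + d))" using Vd by (intro mult_mono hb[folded h0_def]) (use \<epsilon> h0 in auto)
    also have "\<dots> = \<epsilon> * (h0 * (1/2 * (v + d)))" by simp
    also have "\<dots> \<le> \<epsilon> * (B * (h0 * (1/2 * (v + d)) * g x))"
      using nn h0 B1 \<epsilon> by (intro mult_left_mono gB) auto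
    also have "\<dots> = \<epsilon> * B * (h0 * g x * (1/2 * (v + d)))" by simp
    also have "\<dots> \<le> \<epsilon> * B * Y" using B1 \<epsilon> by (intro mult_left_mono Y) auto
    finally show ?thesis by (simp add: mult_ac)
  qed
  have 5: "1/2 * (a1 * K) \<le> 11 * B ^ 4 * Y"
  proof -
    have "a1 * K \<le> (11 * B^3 * \<epsilon> * h0) * K" using a1 nn by (intro mult_right_mono) auto
    then have "1/2 * (a1 * K) \<le> \<epsilon> * (11 * B^3 * h0 * (1/2 * K))" by (simp add: mult_ac)
    also have "\<dots> \<le> 1 * (11 * B^3 * h0 * (1/2 * K))" using B1 \<epsilon> h0 nn by (intro mult_right_mono) auto
    also have "\<dots> = 11 * B^3 * (h0 * (1/2 * K))" by simp
    also have "\<dots> \<le> 11 * B^3 * (B * (h0 * (1/2 * K) * g x))"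
      using nn h0 B1 \<epsilon> by (intro mult_left_mono gB) auto
    also have "\<dots> = 11 * B^3 * B * (h0 * g x * (1/2 * K))" by simp
    also have "\<dots> \<le> 11 * B^3 * B * Y" using B1 by (intro mult_left_mono Y) auto
    finally show ?thesis by (simp add: eval_nat_numeral mult_ac)
  qed
  have 6: "h0 * g x * (kv + 1/2 * K\<^sup>2 - K) \<le> 2 * B ^ 2 * Y"
  proof -
    have "kv + 1/2 * K\<^sup>2 - K \<le> 1/2 * (K + v) + B\<^sup>2 * (1/2 * K)"
      using abs_le_D1[OF kv] nn mult_right_mono[OF KB nn(1)]
      by (simp add: power2_eq_square add_divide_distrib)
    then have "h0 * g x * (kv + 1/2 * K\<^sup>2 - K) \<le> h0 * g x * (1/2 * (K + v) + B\<^sup>2 * (1/2 * K))"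
      using h0 by (intro mult_left_mono) auto
    also have "\<dots> = h0 * g x * (1/2 * (K + v)) + B\<^sup>2 * (h0 * g x * (1/2 * K))" by (simp add: algebra_simps)
    also have "\<dots> \<le> Y + B\<^sup>2 * Y" by (intro add_mono mult_left_mono Y) auto
    also have "\<dots> \<le> 2 * B\<^sup>2 * Y" using B1 Y0 mult_right_mono[of 1 "B\<^sup>2" Y] by (simp add: one_le_power mult_ac)
    finally show ?thesis .
  qed
  have pow: "B ^ 4 \<le> B ^ 5" "B \<le> B ^ 5" "B ^ 3 \<le> B ^ 5"
    using B1 power_increasing[of 4 5 B] power_increasing[of 1 5 B] power_increasing[of 3 5 B] by auto
  have "a1 * kv + \<eta>' x * (2 * Vn + Vd) - \<epsilon> * B * (h0 * g x * N - 1/2 * (a1 * K) - h0 * g x * (kv + 1/2 * K\<^sup>2 - K))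
    = a1 * kv + (\<eta>' x * (2 * Vn) - \<epsilon> * B * (h0 * g x * N)) + \<eta>' x * Vd + \<epsilon> * B * (1/2 * (a1 * K)) + \<epsilon> * B * (h0 * g x * (kv + 1/2 * K\<^sup>2 - K))"
    by (simp add: algebra_simps)
  also have "\<dots> \<le> \<epsilon> * (11 * B ^ 4 * Y) + \<epsilon> * (B * Y) + \<epsilon> * (B * Y) + \<epsilon> * B * (11 * B ^ 4 * Y) + \<epsilon> * B * (2 * B\<^sup>2 * Y)"
    using 1 2 3 \<epsilon> B1 by (intro add_mono mult_left_mono 5 6) auto
  also have "\<dots> = \<epsilon> * Y * (11 * B ^ 4 + 2 * B + 11 * B ^ 5 + 2 * B ^ 3)" by (simp add: algebra_simps eval_nat_numeral)
  also have "\<dots> \<le> \<epsilon> * Y * (30 * B ^ 5)" using pow B1 \<epsilon> Y0 by (intro mult_left_mono) auto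
  finally have main: "a1 * kv + \<eta>' x * (2 * Vn + Vd) - \<epsilon> * B * (h0 * g x * N - 1/2 * (a1 * K) - h0 * g x * (kv + 1/2 * K\<^sup>2 - K))
      \<le> 30 * B ^ 5 * \<epsilon> * Y" by (simp add: mult_ac)
  have dens: "h0 * density e x = h0 * g x * (1/2 * (K + d))"
    unfolding density_def K_def d_def by (simp add: power2_norm_eq_inner)
  have YY: "30 * B ^ 5 * \<epsilon> * Y = 30 * B ^ 5 * \<epsilon> * (h0 * density e x) + 30 * B ^ 5 * \<epsilon> * (h0 * g x * v)"
    unfolding dens Y_def by (simp add: algebra_simps)
  show ?thesis
  proof (rule that, rule weighted_dissipation_identity[OF h])
    show "\<eta> x * density_pq' e (Dx c x) (Dx (Dx c) x) (Dx vel x) (Dx (Dx vel) x)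
      \<le> \<eta> x * density_pq' e (Dx c x) (Dx (Dx c) x) (Dx vel x) (Dx (Dx vel) x) + \<eta> x * g x * (vel x \<bullet> vel x)
      - (\<eta>'' * inverse (g x) - \<eta>' x * (inverse (g x) ^ 3 * (Dx c x \<bullet> Dx (Dx c) x))) * (kap x \<bullet> vel x)
      - \<eta>' x * (2 * (vel x \<bullet> nk x) + vel x \<bullet> (e - tau x))
      + \<epsilon> * B * (\<eta> x * g x * (nk x \<bullet> nk x) - 1/2 * ((\<eta>'' * inverse (g x) - \<eta>' x * (inverse (g x) ^ 3 * (Dx c x \<bullet> Dx (Dx c) x))) * (kap x \<bullet> kap x))
          - \<eta> x * g x * (kap x \<bullet> vel x + 1/2 * (kap x \<bullet> kap x)\<^sup>2 - kap x \<bullet> kap x))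
      - (1 - 30 * B ^ 5 * \<epsilon>) * (\<eta> x * (g x * (vel x \<bullet> vel x))) + 30 * B ^ 5 * \<epsilon> * (\<eta> x * density e x)"
      using main[unfolded YY]
      unfolding a1_def[symmetric] h0_def[symmetric] K_def[symmetric] v_def[symmetric] N_def[symmetric]
        kv_def[symmetric] Vn_def[symmetric] Vd_def[symmetric]
      by (simp add: left_diff_distrib mult.assoc)
  qed
qed

lemma weighted_flux_bound:
  assumes B1: "B \<ge> 1"
    and B: "1 \<le> B * g x" "norm (kap x) \<le> B" "norm (nk x) \<le> B" "norm (vel x) \<le> B"
      "norm (Ds c vel x) \<le> B" "norm (force x + e) \<le> B"
    and \<epsilon>: "0 < \<epsilon>" "\<epsilon> \<le> 1"
    and hb: "0 \<le> \<eta> x" "\<bar>\<eta>' x\<bar> \<le> \<epsilon> * \<eta> x"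
  shows "\<bar>weighted_flux B \<epsilon> e \<eta> \<eta>' x\<bar> \<le> 6 * B ^ 4 * \<eta> x"
proof -
  have ip: "\<bar>p \<bullet> q\<bar> \<le> B\<^sup>2" if "norm p \<le> B" "norm q \<le> B" for p q :: 'a
    using Cauchy_Schwarz_ineq2[of p q] mult_mono[OF that] B1 by (simp add: power2_eq_square)
  have r: "inverse (g x) \<le> B" using B(1) immersed[of x] by (simp add: field_simps)
  define a where "a = \<eta>' x * inverse (g x)"
  have "\<bar>a\<bar> = \<bar>\<eta>' x\<bar> * inverse (g x)" by (simp add: a_def abs_mult)
  also have "\<dots> \<le> (1 * \<eta> x) * B"
    using \<epsilon> hb mult_right_mono[OF \<epsilon>(2) hb(1)] r B1 by (intro mult_mono) auto
  finally have a: "\<bar>a\<bar> \<le> \<eta> x * B" by simp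
  have fl: "\<bar>flux e x\<bar> \<le> 2 * B\<^sup>2"
    using ip[of "kap x" "Ds c vel x"] ip[of "vel x" "force x + e"] B unfolding flux_def by linarith
  have t1: "\<bar>\<eta> x * flux e x\<bar> \<le> \<eta> x * (2 * B\<^sup>2)"
    unfolding abs_mult using hb fl by (intro mult_mono) auto
  have t2: "\<bar>a * (kap x \<bullet> vel x)\<bar> \<le> \<eta> x * B * B\<^sup>2"
    unfolding abs_mult using hb B1 ip[of "kap x" "vel x"] B by (intro mult_mono a) auto
  have t3: "\<bar>\<eta> x * (kap x \<bullet> nk x)\<bar> \<le> \<eta> x * B\<^sup>2"
    unfolding abs_mult using hb B1 ip[of "kap x" "nk x"] B by (intro mult_mono) auto
  have t4: "\<bar>a * (kap x \<bullet> kap x)\<bar> \<le> \<eta> x * B * B\<^sup>2"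
    unfolding abs_mult using hb B1 ip[of "kap x" "kap x"] B by (intro mult_mono a) auto
  have eB: "0 \<le> \<epsilon> * B" "\<epsilon> * B \<le> B" using \<epsilon> B1 mult_right_mono[OF \<epsilon>(2), of B] by auto
  have t5: "\<bar>\<epsilon> * B * (\<eta> x * (kap x \<bullet> nk x) - 1/2 * (a * (kap x \<bullet> kap x)))\<bar> 
     \<le> B * (\<eta> x * B\<^sup>2 + 1/2 * (\<eta> x * B * B\<^sup>2))"
    unfolding abs_mult[of "\<epsilon> * B"] using eB t3 t4 B1 by (intro mult_mono) auto
  have "\<bar>weighted_flux B \<epsilon> e \<eta> \<eta>' x\<bar> \<le> \<eta> x * (2 * B\<^sup>2) + \<eta> x * B * B\<^sup>2 + B * (\<eta> x * B\<^sup>2 + 1/2 * (\<eta> x * B * B\<^sup>2))"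
    using t1 t2 t5 unfolding weighted_flux_def a_def[symmetric] by linarith
  also have "\<dots> = \<eta> x * (2 * B^2 + 2 * B^3 + 1/2 * B^4)" by (simp add: algebra_simps eval_nat_numeral)
  finally have tot: "\<bar>weighted_flux B \<epsilon> e \<eta> \<eta>' x\<bar> \<le> \<eta> x * (2 * B^2 + 2 * B^3 + 1/2 * B^4)" .
  have B4: "0 \<le> B ^ 4" by simp
  have "2 * B^2 + 2 * B^3 + 1/2 * B^4 \<le> 6 * B^4"
    using B4 power_increasing[OF _ B1, of 2 4] power_increasing[OF _ B1, of 3 4] by linarith
  then have end_le: "\<eta> x * (2 * B^2 + 2 * B^3 + 1/2 * B^4) \<le> \<eta> x * (6 * B^4)"
    using hb by (intro mult_left_mono) auto
  note tot
  also note end_le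
  finally show ?thesis by (simp add: mult_ac)
qed

end

section \<open>Smooth families of curves\<close>

lemma smooth_stripD:
  assumes "smooth_strip J u" "t \<in> J"
  shows smooth_strip_smooth: "smooth (u t)"
    and smooth_strip_Dx: "((\<lambda>\<xi>. Dtx J a b u t \<xi>) has_vector_derivative Dx (Dtx J a b u t) x) (at x)"
    and smooth_strip_Dt: "((\<lambda>\<tau>. Dtx J a b u \<tau> x) has_vector_derivative Dtx J (Suc a) b u t x) (at t within J)"
proof -
  have "(\<lambda>\<xi>. Dtx J 0 k u t \<xi>) differentiable (at x)" for k x
    using assms unfolding smooth_strip_def by blast
  then show "smooth (u t)" unfolding smooth_def Dtx_def by simp
  show "((\<lambda>\<xi>. Dtx J a b u t \<xi>) has_vector_derivative Dx (Dtx J a b u t) x) (at x)"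
    using assms unfolding smooth_strip_def Dx_def vector_derivative_works[symmetric] by blast
  have "(\<lambda>\<tau>. Dtx J a b u \<tau> x) differentiable (at t within J)"
    using assms unfolding smooth_strip_def by blast
  then show "((\<lambda>\<tau>. Dtx J a b u \<tau> x) has_vector_derivative Dtx J (Suc a) b u t x) (at t within J)"
    by (simp add: vector_derivative_works Dtx_def Dt_def)
qed

lemma smooth_strip_continuous:
  assumes "smooth_strip J u"
  shows "continuous_on (J \<times> UNIV) (\<lambda>(t, x). Dtx J a b u t x)"
  using assms unfolding smooth_strip_def by blast

text \<open>Differentiating \<open>\<partial>\<^sub>x\<^sup>b u(t,y) = \<partial>\<^sub>x\<^sup>b u(t,y\<^sub>0) + \<integral> \<partial>\<^sub>x\<^sup>b\<^sup>+\<^sup>1 u(t,\<xi>) d\<xi>\<close> in \<open>t\<close> under the integral sign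
  and then in \<open>y\<close> shows that a time derivative commutes with space derivatives.\<close>

lemma Dx_Dt_commute:
  fixes u :: "real \<Rightarrow> real \<Rightarrow> 'a::euclidean_space"
  assumes u: "smooth_strip {0..T} u" and T: "0 < T" and t: "t \<in> {0..T}"
  shows "Dx (Dtx {0..T} 1 b u t) x = Dtx {0..T} 1 (Suc b) u t x"
proof -
  define J where "J = {0..T}"
  note u = u[folded J_def] and t = t[folded J_def]
  have Dx0: "((\<lambda>\<xi>. Dtx J 0 b u \<tau> \<xi>) has_vector_derivative Dtx J 0 (Suc b) u \<tau> y) (at y)" if "\<tau> \<in> J" for \<tau> y
    using smooth_strip_Dx[OF u that, of 0 b y] by (simp add: Dtx_def)
  have cont: "continuous_on (J \<times> {x-1..y}) (\<lambda>(t, x). Dtx J 1 (Suc b) u t x)" for y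
    using smooth_strip_continuous[OF u] by (rule continuous_on_subset) auto
  have ftc: "Dtx J 0 b u \<tau> y = Dtx J 0 b u \<tau> (x-1) + integral (cbox (x-1) y) (Dtx J 0 (Suc b) u \<tau>)"
    and int: "Dtx J 0 (Suc b) u \<tau> integrable_on cbox (x-1) y"
    if \<tau>: "\<tau> \<in> J" and y: "x - 1 \<le> y" for \<tau> y
  proof -
    have "(Dtx J 0 (Suc b) u \<tau> has_integral Dtx J 0 b u \<tau> y - Dtx J 0 b u \<tau> (x-1)) {x-1..y}"
      by (rule fundamental_theorem_of_calculus[OF y has_vector_derivative_at_within[OF Dx0[OF \<tau>]]])
    then show "Dtx J 0 b u \<tau> y = Dtx J 0 b u \<tau> (x-1) + integral (cbox (x-1) y) (Dtx J 0 (Suc b) u \<tau>)"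
      "Dtx J 0 (Suc b) u \<tau> integrable_on cbox (x-1) y"
      by (auto simp: integral_unique has_integral_integrable)
  qed
  have eq: "Dtx J 1 b u t y = Dtx J 1 b u t (x-1) + integral {x-1..y} (Dtx J 1 (Suc b) u t)" if y: "x - 1 \<le> y" for y
  proof -
    have "((\<lambda>\<tau>. integral (cbox (x-1) y) (Dtx J 0 (Suc b) u \<tau>)) has_vector_derivative
        integral (cbox (x-1) y) (Dtx J 1 (Suc b) u t)) (at t within J)"
      using smooth_strip_Dt[OF u] int[OF _ y] cont t
      by (intro leibniz_rule_vector_derivative) (auto simp: J_def)
    then have "((\<lambda>\<tau>. Dtx J 0 b u \<tau> (x-1) + integral (cbox (x-1) y) (Dtx J 0 (Suc b) u \<tau>)) has_vector_derivative
        Dtx J 1 b u t (x-1) + integral (cbox (x-1) y) (Dtx J 1 (Suc b) u t)) (at t within J)"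
      using smooth_strip_Dt[OF u t] by (intro has_vector_derivative_add) auto
    then have "((\<lambda>\<tau>. Dtx J 0 b u \<tau> y) has_vector_derivative
        Dtx J 1 b u t (x-1) + integral (cbox (x-1) y) (Dtx J 1 (Suc b) u t)) (at t within J)"
      by (rule has_vector_derivative_transform[rotated 2]) (intro t ftc y | assumption)+
    moreover have "((\<lambda>\<tau>. Dtx J 0 b u \<tau> y) has_vector_derivative Dtx J 1 b u t y) (at t within J)"
      using smooth_strip_Dt[OF u t] by simp
    ultimately show ?thesis
      using T t unfolding J_def by (metis box_real(2) vector_derivative_unique_within_closed_interval)
  qed
  have "((\<lambda>y. Dtx J 1 b u t (x-1) + integral {x-1..y} (Dtx J 1 (Suc b) u t)) has_vector_derivative
      0 + Dtx J 1 (Suc b) u t x) (at x within {x-1..x+1})"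
  proof (rule has_vector_derivative_add[OF has_vector_derivative_const integral_has_vector_derivative])
    show "continuous_on {x - 1..x + 1} (Dtx J 1 (Suc b) u t)"
      using continuous_on_compose2[OF cont[of "x+1"] continuous_on_Pair[OF continuous_on_const[of _ t] continuous_on_id],
          of "{x-1..x+1}"] t by auto
  qed auto
  then have "((\<lambda>y. Dtx J 1 b u t y) has_vector_derivative 0 + Dtx J 1 (Suc b) u t x) (at x within {x-1..x+1})"
    by (rule has_vector_derivative_transform[rotated 2]) (rule eq | simp)+
  moreover have "at x within {x-1..x+1} = at x" by (rule at_within_interior) simp
  ultimately have "((\<lambda>y. Dtx J 1 b u t y) has_vector_derivative Dtx J 1 (Suc b) u t x) (at x)" by simp
  then show ?thesis unfolding J_def by (rule Dx_eq)
qed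

section \<open>Uniform bounds along the flow\<close>

locale elastic_flow =
  fixes \<gamma>0 :: "real \<Rightarrow> 'a::euclidean_space" and T :: real and \<gamma> :: "real \<Rightarrow> real \<Rightarrow> 'a" and e :: 'a
  assumes flow: "elastic_flow_on \<gamma>0 T \<gamma>" and T_pos: "0 < T" and profile: "\<gamma>0 \<in> dot_Cinf"
    and unit_e: "norm e = 1"
begin

abbreviation "J \<equiv> {0..T}"

abbreviation speed :: "real \<Rightarrow> real \<Rightarrow> real" where "speed t x \<equiv> norm (Dx (\<gamma> t) x)"
abbreviation velocity :: "real \<Rightarrow> real \<Rightarrow> 'a" where "velocity t \<equiv> immersed_curve.vel (\<gamma> t)"
abbreviation edens :: "real \<Rightarrow> real \<Rightarrow> real" where "edens t \<equiv> immersed_curve.density (\<gamma> t) e"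

lemma strip: "smooth_strip J \<gamma>"
  using flow by (simp add: elastic_flow_on_def)

lemma initial: "\<gamma> 0 = \<gamma>0"
  using flow by (auto simp: elastic_flow_on_def)

lemma speed_lower: obtains m where "m > 0" "\<And>t x. t \<in> J \<Longrightarrow> m \<le> speed t x"
proof (rule that)
  show "(INF (t, x)\<in>J \<times> UNIV. speed t x) > 0" using flow by (simp add: elastic_flow_on_def)
  fix t x assume "t \<in> J"
  then have "(INF (t, x)\<in>J \<times> UNIV. speed t x) \<le> (\<lambda>(t, x). speed t x) (t, x)"
    by (intro cINF_lower bdd_belowI[where m = 0]) auto
  then show "(INF (t, x)\<in>J \<times> UNIV. speed t x) \<le> speed t x" by simp
qed

lemma curve: "t \<in> J \<Longrightarrow> immersed_curve (\<gamma> t)"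
proof
  assume t: "t \<in> J"
  then show "smooth (\<gamma> t)" by (rule smooth_strip_smooth[OF strip])
  fix x
  obtain m where "m > 0" "m \<le> speed t x" using speed_lower t by metis
  then show "Dx (\<gamma> t) x \<noteq> 0" by auto
qed

lemma velocity_eq: "t \<in> J \<Longrightarrow> Dt J \<gamma> t x = velocity t x"
proof -
  assume t: "t \<in> J"
  interpret immersed_curve "\<gamma> t" by (rule curve[OF t])
  show ?thesis using flow t unfolding vel_def Ds_force
    by (simp add: elastic_flow_on_def power2_norm_eq_inner algebra_simps)
qed

lemma Dt_space_derivatives:
  assumes "t \<in> J"
  shows "Dtx J 1 0 \<gamma> t x = velocity t x" "Dtx J 1 1 \<gamma> t x = Dx (velocity t) x"
    "Dtx J 1 2 \<gamma> t x = Dx (Dx (velocity t)) x"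
proof -
  have 0: "Dtx J 1 0 \<gamma> t = velocity t" 
    using velocity_eq[OF assms] by (auto simp: Dtx_def Dt_def)
  then show "Dtx J 1 0 \<gamma> t x = velocity t x" by simp
  have 1: "Dtx J 1 1 \<gamma> t = Dx (velocity t)"
    using Dx_Dt_commute[OF strip T_pos assms, of 0] unfolding 0 by auto
  then show "Dtx J 1 1 \<gamma> t x = Dx (velocity t) x" by simp
  show "Dtx J 1 2 \<gamma> t x = Dx (Dx (velocity t)) x"
    using Dx_Dt_commute[OF strip T_pos assms, of 1] unfolding 1 by (simp add: numeral_2_eq_2)
qed

lemma funpow_Dx_diff:
  assumes "smooth u" "smooth v"
  shows "(Dx ^^ k) (\<lambda>x. u x - v x) = (\<lambda>x. (Dx ^^ k) u x - (Dx ^^ k) v x)"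
  using assms
proof (induction k arbitrary: u v)
  case (Suc k)
  have "Dx (\<lambda>x. u x - v x) = (\<lambda>x. Dx u x - Dx v x)"
    by (rule Dx_eqI) (intro has_vector_derivative_diff smooth_has_derivative Suc.prems)
  then show ?case using Suc.IH[of "Dx u" "Dx v"] Suc.prems by (auto simp: funpow_Suc_right simp del: funpow.simps)
qed simp

lemma derivative_bound:
  assumes b: "b \<ge> 1" shows "\<exists>M. \<forall>t\<in>J. \<forall>x. norm ((Dx ^^ b) (\<gamma> t) x) \<le> M"
proof -
  define w where "w = (\<lambda>t x. \<gamma> t x - \<gamma>0 x)"
  have sm: "smooth \<gamma>0" using profile by (simp add: dot_Cinf_def)
  have "bounded ((\<lambda>(t, x). Dtx J 0 b w t x) ` (J \<times> UNIV))"
    using flow unfolding elastic_flow_on_def Cinf_strip_def w_def by blast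
  then obtain M1 where M1: "\<forall>t\<in>J. \<forall>x. norm (Dtx J 0 b w t x) \<le> M1"
    unfolding bounded_iff by fastforce
  obtain M2 where M2: "\<forall>x. norm ((Dx ^^ b) \<gamma>0 x) \<le> M2"
    using profile b unfolding dot_Cinf_def bounded_iff by auto
  have "norm ((Dx ^^ b) (\<gamma> t) x) \<le> M1 + M2" if t: "t \<in> J" for t x
  proof -
    have "Dtx J 0 b w t x = (Dx ^^ b) (\<gamma> t) x - (Dx ^^ b) \<gamma>0 x"
      unfolding Dtx_def w_def using funpow_Dx_diff[OF smooth_strip_smooth[OF strip t] sm] by simp
    then have "(Dx ^^ b) (\<gamma> t) x = Dtx J 0 b w t x + (Dx ^^ b) \<gamma>0 x" by simp
    then show ?thesis using norm_triangle_le[OF add_mono] M1 M2 t by metis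
  qed
  then show ?thesis by blast
qed

lemma velocity_bound: "\<exists>M. \<forall>t\<in>J. \<forall>x. norm (velocity t x) \<le> M \<and> norm (Dx (velocity t) x) \<le> M"
proof -
  define w where "w = (\<lambda>t x. \<gamma> t x - \<gamma>0 x)"
  have sm: "smooth \<gamma>0" using profile by (simp add: dot_Cinf_def)
  have w1: "Dtx J 1 b w t x = Dtx J 1 b \<gamma> t x" if t: "t \<in> J" for b t x
  proof -
    have "((\<lambda>\<tau>. Dtx J 0 b \<gamma> \<tau> x - (Dx ^^ b) \<gamma>0 x) has_vector_derivative Dtx J 1 b \<gamma> t x) (at t within J)"
      using has_vector_derivative_diff[OF smooth_strip_Dt[OF strip t, of 0 b x] has_vector_derivative_const] by simp
    then have "((\<lambda>\<tau>. Dtx J 0 b w \<tau> x) has_vector_derivative Dtx J 1 b \<gamma> t x) (at t within J)"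
      by (rule has_vector_derivative_transform[OF t, rotated])
        (simp add: Dtx_def w_def funpow_Dx_diff[OF smooth_strip_smooth[OF strip] sm])
    moreover have "smooth_strip J w" using flow unfolding elastic_flow_on_def Cinf_strip_def w_def by blast
    then have "((\<lambda>\<tau>. Dtx J 0 b w \<tau> x) has_vector_derivative Dtx J 1 b w t x) (at t within J)"
      using smooth_strip_Dt t by fastforce
    ultimately show ?thesis
      using T_pos t by (metis box_real(2) vector_derivative_unique_within_closed_interval)
  qed
  have "bounded ((\<lambda>(t, x). Dtx J 1 b w t x) ` (J \<times> UNIV))" for b
    using flow unfolding elastic_flow_on_def Cinf_strip_def w_def by blast
  then have "\<exists>M. \<forall>t\<in>J. \<forall>x. norm (Dtx J 1 b w t x) \<le> M" for b
    unfolding bounded_iff by fastforce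
  then obtain M where "\<forall>t\<in>J. \<forall>x. norm (Dtx J 1 b \<gamma> t x) \<le> M b" for b
    using w1 by metis
  then have "\<forall>t\<in>J. \<forall>x. norm (velocity t x) \<le> max (M 0) (M 1) \<and> norm (Dx (velocity t) x) \<le> max (M 0) (M 1)"
    using Dt_space_derivatives by (metis max.coboundedI1 max.coboundedI2)
  then show ?thesis by blast
qed

lemma uniform_bounds:
  obtains B where "B \<ge> 1"
    "\<And>t x. t \<in> J \<Longrightarrow> 1 \<le> B * speed t x"
    "\<And>t x. t \<in> J \<Longrightarrow> norm (Dx (Dx (\<gamma> t)) x) \<le> B"
    "\<And>t x. t \<in> J \<Longrightarrow> norm (curvature (\<gamma> t) x) \<le> B"
    "\<And>t x. t \<in> J \<Longrightarrow> norm (nabla_s (\<gamma> t) (curvature (\<gamma> t)) x) \<le> B"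
    "\<And>t x. t \<in> J \<Longrightarrow> norm (velocity t x) \<le> B"
    "\<And>t x. t \<in> J \<Longrightarrow> norm (Ds (\<gamma> t) (velocity t) x) \<le> B"
    "\<And>t x. t \<in> J \<Longrightarrow> norm (immersed_curve.force (\<gamma> t) x + e) \<le> B"
proof -
  obtain m where m: "m > 0" "\<And>t x. t \<in> J \<Longrightarrow> m \<le> speed t x"
    using speed_lower by blast
  obtain M1 where M1: "\<And>t x. t \<in> J \<Longrightarrow> speed t x \<le> M1"
    using derivative_bound[of 1, simplified] by blast
  obtain M2 where M2: "\<And>t x. t \<in> J \<Longrightarrow> norm (Dx (Dx (\<gamma> t)) x) \<le> M2"
    using derivative_bound[of 2, simplified eval_nat_numeral, simplified] by blast
  obtain M3 where M3: "\<And>t x. t \<in> J \<Longrightarrow> norm (Dx (Dx (Dx (\<gamma> t))) x) \<le> M3"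
    using derivative_bound[of 3, simplified eval_nat_numeral, simplified] by blast
  obtain Mv where Mv: "\<And>t x. t \<in> J \<Longrightarrow> norm (velocity t x) \<le> Mv" "\<And>t x. t \<in> J \<Longrightarrow> norm (Dx (velocity t) x) \<le> Mv"
    using velocity_bound by blast
  define M where "M = Max {1, inverse m, M1, M2, M3, Mv}"
  have M: "1 \<le> M" "inverse m \<le> M" "M1 \<le> M" "M2 \<le> M" "M3 \<le> M" "Mv \<le> M"
    unfolding M_def by (rule Max_ge; simp)+
  have lower: "1 \<le> M * speed t x" if "t \<in> J" for t x
    using mult_mono[OF M(2) m(2)[OF that, of x]] m(1) M(1) by simp
  note le = M1[THEN order_trans, OF _ M(3)] M2[THEN order_trans, OF _ M(4)] M3[THEN order_trans, OF _ M(5)]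
     Mv[THEN order_trans, OF _ M(6)]
  have k: "norm (curvature (\<gamma> t) x) \<le> M ^ 3" if "t \<in> J" for t x
    using immersed_curve.norm_kap_le[OF curve[OF that] lower[OF that] le(2)[OF that]] M by simp
  have n: "norm (nabla_s (\<gamma> t) (curvature (\<gamma> t)) x) \<le> 4 * M ^ 8" if "t \<in> J" for t x
    by (rule immersed_curve.norm_nk_le[OF curve[OF that] lower[OF that] le(1)[OF that] le(2)[OF that] le(3)[OF that] M(1)])
  have d: "norm (Ds (\<gamma> t) (velocity t) x) \<le> M * M" if "t \<in> J" for t x
  proof -
    have "inverse (speed t x) \<le> M" using lower[OF that, of x] immersed_curve.immersed[OF curve[OF that], of x]
      by (simp add: inverse_eq_divide pos_divide_le_eq)
    then show ?thesis unfolding Ds_def using le(5)[OF that, of x] M(1) by (auto intro!: mult_mono)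
  qed
  have f: "norm (immersed_curve.force (\<gamma> t) x + e) \<le> 4 * M ^ 8 + (1/2 * (M^3)\<^sup>2 + 1) + 1" if "t \<in> J" for t x
  proof -
    interpret immersed_curve "\<gamma> t" by (rule curve[OF that])
    have "norm (force x + e) \<le> norm (nk x) + norm ((1/2 * (kap x \<bullet> kap x) - 1) *\<^sub>R tau x) + norm e"
      unfolding force_def by (intro norm_triangle_mono) auto
    also have "norm ((1/2 * (kap x \<bullet> kap x) - 1) *\<^sub>R tau x) = \<bar>1/2 * (norm (kap x))\<^sup>2 - 1\<bar>"
      by (simp add: norm_tau power2_norm_eq_inner)
    also have "\<dots> \<le> 1/2 * (norm (kap x))\<^sup>2 + 1" by (simp add: abs_le_iff)
    also have "\<dots> \<le> 1/2 * (M^3)\<^sup>2 + 1" using power_mono[OF k[OF that, of x], of 2] by simp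
    finally show ?thesis using n[OF that, of x] unit_e by simp
  qed
  define B where "B = 7 * M ^ 8"
  have p: "M \<le> M ^ 8" "M ^ 3 \<le> M ^ 8" "M * M \<le> M ^ 8" "(M^3)\<^sup>2 \<le> M ^ 8" "1 \<le> M ^ 8"
    using M(1) power_increasing[of 1 8 M] power_increasing[of 3 8 M] power_increasing[of 2 8 M] power_increasing[of 6 8 M]
      one_le_power[of M 8]
    by (auto simp: power2_eq_square simp flip: power_add)
  have Bge: "1 \<le> B" "M \<le> B" "M ^ 3 \<le> B" "4 * M ^ 8 \<le> B" "M * M \<le> B" "4 * M ^ 8 + (1/2 * (M^3)\<^sup>2 + 1) + 1 \<le> B"
    unfolding B_def using p by linarith+
  show ?thesis
  proof (rule that[of B])
    fix t x assume t: "t \<in> J"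
    have "M * speed t x \<le> B * speed t x" using Bge by (intro mult_right_mono) auto
    then show "1 \<le> B * speed t x" using lower[OF t, of x] by linarith
  qed (rule Bge(1) order_trans[OF le(2) Bge(2)] order_trans[OF k Bge(3)] order_trans[OF n Bge(4)]
      order_trans[OF le(4) Bge(2)] order_trans[OF d Bge(5)] order_trans[OF f Bge(6)] | assumption)+
qed

lemma curve_derivatives:
  "Dtx J 0 1 \<gamma> t x = Dx (\<gamma> t) x" "Dtx J 0 2 \<gamma> t x = Dx (Dx (\<gamma> t)) x"
  by (simp_all add: Dtx_def eval_nat_numeral)

abbreviation production :: "real \<Rightarrow> real \<Rightarrow> real" where
  "production t x \<equiv> density_pq' e (Dx (\<gamma> t) x) (Dx (Dx (\<gamma> t)) x) (Dx (velocity t) x) (Dx (Dx (velocity t)) x)"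

lemma production_continuous: "continuous_on (J \<times> UNIV) (\<lambda>(t, x). production t x)"
proof -
  have "continuous_on (J \<times> UNIV) (\<lambda>z. density_pq' e (case_prod (Dtx J 0 1 \<gamma>) z) (case_prod (Dtx J 0 2 \<gamma>) z)
      (case_prod (Dtx J 1 1 \<gamma>) z) (case_prod (Dtx J 1 2 \<gamma>) z))"
    unfolding density_pq'_def Let_def
    by (intro continuous_intros smooth_strip_continuous[OF strip])
      (use immersed_curve.immersed[OF curve] curve_derivatives in auto)
  then show ?thesis
    by (rule continuous_on_cong[THEN iffD1, OF refl, rotated])
      (auto simp: curve_derivatives Dt_space_derivatives simp del: One_nat_def)
qed

lemma edens_eq: "t \<in> J \<Longrightarrow> edens t x = density_pq e (Dx (\<gamma> t) x) (Dx (Dx (\<gamma> t)) x)"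
  by (rule immersed_curve.density_eq_pq[OF curve unit_e])

lemma edens_continuous: "t \<in> J \<Longrightarrow> continuous_on S (edens t)"
proof -
  assume t: "t \<in> J"
  interpret immersed_curve "\<gamma> t" by (rule curve[OF t])
  show ?thesis unfolding density_def[abs_def]
    by (intro continuous_intros smooth_continuous smooth_kap smooth_tau smooth_g)
qed

lemma edens_derivative:
  assumes t: "t \<in> J"
  shows "((\<lambda>t. edens t x) has_vector_derivative production t x) (at t within J)"
proof -
  have "((\<lambda>t. density_pq e (Dtx J 0 1 \<gamma> t x) (Dtx J 0 2 \<gamma> t x)) has_vector_derivative
     density_pq' e (Dtx J 0 1 \<gamma> t x) (Dtx J 0 2 \<gamma> t x) (Dtx J 1 1 \<gamma> t x) (Dtx J 1 2 \<gamma> t x)) (at t within J)"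
  proof (rule density_pq_derivative)
    show "Dtx J 0 1 \<gamma> t x \<noteq> 0"
      unfolding curve_derivatives by (rule immersed_curve.immersed[OF curve[OF t]])
  qed (use smooth_strip_Dt[OF strip t, of 0] in simp_all)
  then show ?thesis
    unfolding curve_derivatives Dt_space_derivatives[OF t]
    by (rule has_vector_derivative_transform[OF t, rotated]) (rule edens_eq)
qed

lemma weighted_energy_derivative:
  assumes \<eta>: "continuous_on UNIV \<eta>" and t: "t \<in> J"
  shows "((\<lambda>t. integral {-S..S} (\<lambda>x. \<eta> x * edens t x)) has_vector_derivative
     integral {-S..S} (\<lambda>x. \<eta> x * production t x)) (at t within J)"
proof -
  have "continuous_on (J \<times> {-S..S}) (\<lambda>z. \<eta> (snd z) * (\<lambda>(t, x). production t x) z)"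
    by (intro continuous_intros continuous_on_compose2[OF \<eta>] continuous_on_subset[OF production_continuous]) auto
  then have "continuous_on (J \<times> cbox (-S) S) (\<lambda>(t, x). \<eta> x * production t x)"
    by (simp add: case_prod_beta')
  moreover have "(\<lambda>x. \<eta> x * edens t x) integrable_on cbox (-S) S" if "t \<in> J" for t
    by (rule integrable_continuous) (intro continuous_intros edens_continuous that continuous_on_subset[OF \<eta>], simp)
  ultimately have "((\<lambda>t. integral (cbox (-S) S) (\<lambda>x. \<eta> x * edens t x)) has_vector_derivative
     integral (cbox (-S) S) (\<lambda>x. \<eta> x * production t x)) (at t within J)"
    using t by (intro leibniz_rule_vector_derivative has_vector_derivative_mult_right edens_derivative) auto
  then show ?thesis by simp
qed

end

section \<open>The energy inequality\<close>

text \<open>A weight whose first two derivatives are of order \<open>\<epsilon>\<close> relative to the weight itself, which is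
  small far out and tends to \<open>1\<close> locally as \<open>\<epsilon> \<rightarrow> 0\<close>.\<close>

definition weight :: "real \<Rightarrow> real \<Rightarrow> real" where "weight \<epsilon> x = inverse (1 + (\<epsilon> * x)\<^sup>2)"
definition weight' :: "real \<Rightarrow> real \<Rightarrow> real" where "weight' \<epsilon> x = - 2 * \<epsilon>\<^sup>2 * x * (weight \<epsilon> x)\<^sup>2"

lemma weight_pos: "weight \<epsilon> x > 0" and weight_le_1: "weight \<epsilon> x \<le> 1"
  and weight_antimono: "\<bar>x\<bar> \<le> \<bar>y\<bar> \<Longrightarrow> weight \<epsilon> y \<le> weight \<epsilon> x"
proof -
  have p: "1 + (\<epsilon> * x)\<^sup>2 > 0" for x by (simp add: add_pos_nonneg)
  then show "weight \<epsilon> x > 0" by (simp add: weight_def)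
  show "weight \<epsilon> x \<le> 1" by (simp add: weight_def inverse_le_1_iff)
  assume "\<bar>x\<bar> \<le> \<bar>y\<bar>"
  then have "\<bar>\<epsilon> * x\<bar> \<le> \<bar>\<epsilon> * y\<bar>" by (simp add: abs_mult mult_left_mono)
  then have "(\<epsilon> * x)\<^sup>2 \<le> (\<epsilon> * y)\<^sup>2" by (simp only: abs_le_square_iff)
  then show "weight \<epsilon> y \<le> weight \<epsilon> x" unfolding weight_def using p by (intro le_imp_inverse_le) auto
qed

lemma weight_derivative: "(weight \<epsilon> has_real_derivative weight' \<epsilon> x) (at x)"
proof -
  have "1 + (\<epsilon> * x)\<^sup>2 \<noteq> 0" by (metis add_pos_nonneg less_irrefl zero_le_power2 zero_less_one)
  then show ?thesis unfolding weight'_def weight_def[abs_def]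
    by (auto intro!: derivative_eq_intros simp: power2_eq_square)
qed

lemma weight'_derivative:
  "(weight' \<epsilon> has_real_derivative - 2 * \<epsilon>\<^sup>2 * (weight \<epsilon> x)\<^sup>2 + 8 * \<epsilon>^4 * x\<^sup>2 * (weight \<epsilon> x)^3) (at x)"
  unfolding weight'_def[abs_def]
  apply (rule derivative_eq_intros weight_derivative refl)+
  apply (simp add: weight'_def algebra_simps eval_nat_numeral)
  done

lemma weight_bounds:
  assumes "0 < \<epsilon>" "\<epsilon> \<le> 1"
  shows "\<bar>weight' \<epsilon> x\<bar> \<le> \<epsilon> * weight \<epsilon> x"
    "\<bar>- 2 * \<epsilon>\<^sup>2 * (weight \<epsilon> x)\<^sup>2 + 8 * \<epsilon>^4 * x\<^sup>2 * (weight \<epsilon> x)^3\<bar> \<le> 10 * \<epsilon> * weight \<epsilon> x"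
proof -
  define w y where "w = weight \<epsilon> x" and "y = \<epsilon> * x"
  have p: "1 + y\<^sup>2 > 0" by (simp add: add_pos_nonneg)
  have w: "0 < w" "w \<le> 1" using weight_pos weight_le_1 by (auto simp: w_def)
  have wy: "w * (1 + y\<^sup>2) = 1" using p by (simp add: w_def y_def weight_def)
  have y2: "y\<^sup>2 * w \<le> 1" using wy w by (simp add: algebra_simps)
  have "2 * \<bar>y\<bar> \<le> 1 + y\<^sup>2" using zero_le_power2[of "\<bar>y\<bar> - 1"] by (simp add: power2_diff)
  then have "(2 * \<bar>y\<bar>) * w \<le> (1 + y\<^sup>2) * w" using w by (intro mult_right_mono) auto
  then have y1: "2 * \<bar>y\<bar> * w \<le> 1" using wy by (simp add: mult.commute)
  have "\<bar>weight' \<epsilon> x\<bar> = \<epsilon> * w * (2 * \<bar>y\<bar> * w)"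
    using assms by (simp add: weight'_def w_def[symmetric] y_def abs_mult power2_eq_square mult_ac)
  also have "\<dots> \<le> \<epsilon> * w * 1" using y1 assms w by (intro mult_left_mono) auto
  finally show "\<bar>weight' \<epsilon> x\<bar> \<le> \<epsilon> * weight \<epsilon> x" by (simp add: w_def)
  have "- 2 * \<epsilon>\<^sup>2 * w\<^sup>2 + 8 * \<epsilon>^4 * x\<^sup>2 * w^3 = (\<epsilon>\<^sup>2 * w) * (- 2 * w + 8 * (y\<^sup>2 * w) * w)"
    unfolding y_def by algebra
  then have "\<bar>- 2 * \<epsilon>\<^sup>2 * w\<^sup>2 + 8 * \<epsilon>^4 * x\<^sup>2 * w^3\<bar> = \<epsilon>\<^sup>2 * w * \<bar>- 2 * w + 8 * (y\<^sup>2 * w) * w\<bar>"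
    using w by (simp add: abs_mult)
  also have "\<dots> \<le> \<epsilon>\<^sup>2 * w * 10"
  proof (intro mult_left_mono)
    define z where "z = (y\<^sup>2 * w) * w"
    have "z \<le> 1 * 1" unfolding z_def using y2 w by (intro mult_mono) auto
    moreover have "0 \<le> z" using w by (simp add: z_def)
    ultimately have "\<bar>- 2 * w + 8 * z\<bar> \<le> 10" using w by (simp add: abs_le_iff)
    then show "\<bar>- 2 * w + 8 * (y\<^sup>2 * w) * w\<bar> \<le> 10" by (simp add: z_def mult.assoc)
  qed (use w in auto)
  also have "\<epsilon>\<^sup>2 * w * 10 \<le> \<epsilon> * w * 10"
    using assms w mult_right_mono[of \<epsilon> 1 \<epsilon>] by (intro mult_right_mono) (auto simp: power2_eq_square)
  finally show "\<bar>- 2 * \<epsilon>\<^sup>2 * (weight \<epsilon> x)\<^sup>2 + 8 * \<epsilon>^4 * x\<^sup>2 * (weight \<epsilon> x)^3\<bar> \<le> 10 * \<epsilon> * weight \<epsilon> x"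
    by (simp add: w_def mult_ac)
qed

lemma weight_continuous: "continuous_on S (weight \<epsilon>)"
  using weight_derivative by (meson DERIV_isCont continuous_at_imp_continuous_on)

context elastic_flow
begin

lemma vel_sq_continuous: "t \<in> J \<Longrightarrow> continuous_on S (\<lambda>x. speed t x * (velocity t x \<bullet> velocity t x))"
proof -
  assume t: "t \<in> J"
  interpret immersed_curve "\<gamma> t" by (rule curve[OF t])
  show ?thesis by (intro continuous_intros smooth_continuous smooth_vel smooth_g)
qed

text \<open>Integrating the pointwise inequality over \<open>[-S,S]\<close>: the exact derivative only leaves boundary
  terms, which the weight makes small.\<close>

lemma weighted_production_le:
  obtains C where "C \<ge> 0"
    "\<And>\<epsilon> S t. 0 < \<epsilon> \<Longrightarrow> \<epsilon> \<le> 1 \<Longrightarrow> 0 \<le> S \<Longrightarrow> t \<in> J \<Longrightarrow>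
      integral {-S..S} (\<lambda>x. weight \<epsilon> x * production t x) \<le> C * weight \<epsilon> S
      - (1 - C * \<epsilon>) * integral {-S..S} (\<lambda>x. weight \<epsilon> x * (speed t x * (velocity t x \<bullet> velocity t x)))
      + C * \<epsilon> * integral {-S..S} (\<lambda>x. weight \<epsilon> x * edens t x)"
proof -
  obtain B where B1: "B \<ge> 1" and B:
    "\<And>t x. t \<in> J \<Longrightarrow> 1 \<le> B * speed t x"
    "\<And>t x. t \<in> J \<Longrightarrow> norm (Dx (Dx (\<gamma> t)) x) \<le> B"
    "\<And>t x. t \<in> J \<Longrightarrow> norm (curvature (\<gamma> t) x) \<le> B"
    "\<And>t x. t \<in> J \<Longrightarrow> norm (nabla_s (\<gamma> t) (curvature (\<gamma> t)) x) \<le> B"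
    "\<And>t x. t \<in> J \<Longrightarrow> norm (velocity t x) \<le> B"
    "\<And>t x. t \<in> J \<Longrightarrow> norm (Ds (\<gamma> t) (velocity t) x) \<le> B"
    "\<And>t x. t \<in> J \<Longrightarrow> norm (immersed_curve.force (\<gamma> t) x + e) \<le> B"
    using uniform_bounds by blast
  define C where "C = 30 * B ^ 5"
  have C0: "C \<ge> 0" using B1 by (simp add: C_def)
  have B45: "12 * B ^ 4 \<le> C" using power_increasing[OF _ B1, of 4 5] zero_le_power[OF order_trans[OF zero_le_one B1], of 5] unfolding C_def by linarith
  show ?thesis
  proof (rule that[OF C0])
    fix \<epsilon> S t assume \<epsilon>: "0 < \<epsilon>" "\<epsilon> \<le> (1::real)" and S: "0 \<le> (S::real)" and t: "t \<in> J"
    interpret immersed_curve "\<gamma> t" by (rule curve[OF t])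
    let ?v = "\<lambda>x. speed t x * (velocity t x \<bullet> velocity t x)"
    define \<Psi> where "\<Psi> = weighted_flux B \<epsilon> e (weight \<epsilon>) (weight' \<epsilon>)"
    have "\<exists>\<Psi>'. (\<Psi> has_real_derivative \<Psi>') (at x) \<and> weight \<epsilon> x * production t x
        \<le> \<Psi>' - (1 - C * \<epsilon>) * (weight \<epsilon> x * ?v x) + C * \<epsilon> * (weight \<epsilon> x * edens t x)" for x
      unfolding \<Psi>_def C_def
      by (rule weighted_dissipation[OF unit_e B1 B(1,2,3)[OF t] weight_derivative weight'_derivative \<epsilon>
          less_imp_le[OF weight_pos] weight_bounds[OF \<epsilon>], of x]) blast
    then obtain \<Psi>' where \<Psi>: "\<And>x. (\<Psi> has_real_derivative \<Psi>' x) (at x)" and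
      le: "\<And>x. weight \<epsilon> x * production t x
        \<le> \<Psi>' x - (1 - C * \<epsilon>) * (weight \<epsilon> x * ?v x) + C * \<epsilon> * (weight \<epsilon> x * edens t x)" by metis
    have i\<Psi>: "(\<Psi>' has_integral \<Psi> S - \<Psi> (-S)) {-S..S}"
      using S \<Psi> by (intro fundamental_theorem_of_calculus)
        (auto simp flip: has_real_derivative_iff_has_vector_derivative intro: has_field_derivative_at_within)
    have int: "(\<lambda>x. weight \<epsilon> x * f x) integrable_on {-S..S}" if "continuous_on {-S..S} f" for f
      by (intro integrable_continuous_interval continuous_intros weight_continuous that)
    have "continuous_on {-S..S} (production t)"
      using continuous_on_compose2[OF production_continuous continuous_on_Pair[OF continuous_on_const[of _ t] continuous_on_id], of "{-S..S}"]
        t by (simp add: image_subset_iff)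
    note ip = integrable_integral[OF int[OF this]] and ie = integrable_integral[OF int[OF edens_continuous[OF t]]]
      and iv = integrable_integral[OF int[OF vel_sq_continuous[OF t]]]
    have "integral {-S..S} (\<lambda>x. weight \<epsilon> x * production t x) \<le> (\<Psi> S - \<Psi> (-S))
       - (1 - C * \<epsilon>) * integral {-S..S} (\<lambda>x. weight \<epsilon> x * ?v x) + C * \<epsilon> * integral {-S..S} (\<lambda>x. weight \<epsilon> x * edens t x)"
      by (rule has_integral_le[OF ip has_integral_add[OF has_integral_diff[OF i\<Psi> has_integral_mult_right[OF iv]]
              has_integral_mult_right[OF ie]]]) (rule le)
    also have "\<Psi> S - \<Psi> (-S) \<le> C * weight \<epsilon> S"
    proof -
      have "\<bar>\<Psi> x\<bar> \<le> 6 * B ^ 4 * weight \<epsilon> x" for x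
        unfolding \<Psi>_def 
        by (rule weighted_flux_bound) (rule B1 B(1,3-7)[OF t] \<epsilon> less_imp_le[OF weight_pos] weight_bounds(1)[OF \<epsilon>])+
      from this[of S] this[of "-S"] have "\<Psi> S - \<Psi> (-S) \<le> 12 * B ^ 4 * weight \<epsilon> S"
        by (simp add: weight_def)
      also have "\<dots> \<le> C * weight \<epsilon> S" using B45 weight_pos[of \<epsilon> S] by (intro mult_right_mono) auto
      finally show ?thesis .
    qed
    finally show "integral {-S..S} (\<lambda>x. weight \<epsilon> x * production t x) \<le> C * weight \<epsilon> S
      - (1 - C * \<epsilon>) * integral {-S..S} (\<lambda>x. weight \<epsilon> x * ?v x)
      + C * \<epsilon> * integral {-S..S} (\<lambda>x. weight \<epsilon> x * edens t x)" by simp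
  qed
qed

lemma weighted_integral_ge:
  assumes R: "0 \<le> R" "R \<le> S" and f: "\<And>S. continuous_on {-S..S} f" "\<And>x. 0 \<le> f x"
  shows "weight \<epsilon> R * integral {-R..R} f \<le> integral {-S..S} (\<lambda>x. weight \<epsilon> x * f x)"
proof -
  have int: "(\<lambda>x. weight \<epsilon> x * f x) integrable_on {-S..S}" for S
    by (intro integrable_continuous_interval continuous_intros weight_continuous f)
  have "weight \<epsilon> R * integral {-R..R} f = integral {-R..R} (\<lambda>x. weight \<epsilon> R * f x)" by simp
  also have "\<dots> \<le> integral {-R..R} (\<lambda>x. weight \<epsilon> x * f x)"
    by (intro integral_le int integrable_continuous_interval continuous_intros f mult_right_mono weight_antimono) auto
  also have "\<dots> \<le> integral {-S..S} (\<lambda>x. weight \<epsilon> x * f x)"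
    using R f(2) less_imp_le[OF weight_pos[of \<epsilon>]] by (intro integral_subset_le int) auto
  finally show ?thesis .
qed

text \<open>The loss \<open>a\<close> survives in Gronwall's inequality: \<open>e\<^sup>-\<^sup>b\<^sup>s G(s) - (c - a e\<^sup>-\<^sup>b\<^sup>t) s\<close> is nonincreasing.\<close>

lemma gronwall_decay:
  fixes G G' :: "real \<Rightarrow> real"
  assumes G: "\<And>s. s \<in> {0..t} \<Longrightarrow> (G has_vector_derivative G' s) (at s within {0..t})"
    and le: "\<And>s. s \<in> {0..t} \<Longrightarrow> G' s \<le> c - a + b * G s"
    and nn: "0 \<le> a" "0 \<le> b" "0 \<le> c" "0 \<le> t"
  shows "exp (- b * t) * G t \<le> G 0 + (c - a * exp (- b * t)) * t"
proof -
  define k where "k = c - a * exp (- b * t)"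
  define H where "H = (\<lambda>s. exp (- b * s) * G s - k * s)"
  have "(H has_vector_derivative (exp (- b * s) * G' s - b * exp (- b * s) * G s - k)) (at s within {0..t})"
    if "s \<in> {0..t}" for s
    unfolding H_def using G[OF that] unfolding has_real_derivative_iff_has_vector_derivative[symmetric]
    by (auto intro!: derivative_eq_intros)
  then have "((\<lambda>s. exp (- b * s) * G' s - b * exp (- b * s) * G s - k) has_integral H t - H 0) {0..t}"
    using nn by (intro fundamental_theorem_of_calculus) auto
  moreover have "((\<lambda>s. 0) has_integral (0::real)) {0..t}" by simp
  moreover have "exp (- b * s) * G' s - b * exp (- b * s) * G s - k \<le> 0" if s: "s \<in> {0..t}" for s
  proof -
    have "exp (- b * s) * G' s \<le> exp (- b * s) * (c - a + b * G s)" using le[OF s] by simp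
    moreover have "exp (- b * s) * c \<le> 1 * c" using s nn by (intro mult_right_mono) auto
    moreover have "exp (- b * t) * a \<le> exp (- b * s) * a" using s nn by (intro mult_right_mono) (auto intro: mult_left_mono)
    ultimately show ?thesis unfolding k_def by (simp add: algebra_simps)
  qed
  ultimately have "H t - H 0 \<le> 0" by (rule has_integral_le)
  then show ?thesis by (simp add: H_def k_def)
qed

text \<open>The energy on \<open>[-R,R]\<close> is compared with the weighted energy on \<open>[-S,S]\<close> for \<open>S = 1/\<epsilon>\<^sup>2\<close>, and then
  \<open>\<epsilon> \<rightarrow> 0\<close>. The rate \<open>m\<close> is a lower bound for the dissipation on \<open>[-R,R]\<close>, so that no time integral
  enters; \<open>m = 0\<close> gives monotonicity of the energy.\<close>

theorem energy_dissipation: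
  assumes t: "t \<in> J" and R: "0 \<le> R" and m: "0 \<le> m"
    and dissipation: "\<And>s. s \<in> {0..t} \<Longrightarrow> m \<le> integral {-R..R} (\<lambda>x. speed s x * (velocity s x \<bullet> velocity s x))"
    and E0: "\<And>r. integral {-r..r} (edens 0) \<le> E0"
  shows "integral {-R..R} (edens t) \<le> E0 - m * t"
proof -
  obtain C where C0: "C \<ge> 0" and C:
    "\<And>\<epsilon> S t. 0 < \<epsilon> \<Longrightarrow> \<epsilon> \<le> 1 \<Longrightarrow> 0 \<le> S \<Longrightarrow> t \<in> J \<Longrightarrow>
      integral {-S..S} (\<lambda>x. weight \<epsilon> x * production t x) \<le> C * weight \<epsilon> S
      - (1 - C * \<epsilon>) * integral {-S..S} (\<lambda>x. weight \<epsilon> x * (speed t x * (velocity t x \<bullet> velocity t x)))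
      + C * \<epsilon> * integral {-S..S} (\<lambda>x. weight \<epsilon> x * edens t x)"
    using weighted_production_le by blast
  define A where "A = integral {-R..R} (edens t)"
  have nonneg: "edens s x \<ge> 0" if "s \<in> J" for s x
    by (rule immersed_curve.density_nonneg[OF curve[OF that]])
  have key: "exp (- (C * \<epsilon>) * t) * (weight \<epsilon> R * A)
      \<le> E0 + (C * \<epsilon>\<^sup>2 - (1 - C * \<epsilon>) * (weight \<epsilon> R * m) * exp (- (C * \<epsilon>) * t)) * t"
    if \<epsilon>: "0 < \<epsilon>" "\<epsilon> \<le> 1" "C * \<epsilon> \<le> 1" "\<epsilon>\<^sup>2 * R \<le> 1" for \<epsilon>
  proof -
    \<comment> \<open>the boundary terms at \<open>S\<close> have the size \<open>weight \<epsilon> S \<le> \<epsilon>\<^sup>2\<close>\<close>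
    define S where "S = 1 / \<epsilon>\<^sup>2"
    have S: "R \<le> S" "0 \<le> S" using \<epsilon> by (auto simp: S_def field_simps)
    have wS: "weight \<epsilon> S \<le> \<epsilon>\<^sup>2"
    proof -
      have "weight \<epsilon> S = \<epsilon>\<^sup>2 / (\<epsilon>\<^sup>2 + 1)" using \<epsilon> 
        by (simp add: weight_def S_def power2_eq_square field_simps)
      also have "\<dots> \<le> \<epsilon>\<^sup>2 / 1" by (intro divide_left_mono) (auto simp: add_nonneg_pos)
      also have "\<dots> = \<epsilon>\<^sup>2" by simp
      finally show ?thesis .
    qed
    define G where "G = (\<lambda>s. integral {-S..S} (\<lambda>x. weight \<epsilon> x * edens s x))"
    define G' where "G' = (\<lambda>s. integral {-S..S} (\<lambda>x. weight \<epsilon> x * production s x))"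
    have sub: "{0..t} \<subseteq> J" using t by auto
    have "exp (- (C * \<epsilon>) * t) * G t \<le> G 0 + (C * \<epsilon>\<^sup>2 - (1 - C * \<epsilon>) * (weight \<epsilon> R * m) * exp (- (C * \<epsilon>) * t)) * t"
    proof (rule gronwall_decay)
      fix s assume s: "s \<in> {0..t}"
      then have sJ: "s \<in> J" using sub by blast
      show "(G has_vector_derivative G' s) (at s within {0..t})"
        unfolding G_def G'_def
        by (rule has_vector_derivative_within_subset[OF weighted_energy_derivative[OF weight_continuous sJ] sub])
      have "weight \<epsilon> R * m \<le> weight \<epsilon> R * integral {-R..R} (\<lambda>x. speed s x * (velocity s x \<bullet> velocity s x))"
        using dissipation[OF s] weight_pos[of \<epsilon> R] by (intro mult_left_mono) auto
      also have "\<dots> \<le> integral {-S..S} (\<lambda>x. weight \<epsilon> x * (speed s x * (velocity s x \<bullet> velocity s x)))"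
        by (rule weighted_integral_ge[OF R S(1) vel_sq_continuous[OF sJ]]) simp
      finally have "(1 - C * \<epsilon>) * (weight \<epsilon> R * m) \<le> (1 - C * \<epsilon>) * 
          integral {-S..S} (\<lambda>x. weight \<epsilon> x * (speed s x * (velocity s x \<bullet> velocity s x)))"
        using \<epsilon> by (intro mult_left_mono) auto
      moreover have "C * weight \<epsilon> S \<le> C * \<epsilon>\<^sup>2" using wS C0 by (rule mult_left_mono)
      ultimately show "G' s \<le> C * \<epsilon>\<^sup>2 - (1 - C * \<epsilon>) * (weight \<epsilon> R * m) + C * \<epsilon> * G s"
        using C[OF \<epsilon>(1,2) S(2) sJ] unfolding G_def G'_def by linarith
    qed (use \<epsilon> C0 m t weight_pos[of \<epsilon> R] in auto)
    moreover have "weight \<epsilon> R * A \<le> G t"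
      unfolding A_def G_def by (rule weighted_integral_ge[OF R S(1) edens_continuous[OF t] nonneg[OF t]])
    then have "exp (- (C * \<epsilon>) * t) * (weight \<epsilon> R * A) \<le> exp (- (C * \<epsilon>) * t) * G t" by simp
    moreover have "G 0 \<le> E0"
    proof -
      have 0: "0 \<in> J" using T_pos by simp
      have "G 0 \<le> integral {-S..S} (edens 0)" unfolding G_def
        using mult_right_mono[OF weight_le_1 nonneg[OF 0]]
        by (intro integral_le integrable_continuous_interval continuous_intros weight_continuous edens_continuous 0) auto
      then show ?thesis using E0[of S] by simp
    qed
    ultimately show ?thesis by linarith
  qed
  have w: "((\<lambda>\<epsilon>. weight \<epsilon> R) \<longlongrightarrow> 1) (at_right 0)"
    unfolding weight_def by (auto intro!: tendsto_eq_intros)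
  have "eventually (\<lambda>\<epsilon>. C * \<epsilon> < 1) (at_right (0::real))"
    by (rule order_tendstoD(2)[of _ 0]) (auto intro!: tendsto_eq_intros)
  moreover have "eventually (\<lambda>\<epsilon>. \<epsilon>\<^sup>2 * R < 1) (at_right (0::real))"
    by (rule order_tendstoD(2)[of _ 0]) (auto intro!: tendsto_eq_intros)
  moreover have "eventually (\<lambda>\<epsilon>. \<epsilon> < 1) (at_right (0::real))"
    by (rule order_tendstoD(2)[of _ 0]) (auto intro!: tendsto_eq_intros)
  moreover have "eventually (\<lambda>\<epsilon>. 0 < \<epsilon>) (at_right (0::real))"
    by (rule eventually_at_right_less)
  ultimately have ev: "eventually (\<lambda>\<epsilon>. exp (- (C * \<epsilon>) * t) * (weight \<epsilon> R * A)
      \<le> E0 + (C * \<epsilon>\<^sup>2 - (1 - C * \<epsilon>) * (weight \<epsilon> R * m) * exp (- (C * \<epsilon>) * t)) * t) (at_right 0)"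
    by eventually_elim (rule key, auto)
  have "((\<lambda>\<epsilon>. exp (- (C * \<epsilon>) * t) * (weight \<epsilon> R * A)) \<longlongrightarrow> exp (- (C * 0) * t) * (1 * A)) (at_right 0)"
    by (intro tendsto_intros w)
  moreover have "((\<lambda>\<epsilon>. E0 + (C * \<epsilon>\<^sup>2 - (1 - C * \<epsilon>) * (weight \<epsilon> R * m) * exp (- (C * \<epsilon>) * t)) * t)
     \<longlongrightarrow> E0 + (C * 0\<^sup>2 - (1 - C * 0) * (1 * m) * exp (- (C * 0) * t)) * t) (at_right 0)"
    by (intro tendsto_intros w)
  ultimately have "exp (- (C * 0) * t) * (1 * A) \<le> E0 + (C * 0\<^sup>2 - (1 - C * 0) * (1 * m) * exp (- (C * 0) * t)) * t"
    using ev by (intro tendsto_le[OF trivial_limit_at_right_real])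
  then show ?thesis by (simp add: A_def)
qed

end

section \<open>Stationary curves of finite energy\<close>

text \<open>By the bound on the derivative, a value \<open>\<epsilon>\<close> persists as \<open>\<epsilon>/2\<close> on an interval of a fixed length \<open>\<delta>\<close>;
  far out this would add \<open>\<delta>\<epsilon>/2\<close> to an integral that has almost reached its supremum.\<close>

lemma tendsto_zero_of_bounded_integral:
  fixes f f' :: "real \<Rightarrow> real"
  assumes f: "\<And>x. (f has_real_derivative f' x) (at x)" and L: "\<And>x. \<bar>f' x\<bar> \<le> L"
    and nonneg: "\<And>x. 0 \<le> f x" and K: "\<And>b. 0 \<le> b \<Longrightarrow> integral {0..b} f \<le> K"
  shows "(f \<longlongrightarrow> 0) at_top"
proof (rule tendstoI)
  fix \<epsilon> :: real assume \<epsilon>: "\<epsilon> > 0"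
  have int: "f integrable_on {a..b}" for a b
    using f by (intro integrable_continuous_interval continuous_at_imp_continuous_on) (auto intro: DERIV_isCont)
  define \<delta> where "\<delta> = \<epsilon> / (2 * (L + 1))"
  have L0: "0 \<le> L" using L[of 0] by simp
  have \<delta>: "0 < \<delta>" "L * \<delta> \<le> \<epsilon> / 2" using \<epsilon> L0 by (auto simp: \<delta>_def field_simps)
  define I where "I = (\<lambda>b. integral {0..b} f)"
  have bdd: "bdd_above (I ` {0..})" using K by (intro bdd_aboveI[where M = K]) (auto simp: I_def)
  have "Sup (I ` {0..}) - \<delta> * (\<epsilon> / 2) < Sup (I ` {0..})" using \<delta> \<epsilon> by simp
  then obtain X where X: "X \<ge> 0" "I X > Sup (I ` {0..}) - \<delta> * (\<epsilon> / 2)"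
    using less_cSup_iff[OF _ bdd] by fastforce
  have "f x < \<epsilon>" if x: "x \<ge> X" for x
  proof (rule ccontr)
    assume "\<not> f x < \<epsilon>"
    have low: "\<epsilon> / 2 \<le> f y" if y: "y \<in> {x..x+\<delta>}" for y
    proof -
      have "\<bar>f y - f x\<bar> \<le> L * \<bar>y - x\<bar>"
        using field_differentiable_bound[of UNIV f f' L y x] f L by auto
      also have "\<dots> \<le> L * \<delta>" using y L0 by (intro mult_left_mono) auto
      finally show ?thesis using \<delta> \<open>\<not> f x < \<epsilon>\<close> by linarith
    qed
    have "\<delta> * (\<epsilon> / 2) = integral {x..x+\<delta>} (\<lambda>_. \<epsilon> / 2)" using \<delta> by simp
    also have "\<dots> \<le> integral {x..x+\<delta>} f" by (intro integral_le int low) auto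
    finally have "\<delta> * (\<epsilon> / 2) \<le> integral {x..x+\<delta>} f" .
    moreover have "I X \<le> integral {0..x} f"
      unfolding I_def using x X nonneg by (intro integral_subset_le int) auto
    moreover have "integral {0..x} f + integral {x..x+\<delta>} f = I (x + \<delta>)"
      unfolding I_def using x X \<delta> by (intro Henstock_Kurzweil_Integration.integral_combine int) auto
    moreover have "I (x + \<delta>) \<le> Sup (I ` {0..})" using x X \<delta> by (intro cSup_upper bdd) auto
    ultimately show False using X by linarith
  qed
  then show "\<forall>\<^sub>F x in at_top. dist (f x) 0 < \<epsilon>"
    using nonneg by (auto simp: eventually_at_top_linorder)
qed

context immersed_curve
begin

lemma arclength_parameter:
  assumes m: "0 < m" "\<And>x. m \<le> g x"
  obtains \<phi> where "\<phi> x1 = 0" "\<And>x. (\<phi> has_real_derivative g x) (at x)" "reparametrization \<phi>"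
proof -
  have "isCont g x" for x
    using smooth_continuous[OF smooth_g, of UNIV] by (simp add: continuous_on_eq_continuous_at)
  then obtain F where F: "\<And>x. (F has_vector_derivative g x) (at x)"
    using einterval_antiderivative[of "-\<infinity>" "\<infinity>" g] by auto
  define \<phi> where "\<phi> = (\<lambda>x. F x - F x1)"
  have d: "(\<phi> has_real_derivative g x) (at x)" for x
    unfolding \<phi>_def using F[folded has_real_derivative_iff_has_vector_derivative, of x]
    by (auto intro!: derivative_eq_intros)
  note d' = d[unfolded has_real_derivative_iff_has_vector_derivative]
  have inc: "m * (y - x) \<le> \<phi> y - \<phi> x" if "x \<le> y" for x y
  proof (cases "x = y")
    case False
    then have "x < y" using that by simp
    then obtain z where "\<phi> y - \<phi> x = (y - x) * g z" using MVT2[of x y \<phi> g] d by auto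
    then show ?thesis using mult_right_mono[OF m(2)[of z], of "y - x"] that by (simp add: mult.commute)
  qed simp
  have "inj \<phi>"
  proof (rule injI)
    fix x y assume eq: "\<phi> x = \<phi> y"
    show "x = y"
    proof (rule linorder_cases[of x y])
      assume "x < y"
      then have "0 < m * (y - x)" using m(1) by simp
      then show ?thesis using inc[of x y] \<open>x < y\<close> eq by linarith
    next
      assume "y < x"
      then have "0 < m * (x - y)" using m(1) by simp
      then show ?thesis using inc[of y x] \<open>y < x\<close> eq by linarith
    qed
  qed
  moreover have "surj \<phi>"
    unfolding surj_def
  proof
    fix y
    show "\<exists>x. y = \<phi> x"
    proof -
      define r where "r = \<bar>y - \<phi> 0\<bar> / m"
      have r: "r \<ge> 0" "m * r = \<bar>y - \<phi> 0\<bar>" using m by (auto simp: r_def)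
      have "\<phi> (-r) \<le> y" "y \<le> \<phi> r" using inc[of "-r" 0] inc[of 0 r] r by auto
      then have "\<exists>x\<ge>-r. x \<le> r \<and> \<phi> x = y"
        using r d by (intro IVT') (auto intro: continuous_at_imp_continuous_on DERIV_isCont)
      then show ?thesis by blast
    qed
  qed
  moreover have "smooth \<phi>" by (rule smoothI[OF d' smooth_g])
  ultimately have "reparametrization \<phi>"
    unfolding reparametrization_def bij_def using Dx_eqI[OF d'] immersed by auto
  then show ?thesis using that[of \<phi>] d by (simp add: \<phi>_def)
qed

lemma constant_of_arclength_derivative:
  assumes "\<And>x. (f has_vector_derivative g x *\<^sub>R D x) (at x)" "\<And>x. (h has_vector_derivative g x *\<^sub>R D x) (at x)"
  obtains p where "\<And>x. f x = p + h x"
proof -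
  have "((\<lambda>x. f x - h x) has_vector_derivative 0) (at x)" for x
    using has_vector_derivative_diff[OF assms] by simp
  then obtain p where p: "\<And>x. f x - h x = p"
    by (rule has_vector_derivative_zero_constant[OF convex_UNIV]) blast
  have "f x = p + h x" for x unfolding p[of x, symmetric] by simp
  then show ?thesis by (rule that)
qed

lemma c_derivative: "(c has_vector_derivative g x *\<^sub>R tau x) (at x)"
  using arclength_derivative[OF smooth_c] .

lemma straight_line_of_constant_tangent:
  assumes m: "0 < m" "\<And>x. m \<le> g x" and const: "\<And>x. tau x = w"
  shows "straight_line c"
proof -
  obtain \<phi> where \<phi>: "\<And>x. (\<phi> has_real_derivative g x) (at x)" "reparametrization \<phi>"
    using arclength_parameter[OF m] by metis
  have "((\<lambda>x. \<phi> x *\<^sub>R w) has_vector_derivative g x *\<^sub>R w) (at x)" for x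
    using has_vector_derivative_scaleR[OF \<phi>(1) has_vector_derivative_const[of w]] by simp
  moreover have "(c has_vector_derivative g x *\<^sub>R w) (at x)" for x using c_derivative const by metis
  ultimately obtain p where "\<And>x. c x = p + \<phi> x *\<^sub>R w"
    using constant_of_arclength_derivative[of c "\<lambda>_. w" "\<lambda>x. \<phi> x *\<^sub>R w"] by auto
  moreover have "w \<noteq> 0" using tau_unit[of undefined] const by auto
  ultimately show ?thesis unfolding straight_line_def using \<phi>(2) by blast
qed

end

text \<open>In the plane spanned by the asymptotic direction \<open>e\<close> and \<open>\<omega>\<close>, these are the first two derivatives
  of \<open>(s - 2 tanh s) e + (2 / cosh s) \<omega>\<close>.\<close>

definition elastica_tangent :: "'a::euclidean_space \<Rightarrow> 'a \<Rightarrow> real \<Rightarrow> 'a" where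
  "elastica_tangent e \<omega> s = (1 - 2 / (cosh s)\<^sup>2) *\<^sub>R e - (2 * sinh s / (cosh s)\<^sup>2) *\<^sub>R \<omega>"

definition elastica_curvature :: "'a::euclidean_space \<Rightarrow> 'a \<Rightarrow> real \<Rightarrow> 'a" where
  "elastica_curvature e \<omega> s = (4 * sinh s / (cosh s)^3) *\<^sub>R e + (2 * ((sinh s)\<^sup>2 - 1) / (cosh s)^3) *\<^sub>R \<omega>"

lemma elastica_tangent_derivative:
  "(elastica_tangent e \<omega> has_vector_derivative elastica_curvature e \<omega> s) (at s)"
proof -
  have cs: "(cosh s)\<^sup>2 = 1 + (sinh s)\<^sup>2" using hyperbolic_pythagoras[of s] by simp
  have nz: "cosh s \<noteq> (0::real)" by simp
  have 1: "((\<lambda>s. 1 - 2 / (cosh s)\<^sup>2) has_real_derivative 4 * sinh s / (cosh s)^3) (at s)"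
    by (rule derivative_eq_intros refl | simp)+ (simp add: field_simps eval_nat_numeral)
  have 2: "((\<lambda>s. 2 * sinh s / (cosh s)\<^sup>2) has_real_derivative - (2 * ((sinh s)\<^sup>2 - 1) / (cosh s)^3)) (at s)"
  proof -
    have "((\<lambda>s. 2 * sinh s / (cosh s)\<^sup>2) has_real_derivative 
       (2 * cosh s * (cosh s)\<^sup>2 - 2 * sinh s * (2 * cosh s * sinh s)) / ((cosh s)\<^sup>2 * (cosh s)\<^sup>2)) (at s)"
      by (rule derivative_eq_intros refl | simp)+
    also have "2 * cosh s * (cosh s)\<^sup>2 - 2 * sinh s * (2 * cosh s * sinh s) = cosh s * (- (2 * ((sinh s)\<^sup>2 - 1)))"
      unfolding cs by (simp add: algebra_simps power2_eq_square)
    also have "\<dots> / ((cosh s)\<^sup>2 * (cosh s)\<^sup>2) = - (2 * ((sinh s)\<^sup>2 - 1) / (cosh s)^3)"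
      using nz by (simp add: field_simps eval_nat_numeral)
    finally show ?thesis .
  qed
  show ?thesis unfolding elastica_tangent_def[abs_def] elastica_curvature_def
    using has_vector_derivative_diff[OF has_vector_derivative_scaleR[OF 1 has_vector_derivative_const[of e]]
        has_vector_derivative_scaleR[OF 2 has_vector_derivative_const[of \<omega>]]]
    by (simp only: scaleR_zero_right add_0_left scaleR_minus_left diff_minus_eq_add)
qed

text \<open>The form in which stationarity with force \<open>- e\<close> is an autonomous system for the tangent and its
  derivative.\<close>

lemma elastica_curvature_derivative:
  assumes "e \<bullet> e = 1" "\<omega> \<bullet> e = 0"
  shows "(elastica_curvature e \<omega> has_vector_derivative
     (3 * (elastica_tangent e \<omega> s \<bullet> e) - 2) *\<^sub>R elastica_tangent e \<omega> s - e) (at s)"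
proof -
  have cs: "(sinh s)\<^sup>2 = (cosh s)\<^sup>2 - 1" using hyperbolic_pythagoras[of s] by simp
  define C S where "C = cosh s" and "S = sinh s"
  have CS: "S * S = C * C - 1" and nz: "C \<noteq> 0" using cs by (auto simp: C_def S_def power2_eq_square)
  have te: "elastica_tangent e \<omega> s \<bullet> e = 1 - 2 / C\<^sup>2"
    using assms by (simp add: elastica_tangent_def inner_diff_left C_def)
  have 1: "((\<lambda>s. 4 * sinh s / (cosh s)^3) has_real_derivative (1 - 6 / C\<^sup>2) * (1 - 2 / C\<^sup>2) - 1) (at s)"
  proof -
    have "((\<lambda>s. 4 * sinh s / (cosh s)^3) has_real_derivative 
       (4 * C * C^3 - 4 * S * (3 * C^2 * S)) / (C^3 * C^3)) (at s)"
      unfolding C_def S_def by (rule derivative_eq_intros refl | simp)+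
    also have "4 * C * C^3 - 4 * S * (3 * C^2 * S) = 4 * C^4 - 12 * C^2 * (S * S)" by (simp add: algebra_simps eval_nat_numeral)
    also have "\<dots> / (C^3 * C^3) = (1 - 6 / C\<^sup>2) * (1 - 2 / C\<^sup>2) - 1"
      unfolding CS using nz by (simp add: field_simps eval_nat_numeral)
    finally show ?thesis .
  qed
  have 2: "((\<lambda>s. 2 * ((sinh s)\<^sup>2 - 1) / (cosh s)^3) has_real_derivative - ((1 - 6 / C\<^sup>2) * (2 * S / C\<^sup>2))) (at s)"
  proof -
    have "((\<lambda>s. 2 * ((sinh s)\<^sup>2 - 1) / (cosh s)^3) has_real_derivative 
       (2 * (2 * S * C) * C^3 - 2 * (S\<^sup>2 - 1) * (3 * C^2 * S)) / (C^3 * C^3)) (at s)"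
      unfolding C_def S_def by (rule derivative_eq_intros refl | simp)+
    also have "2 * (2 * S * C) * C^3 - 2 * (S\<^sup>2 - 1) * (3 * C^2 * S) = S * (4 * C^4 - 6 * (S * S - 1) * C^2)"
      by (simp add: algebra_simps eval_nat_numeral)
    also have "\<dots> / (C^3 * C^3) = - ((1 - 6 / C\<^sup>2) * (2 * S / C\<^sup>2))"
      unfolding CS using nz by (simp add: field_simps eval_nat_numeral)
    finally show ?thesis .
  qed
  have "(elastica_curvature e \<omega> has_vector_derivative
     ((1 - 6 / C\<^sup>2) * (1 - 2 / C\<^sup>2) - 1) *\<^sub>R e + (- ((1 - 6 / C\<^sup>2) * (2 * S / C\<^sup>2))) *\<^sub>R \<omega>) (at s)"
    unfolding elastica_curvature_def[abs_def]
    using has_vector_derivative_add[OF has_vector_derivative_scaleR[OF 1 has_vector_derivative_const[of e]]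
        has_vector_derivative_scaleR[OF 2 has_vector_derivative_const[of \<omega>]]]
    by (simp only: scaleR_zero_right add_0_left)
  also have "((1 - 6 / C\<^sup>2) * (1 - 2 / C\<^sup>2) - 1) *\<^sub>R e + (- ((1 - 6 / C\<^sup>2) * (2 * S / C\<^sup>2))) *\<^sub>R \<omega>
     = (3 * (1 - 2 / C\<^sup>2) - 2) *\<^sub>R elastica_tangent e \<omega> s - e"
    unfolding elastica_tangent_def C_def[symmetric] S_def[symmetric]
    by (simp add: algebra_simps, simp flip: scaleR_add_left)
  finally show ?thesis unfolding te .
qed

lemma norm_elastica_tangent:
  assumes "e \<bullet> e = 1" "\<omega> \<bullet> \<omega> = 1" "\<omega> \<bullet> e = 0"
  shows "norm (elastica_tangent e \<omega> s) = 1"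
proof -
  have cs: "(sinh s)\<^sup>2 = (cosh s)\<^sup>2 - 1" using hyperbolic_pythagoras[of s] by simp
  have "elastica_tangent e \<omega> s \<bullet> elastica_tangent e \<omega> s = (1 - 2 / (cosh s)\<^sup>2)\<^sup>2 + 4 * (sinh s)\<^sup>2 / (cosh s)^4"
    using assms by (simp add: elastica_tangent_def inner_diff_left inner_diff_right inner_commute power2_eq_square power4_eq_xxxx)
  also have "\<dots> = 1" unfolding cs by (simp add: field_simps eval_nat_numeral)
  finally show ?thesis by (simp add: norm_eq_1)
qed

locale stationary_curve = immersed_curve c for c :: "real \<Rightarrow> 'a::euclidean_space" +
  fixes e :: 'a and m M B E0 :: real
  assumes unit_e: "norm e = 1"
    and m_pos: "0 < m" and g_lower: "\<And>x. m \<le> g x" and g_upper: "\<And>x. g x \<le> M"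
    and kap_bound: "\<And>x. norm (kap x) \<le> B" and nk_bound: "\<And>x. norm (nk x) \<le> B"
    and finite_energy: "\<And>r. integral {-r..r} (density e) \<le> E0"
    and vel_zero: "\<And>x. vel x = 0"
begin

lemma ee: "e \<bullet> e = 1" using unit_e by (simp add: norm_eq_1)

definition v :: "real \<Rightarrow> real" where "v x = 1 - tau x \<bullet> e"

lemma v_eq: "v x = 1/2 * (norm (tau x - e))\<^sup>2"
  unfolding v_def using half_norm_tau_diff[OF unit_e] by simp

lemma v_nonneg: "0 \<le> v x" unfolding v_eq by simp

lemma v_derivative: "(v has_real_derivative - (g x * (kap x \<bullet> e))) (at x)"
proof -
  have "((\<lambda>x. tau x \<bullet> e) has_vector_derivative g x * (kap x \<bullet> e)) (at x)"
    using bounded_linear.has_vector_derivative[OF bounded_linear_inner_left tau_derivative] by simp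
  then show ?thesis unfolding v_def[abs_def] has_real_derivative_iff_has_vector_derivative[symmetric]
    by (auto intro!: derivative_eq_intros)
qed

lemma density_integrable: "density e integrable_on {a..b}"
  unfolding density_def[abs_def]
  by (intro integrable_continuous_interval continuous_intros smooth_continuous smooth_kap smooth_tau smooth_g)

text \<open>Domination by the energy density bounds the integrals of \<open>f\<close> over all intervals. This covers both
  \<open>v\<close> and \<open>|\<kappa>|\<^sup>2\<close>, as the speed is bounded below.\<close>

lemma decay:
  assumes f: "\<And>x. (f has_real_derivative f' x) (at x)" and L: "\<And>x. \<bar>f' x\<bar> \<le> L"
    and nonneg: "\<And>x. 0 \<le> f x" and le: "\<And>x. f x \<le> C * density e x" and C: "0 \<le> C"
  shows "(f \<longlongrightarrow> 0) at_top" "(f \<longlongrightarrow> 0) at_bot"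
proof -
  have int: "f integrable_on {a..b}" for a b
    using f by (intro integrable_continuous_interval continuous_at_imp_continuous_on) (auto intro: DERIV_isCont)
  have sub: "integral {a..b} f \<le> C * E0" if "-r \<le> a" "b \<le> r" for a b r
  proof -
    have "integral {a..b} f \<le> integral {-r..r} f"
      using that nonneg by (intro integral_subset_le int) auto
    also have "\<dots> \<le> integral {-r..r} (\<lambda>x. C * density e x)"
      by (intro integral_le int integrable_on_mult_right density_integrable le)
    also have "\<dots> \<le> C * E0" using finite_energy[of r] C by (simp add: mult_left_mono)
    finally show ?thesis .
  qed
  show "(f \<longlongrightarrow> 0) at_top"
    by (rule tendsto_zero_of_bounded_integral[OF f L nonneg]) (rule sub, auto)
  have "((\<lambda>x. f (- x)) \<longlongrightarrow> 0) at_top"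
  proof (rule tendsto_zero_of_bounded_integral)
    show "((\<lambda>x. f (- x)) has_real_derivative - f' (- x)) (at x)" for x
      using DERIV_mirror[of f "f' (-x)" "-x"] f[of "-x"] DERIV_chain2[OF f DERIV_minus[OF DERIV_ident]]
      by auto
    show "integral {0..b} (\<lambda>x. f (- x)) \<le> C * E0" if "0 \<le> b" for b
      using sub[of b "-b" 0] that Henstock_Kurzweil_Integration.integral_reflect_real[of 0 "-b" f] by simp
  qed (use L nonneg in auto)
  then show "(f \<longlongrightarrow> 0) at_bot" by (simp add: filterlim_at_bot_mirror)
qed

lemma gK: "1 \<le> inverse m * g x"
  using g_lower[of x] m_pos by (simp add: field_simps)

lemma M_nonneg: "0 \<le> M" using g_lower[of 0] g_upper[of 0] m_pos by linarith
lemma B_nonneg: "0 \<le> B" using kap_bound[of 0] norm_ge_zero order_trans by blast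

lemma v_tendsto: "(v \<longlongrightarrow> 0) at_top" "(v \<longlongrightarrow> 0) at_bot"
proof -
  have L: "\<bar>- (g x * (kap x \<bullet> e))\<bar> \<le> M * B" for x
    using g_upper[of x] kap_bound[of x] Cauchy_Schwarz_ineq2[of "kap x" e] unit_e M_nonneg
    by (auto simp: abs_mult intro!: mult_mono)
  have le: "v x \<le> inverse m * density e x" for x
  proof -
    have "v x \<le> (inverse m * g x) * v x" using mult_right_mono[OF gK v_nonneg] by simp
    also have "\<dots> = inverse m * (v x * g x)" by simp
    also have "v x * g x \<le> density e x"
      unfolding density_def v_eq by (intro mult_right_mono) auto
    then have "inverse m * (v x * g x) \<le> inverse m * density e x" using m_pos by simp
    finally show ?thesis .
  qed
  show "(v \<longlongrightarrow> 0) at_top" "(v \<longlongrightarrow> 0) at_bot"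
    using decay[OF v_derivative L v_nonneg le] m_pos by auto
qed

lemma kap_sq_tendsto: "((\<lambda>x. kap x \<bullet> kap x) \<longlongrightarrow> 0) at_top"
proof -
  have "\<bar>g x * (2 * (kap x \<bullet> nk x))\<bar> \<le> M * (2 * (B * B))" for x
  proof -
    have "\<bar>kap x \<bullet> nk x\<bar> \<le> norm (kap x) * norm (nk x)" by (rule Cauchy_Schwarz_ineq2)
    also have "\<dots> \<le> B * B" by (intro mult_mono kap_bound nk_bound B_nonneg) simp
    finally show ?thesis using g_upper[of x] M_nonneg by (auto simp: abs_mult intro!: mult_mono)
  qed
  note L = this
  have le: "kap x \<bullet> kap x \<le> (2 * inverse m) * density e x" for x
  proof -
    have "kap x \<bullet> kap x \<le> (inverse m * g x) * (kap x \<bullet> kap x)" using mult_right_mono[OF gK inner_ge_zero] by simp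
    also have "\<dots> \<le> (2 * inverse m) * density e x"
      using m_pos g_pos[of x] by (simp add: density_def power2_norm_eq_inner field_simps)
    finally show ?thesis .
  qed
  show ?thesis
    using decay(1)[OF kap_sq_derivative[folded has_real_derivative_iff_has_vector_derivative] L inner_ge_zero le] m_pos by auto
qed

lemma force_constant: obtains w where "\<And>x. force x = w"
proof -
  have "(force has_vector_derivative 0) (at x)" for x
    using force_derivative[of x] vel_zero by simp
  then obtain w where "\<And>x. force x = w"
    by (rule has_vector_derivative_zero_constant[OF convex_UNIV]) blast
  then show ?thesis by (rule that)
qed

text \<open>Were the constant force different from \<open>-e\<close>, the curvature vector would have a derivative with
  nonzero limit and could not stay bounded.\<close>

lemma force_eq: "force x = - e"
proof -
  obtain w where w: "\<And>x. force x = w" by (rule force_constant) blast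
  define l where "l = w + e"
  have l: "l = nk x + (1/2 * (kap x \<bullet> kap x)) *\<^sub>R tau x - (tau x - e)" for x
    unfolding l_def w[of x, symmetric] force_def by (simp add: algebra_simps)
  have "((\<lambda>x. norm (tau x - e)) \<longlongrightarrow> 0) at_top"
  proof -
    have "((\<lambda>x. sqrt (2 * v x)) \<longlongrightarrow> sqrt (2 * 0)) at_top" by (intro tendsto_intros v_tendsto)
    moreover have "sqrt (2 * v x) = norm (tau x - e)" for x unfolding v_eq by simp
    ultimately show ?thesis by simp
  qed
  then have lim: "((\<lambda>x. 3/2 * (kap x \<bullet> kap x) * norm l + norm (tau x - e) * norm l) \<longlongrightarrow> 3/2 * 0 * norm l + 0 * norm l) at_top"
    by (intro tendsto_intros kap_sq_tendsto)
  have est: "\<bar>Ds c kap x \<bullet> l - l \<bullet> l\<bar> \<le> 3/2 * (kap x \<bullet> kap x) * norm l + norm (tau x - e) * norm l" for x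
  proof -
    have "Ds c kap x = l - (3/2 * (kap x \<bullet> kap x)) *\<^sub>R tau x + (tau x - e)"
      unfolding Ds_kap l[of x] by (simp add: algebra_simps flip: scaleR_add_left)
    then have "Ds c kap x \<bullet> l - l \<bullet> l = (tau x - e) \<bullet> l - 3/2 * (kap x \<bullet> kap x) * (tau x \<bullet> l)"
      by (simp add: inner_add_left inner_diff_left)
    moreover have "\<bar>(tau x - e) \<bullet> l\<bar> \<le> norm (tau x - e) * norm l" by (rule Cauchy_Schwarz_ineq2)
    moreover have "\<bar>3/2 * (kap x \<bullet> kap x) * (tau x \<bullet> l)\<bar> \<le> 3/2 * (kap x \<bullet> kap x) * norm l"
      using mult_left_mono[OF Cauchy_Schwarz_ineq2[of "tau x" l], of "kap x \<bullet> kap x"]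
      by (simp add: abs_mult norm_tau mult.commute)
    ultimately show ?thesis by linarith
  qed
  have "l = 0"
  proof (rule ccontr)
    assume "l \<noteq> 0"
    then have ll: "l \<bullet> l > 0" by simp
    have "eventually (\<lambda>x. 3/2 * (kap x \<bullet> kap x) * norm l + norm (tau x - e) * norm l < (l \<bullet> l) / 2) at_top"
      by (rule order_tendstoD(2)[OF lim]) (use ll in simp)
    then obtain X where X: "\<And>x. x \<ge> X \<Longrightarrow> 3/2 * (kap x \<bullet> kap x) * norm l + norm (tau x - e) * norm l < (l \<bullet> l) / 2"
      unfolding eventually_at_top_linorder by blast
    have d: "((\<lambda>x. kap x \<bullet> l) has_real_derivative g x * (Ds c kap x \<bullet> l)) (at x)" for x
      using bounded_linear.has_vector_derivative[OF bounded_linear_inner_left arclength_derivative[OF smooth_kap]]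
      by (simp add: has_real_derivative_iff_has_vector_derivative)
    have low: "m * (l \<bullet> l / 2) \<le> g x * (Ds c kap x \<bullet> l)" if "x \<ge> X" for x
    proof -
      have "l \<bullet> l / 2 \<le> Ds c kap x \<bullet> l" using est[of x] X[OF that] by linarith
      then show ?thesis using g_lower[of x] m_pos ll by (intro mult_mono) auto
    qed
    define k where "k = m * (l \<bullet> l / 2)"
    have k: "k > 0" using m_pos ll by (simp add: k_def)
    define Y where "Y = X + (2 * B * norm l + 1) / k"
    have XY: "X < Y" using k B_nonneg by (simp add: Y_def add_nonneg_pos)
    obtain z where z: "z > X" "kap Y \<bullet> l - kap X \<bullet> l = (Y - X) * (g z * (Ds c kap z \<bullet> l))"
      using MVT2[OF XY, of "\<lambda>x. kap x \<bullet> l" "\<lambda>x. g x * (Ds c kap x \<bullet> l)"] d by blast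
    have "(Y - X) * k \<le> kap Y \<bullet> l - kap X \<bullet> l"
      unfolding z(2) k_def using low[of z] z(1) XY by (intro mult_left_mono) auto
    moreover have "(Y - X) * k = 2 * B * norm l + 1" using k by (simp add: Y_def)
    moreover have "\<bar>kap y \<bullet> l\<bar> \<le> B * norm l" for y
      using Cauchy_Schwarz_ineq2[of "kap y" l] mult_right_mono[OF kap_bound[of y], of "norm l"] by simp
    from this[of X] this[of Y] have "kap Y \<bullet> l - kap X \<bullet> l \<le> 2 * B * norm l" by linarith
    ultimately show False by linarith
  qed
  then show ?thesis using w[of x] by (simp add: l_def eq_neg_iff_add_eq_0)
qed

text \<open>The tangential part of \<open>force = - e\<close>; the normal part enters the next lemma.\<close>

lemma kap_sq_eq: "1/2 * (kap x \<bullet> kap x) = v x"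
proof -
  have "force x \<bullet> tau x = 1/2 * (kap x \<bullet> kap x) - 1"
    unfolding force_def by (simp add: inner_add_left nabla_tau tau_unit)
  then show ?thesis unfolding force_eq v_def by (simp add: inner_commute)
qed

lemma Ds_kap_eq: "Ds c kap x = (3 * (tau x \<bullet> e) - 2) *\<^sub>R tau x - e"
proof -
  have "nk x = - e - (1/2 * (kap x \<bullet> kap x) - 1) *\<^sub>R tau x"
    using force_eq[of x] unfolding force_def by (simp add: algebra_simps eq_neg_iff_add_eq_0)
  moreover have "kap x \<bullet> kap x = 2 - 2 * (tau x \<bullet> e)" using kap_sq_eq[of x] by (simp add: v_def)
  ultimately show ?thesis unfolding Ds_kap by (simp add: algebra_simps, simp flip: scaleR_add_left)
qed

text \<open>This is conservation of energy for \<open>v'' = 4 v - 3 v\<^sup>2\<close>, where the constant is \<open>0\<close> because \<open>v\<close> and \<open>v'\<close>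
  vanish at infinity.\<close>

lemma first_integral: "(kap x \<bullet> e)\<^sup>2 = 2 * (v x)\<^sup>2 * (2 - v x)"
proof -
  define Q where "Q = (\<lambda>x. (kap x \<bullet> e)\<^sup>2 - 4 * (v x)\<^sup>2 + 2 * (v x)^3)"
  have y: "((\<lambda>x. kap x \<bullet> e) has_real_derivative g x * (3 * (v x)\<^sup>2 - 4 * v x)) (at x)" for x
  proof -
    have "((\<lambda>x. kap x \<bullet> e) has_real_derivative g x * (Ds c kap x \<bullet> e)) (at x)"
      using bounded_linear.has_vector_derivative[OF bounded_linear_inner_left arclength_derivative[OF smooth_kap]]
      by (simp add: has_real_derivative_iff_has_vector_derivative)
    moreover have "Ds c kap x \<bullet> e = 3 * (v x)\<^sup>2 - 4 * v x"
      unfolding Ds_kap_eq v_def by (simp add: inner_diff_left ee algebra_simps power2_eq_square)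
    ultimately show ?thesis by simp
  qed
  have "(Q has_real_derivative 0) (at x)" for x
    unfolding Q_def
    by (rule derivative_eq_intros y v_derivative refl)+ (simp add: algebra_simps power2_eq_square)
  then have const: "Q x = Q y" for x y
    using DERIV_isconst_all by blast
  have "((\<lambda>x. kap x \<bullet> e) \<longlongrightarrow> 0) at_top"
  proof (rule tendsto_rabs_zero_cancel, rule tendsto_sandwich)
    show "\<forall>\<^sub>F x in at_top. 0 \<le> \<bar>kap x \<bullet> e\<bar>" by simp
    show "\<forall>\<^sub>F x in at_top. \<bar>kap x \<bullet> e\<bar> \<le> sqrt (kap x \<bullet> kap x)"
      using Cauchy_Schwarz_ineq2[of _ e] unit_e by (auto simp: norm_eq_sqrt_inner)
    show "((\<lambda>x. sqrt (kap x \<bullet> kap x)) \<longlongrightarrow> 0) at_top"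
      using tendsto_real_sqrt[OF kap_sq_tendsto] by simp
  qed simp
  then have "(Q \<longlongrightarrow> 0\<^sup>2 - 4 * 0\<^sup>2 + 2 * 0^3) at_top"
    unfolding Q_def by (intro tendsto_intros v_tendsto)
  moreover have "Q = (\<lambda>_. Q x)" using const by auto
  then have "(Q \<longlongrightarrow> Q x) at_top" using tendsto_const by metis
  ultimately have "Q x = 0" using tendsto_unique[OF trivial_limit_at_top_linorder] by fastforce
  then show ?thesis unfolding Q_def by (simp add: algebra_simps power2_eq_square power3_eq_cube)
qed

text \<open>Since \<open>v\<close> vanishes at both ends it has a maximum, where \<open>v' = 0\<close> and the first integral leaves
  \<open>v = 2\<close>, that is \<open>\<langle>\<tau>,e\<rangle> = - 1\<close>.\<close>

lemma turning_point:
  assumes x0: "v x0 \<noteq> 0"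
  obtains x1 where "tau x1 = - e" "kap x1 \<bullet> kap x1 = 4" "kap x1 \<bullet> e = 0"
proof -
  have pos: "0 < v x0" using x0 v_nonneg[of x0] by simp
  obtain X where X: "\<And>x. x \<ge> X \<Longrightarrow> v x < v x0"
    using order_tendstoD(2)[OF v_tendsto(1) pos] unfolding eventually_at_top_linorder by blast
  obtain Z where Z: "\<And>x. x \<le> Z \<Longrightarrow> v x < v x0"
    using order_tendstoD(2)[OF v_tendsto(2) pos] unfolding eventually_at_bot_linorder by blast
  have "x0 \<in> {Z..X}" using X[of x0] Z[of x0] by fastforce
  moreover have "continuous_on {Z..X} v"
    using v_derivative by (auto intro: continuous_at_imp_continuous_on DERIV_isCont)
  ultimately obtain x1 where x1: "x1 \<in> {Z..X}" "\<And>x. x \<in> {Z..X} \<Longrightarrow> v x \<le> v x1"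
    using continuous_attains_sup[of "{Z..X}" v] by auto
  have max: "v x \<le> v x1" for x
    using x1(2)[of x] x1(2)[OF \<open>x0 \<in> {Z..X}\<close>] X[of x] Z[of x] by fastforce
  then have "- (g x1 * (kap x1 \<bullet> e)) = 0"
    using DERIV_local_max[OF v_derivative, of 1] by auto
  then have y0: "kap x1 \<bullet> e = 0" using immersed by simp
  have "v x1 > 0" using max[of x0] pos by simp
  then have v2: "v x1 = 2" using first_integral[of x1] y0 by simp
  have "(tau x1 + e) \<bullet> (tau x1 + e) = 2 + 2 * (tau x1 \<bullet> e)"
    by (simp add: inner_add_left inner_add_right tau_unit ee inner_commute)
  also have "\<dots> = 0" using v2 by (simp add: v_def)
  finally have "tau x1 = - e" by (simp add: eq_neg_iff_add_eq_0)
  then show ?thesis using that[of x1] y0 kap_sq_eq[of x1] v2 by simp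
qed

text \<open>Tangent and curvature solve the same first order system as those of the explicit elastica, with
  the same data at the turning point. The squared distance \<open>h\<close> of the two solutions satisfies
  \<open>|h'| \<le> 9 M h\<close>, so it vanishes on both sides of that point.\<close>

lemma tangent_eq_elastica:
  assumes \<phi>: "\<And>x. (\<phi> has_real_derivative g x) (at x)" "\<phi> x1 = 0"
    and x1: "tau x1 = - e" "kap x1 = - 2 *\<^sub>R \<omega>" and \<omega>: "\<omega> \<bullet> \<omega> = 1" "\<omega> \<bullet> e = 0"
  shows "tau x = elastica_tangent e \<omega> (\<phi> x)"
proof -
  define tb kb where "tb = (\<lambda>x. elastica_tangent e \<omega> (\<phi> x))" and "kb = (\<lambda>x. elastica_curvature e \<omega> (\<phi> x))"
  note \<phi>' = \<phi>(1)[unfolded has_real_derivative_iff_has_vector_derivative]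
  have tb: "(tb has_vector_derivative g x *\<^sub>R kb x) (at x)" for x
    using vector_diff_chain_at[OF \<phi>' elastica_tangent_derivative] by (simp add: tb_def kb_def o_def)
  have kb: "(kb has_vector_derivative g x *\<^sub>R ((3 * (tb x \<bullet> e) - 2) *\<^sub>R tb x - e)) (at x)" for x
    using vector_diff_chain_at[OF \<phi>' elastica_curvature_derivative[OF ee \<omega>(2)]] by (simp add: tb_def kb_def o_def)
  have k: "(kap has_vector_derivative g x *\<^sub>R ((3 * (tau x \<bullet> e) - 2) *\<^sub>R tau x - e)) (at x)" for x
    using arclength_derivative[OF smooth_kap, of x] by (simp add: Ds_kap_eq)
  have ntb: "norm (tb x) = 1" for x unfolding tb_def by (rule norm_elastica_tangent[OF ee \<omega>])
  define d q where "d = (\<lambda>x. tau x - tb x)" and "q = (\<lambda>x. kap x - kb x)"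
  define h where "h = (\<lambda>x. d x \<bullet> d x + q x \<bullet> q x)"
  define \<Delta> where "\<Delta> = (\<lambda>x. (3 * (tau x \<bullet> e) - 2) *\<^sub>R tau x - (3 * (tb x \<bullet> e) - 2) *\<^sub>R tb x)"
  define h' where "h' = (\<lambda>x. 2 * g x * (d x \<bullet> q x + q x \<bullet> \<Delta> x))"
  have dd: "(d has_vector_derivative g x *\<^sub>R q x) (at x)" for x
    unfolding d_def q_def using has_vector_derivative_diff[OF tau_derivative tb] by (simp add: scaleR_diff_right)
  have dq: "(q has_vector_derivative g x *\<^sub>R \<Delta> x) (at x)" for x
    unfolding q_def \<Delta>_def using has_vector_derivative_diff[OF k kb] by (simp add: scaleR_diff_right)
  have dh: "(h has_real_derivative h' x) (at x)" for x
    unfolding h_def h'_def has_real_derivative_iff_has_vector_derivative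
    using has_vector_derivative_add[OF bounded_bilinear.has_vector_derivative[OF bounded_bilinear_inner dd dd]
        bounded_bilinear.has_vector_derivative[OF bounded_bilinear_inner dq dq], of x]
    by (simp add: inner_commute algebra_simps)
  have h0: "h x \<ge> 0" for x by (simp add: h_def)
  have bound: "\<bar>h' x\<bar> \<le> (9 * M) * h x" for x
  proof -
    have "\<Delta> x = (3 * (d x \<bullet> e)) *\<^sub>R tau x + (3 * (tb x \<bullet> e) - 2) *\<^sub>R d x"
      unfolding \<Delta>_def d_def by (simp add: algebra_simps inner_diff_left)
    then have "norm (\<Delta> x) \<le> \<bar>3 * (d x \<bullet> e)\<bar> * norm (tau x) + \<bar>3 * (tb x \<bullet> e) - 2\<bar> * norm (d x)"
      using norm_triangle_ineq by (metis norm_scaleR)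
    also have "\<dots> \<le> (3 * norm (d x)) * 1 + 5 * norm (d x)"
      using Cauchy_Schwarz_ineq2[of "d x" e] Cauchy_Schwarz_ineq2[of "tb x" e] unit_e ntb
      by (intro add_mono mult_mono) (auto simp: norm_tau abs_mult)
    finally have \<Delta>: "norm (\<Delta> x) \<le> 8 * norm (d x)" by simp
    have "\<bar>d x \<bullet> q x + q x \<bullet> \<Delta> x\<bar> \<le> norm (d x) * norm (q x) + norm (q x) * norm (\<Delta> x)"
      using Cauchy_Schwarz_ineq2[of "d x" "q x"] Cauchy_Schwarz_ineq2[of "q x" "\<Delta> x"] by linarith
    also have "\<dots> \<le> norm (d x) * norm (q x) + norm (q x) * (8 * norm (d x))"
      by (intro add_left_mono mult_left_mono \<Delta>) simp
    also have "\<dots> = 9 * (norm (d x) * norm (q x))" by simp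
    also have "\<dots> \<le> 9 * (h x / 2)"
      using zero_le_power2[of "norm (d x) - norm (q x)"]
      by (simp add: h_def power2_diff power2_norm_eq_inner[symmetric])
    finally have "2 * g x * \<bar>d x \<bullet> q x + q x \<bullet> \<Delta> x\<bar> \<le> 2 * g x * (9 * (h x / 2))"
      by (intro mult_left_mono) auto
    also have "\<dots> \<le> 2 * M * (9 * (h x / 2))" using g_upper[of x] h0[of x] by (intro mult_right_mono) auto
    finally show ?thesis by (simp add: h'_def abs_mult)
  qed
  have hx1: "h x1 = 0"
    using x1 by (simp add: h_def d_def q_def tb_def kb_def \<phi> elastica_tangent_def elastica_curvature_def)
  have "h x = 0"
  proof (cases "x1 \<le> x")
    case True
    have "exp (- (9 * M) * x) * h x \<le> exp (- (9 * M) * x1) * h x1"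
    proof (rule DERIV_nonpos_imp_nonincreasing[OF True])
      fix y
      have "((\<lambda>x. exp (- (9 * M) * x) * h x) has_real_derivative exp (- (9 * M) * y) * (h' y - 9 * M * h y)) (at y)"
        by (rule derivative_eq_intros dh refl)+ (simp add: algebra_simps)
      moreover have "exp (- (9 * M) * y) * (h' y - 9 * M * h y) \<le> 0"
        using bound[of y] by (intro mult_nonneg_nonpos) auto
      ultimately show "\<exists>z. ((\<lambda>x. exp (- (9 * M) * x) * h x) has_real_derivative z) (at y) \<and> z \<le> 0" by blast
    qed
    then have "h x \<le> 0" using hx1 by (simp add: mult_le_0_iff)
    then show ?thesis using h0[of x] by simp
  next
    case False
    then have "x \<le> x1" by simp
    have "exp ((9 * M) * x) * h x \<le> exp ((9 * M) * x1) * h x1"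
    proof (rule DERIV_nonneg_imp_nondecreasing[OF \<open>x \<le> x1\<close>])
      fix y
      have "((\<lambda>x. exp ((9 * M) * x) * h x) has_real_derivative exp ((9 * M) * y) * (h' y + 9 * M * h y)) (at y)"
        by (rule derivative_eq_intros dh refl)+ (simp add: algebra_simps)
      moreover have "exp ((9 * M) * y) * (h' y + 9 * M * h y) \<ge> 0"
        using bound[of y] by (intro mult_nonneg_nonneg) auto
      ultimately show "\<exists>z. ((\<lambda>x. exp ((9 * M) * x) * h x) has_real_derivative z) (at y) \<and> z \<ge> 0" by blast
    qed
    then have "h x \<le> 0" using hx1 by (simp add: mult_le_0_iff)
    then show ?thesis using h0[of x] by simp
  qed
  then have "d x \<bullet> d x = 0" using inner_ge_zero[of "d x"] inner_ge_zero[of "q x"] unfolding h_def by linarith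
  then show ?thesis by (simp add: d_def tb_def)
qed

theorem line_or_elastica: "straight_line c \<or> borderline_elastica c"
proof (cases "\<forall>x. v x = 0")
  case True
  then have "tau x = e" for x using v_eq[of x] by simp
  then show ?thesis using straight_line_of_constant_tangent[OF m_pos g_lower] by blast
next
  case False
  then obtain x0 where x0: "v x0 \<noteq> 0" by blast
  obtain x1 where x1: "tau x1 = - e" "kap x1 \<bullet> kap x1 = 4" "kap x1 \<bullet> e = 0"
    by (rule turning_point[OF x0])
  define \<omega> where "\<omega> = (-1/2) *\<^sub>R kap x1"
  have \<omega>: "\<omega> \<bullet> \<omega> = 1" "\<omega> \<bullet> e = 0" "kap x1 = - 2 *\<^sub>R \<omega>" using x1 by (simp_all add: \<omega>_def)
  have e\<omega>: "e \<bullet> \<omega> = 0" using \<omega>(2) by (simp add: inner_commute)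
  obtain \<phi> where \<phi>: "\<phi> x1 = 0" "\<And>x. (\<phi> has_real_derivative g x) (at x)" "reparametrization \<phi>"
    using arclength_parameter[OF m_pos g_lower, of x1] by blast
  have t: "tau x = elastica_tangent e \<omega> (\<phi> x)" for x
    by (rule tangent_eq_elastica[OF \<phi>(2,1) x1(1) \<omega>(3,1,2)])
  define b where "b = (\<lambda>s. (s - 2 * tanh s) *\<^sub>R e + (2 / cosh s) *\<^sub>R \<omega>)"
  have "(b has_vector_derivative elastica_tangent e \<omega> s) (at s)" for s
  proof -
    have 1: "((\<lambda>s. s - 2 * tanh s) has_real_derivative 1 - 2 / (cosh s)\<^sup>2) (at s)"
    proof -
      have "1 - (tanh s)\<^sup>2 = 1 / (cosh s)\<^sup>2"
        using hyperbolic_pythagoras[of s] by (simp add: tanh_def power_divide eq_divide_eq left_diff_distrib)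
      then show ?thesis by (auto intro!: derivative_eq_intros)
    qed
    have 2: "((\<lambda>s. 2 / cosh s) has_real_derivative - (2 * sinh s / (cosh s)\<^sup>2)) (at s)"
      by (rule derivative_eq_intros refl | simp)+ (simp add: power2_eq_square)
    show ?thesis unfolding b_def elastica_tangent_def
      using has_vector_derivative_add[OF has_vector_derivative_scaleR[OF 1 has_vector_derivative_const[of e]]
        has_vector_derivative_scaleR[OF 2 has_vector_derivative_const[of \<omega>]]]
      by (simp only: scaleR_zero_right add_0_left scaleR_minus_left) simp
  qed
  then have "((\<lambda>x. b (\<phi> x)) has_vector_derivative g x *\<^sub>R elastica_tangent e \<omega> (\<phi> x)) (at x)" for x
    using vector_diff_chain_at[of \<phi> "g x" x b] \<phi>(2) by (simp add: o_def has_real_derivative_iff_has_vector_derivative)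
  moreover have "(c has_vector_derivative g x *\<^sub>R elastica_tangent e \<omega> (\<phi> x)) (at x)" for x
    using c_derivative[of x] by (simp add: t)
  ultimately obtain p where p: "\<And>x. c x = p + b (\<phi> x)"
    using constant_of_arclength_derivative[of c "\<lambda>x. elastica_tangent e \<omega> (\<phi> x)" "\<lambda>x. b (\<phi> x)"] by blast
  define F where "F = (\<lambda>y :: real^2. p + (y$1) *\<^sub>R e + (y$2) *\<^sub>R \<omega>)"
  have "dist (F y) (F z) = 1 * dist y z" for y z
  proof -
    have "F y - F z = (y$1 - z$1) *\<^sub>R e + (y$2 - z$2) *\<^sub>R \<omega>" by (simp add: F_def algebra_simps)
    then have "(norm (F y - F z))\<^sup>2 = (y$1 - z$1)\<^sup>2 + (y$2 - z$2)\<^sup>2"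
      unfolding power2_norm_eq_inner by (simp add: inner_add_left inner_add_right ee \<omega>(1,2) e\<omega> power2_eq_square)
    also have "\<dots> = (norm (y - z))\<^sup>2"
      unfolding power2_norm_eq_inner inner_vec_def sum_2 by (simp add: power2_eq_square)
    finally show ?thesis by (simp add: dist_norm)
  qed
  moreover have "c x = F (gamma_b (\<phi> x))" for x
    by (simp add: p F_def gamma_b_def b_def vector_2)
  ultimately have "borderline_elastica c"
    unfolding borderline_elastica_def using \<phi>(3) by (intro exI[of _ F] exI[of _ 1] exI[of _ \<phi>]) auto
  then show ?thesis ..
qed

end

section \<open>Isometric images\<close>

lemma reparametrization_sign:
  assumes "reparametrization \<phi>"
  obtains \<sigma> where "\<bar>\<sigma>\<bar> = 1" "\<And>x. Dx \<phi> x = \<sigma> * \<bar>Dx \<phi> x\<bar>"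
proof -
  have nz: "Dx \<phi> x \<noteq> 0" for x using assms by (simp add: reparametrization_def)
  have cont: "continuous_on UNIV (Dx \<phi>)"
    using assms by (intro smooth_continuous smooth_Dx) (simp add: reparametrization_def)
  have "sgn (Dx \<phi> x) = sgn (Dx \<phi> 0)" for x
  proof -
    have "continuous_on UNIV (\<lambda>x. sgn (Dx \<phi> x))"
      by (intro continuous_intros cont) (use nz in auto)
    moreover have "finite (range (\<lambda>x. sgn (Dx \<phi> x)))"
      by (rule finite_subset[of _ "{-1, 0, 1}"]) (auto simp: sgn_if)
    ultimately show ?thesis
      using continuous_finite_range_constant_eq[of UNIV] by (metis UNIV_I connected_UNIV constant_on_def continuous_finite_range_constant)
  qed
  then show ?thesis using that[of "sgn (Dx \<phi> 0)"] nz by (metis abs_sgn_eq_1 sgn_mult_abs)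
qed

lemma reparametrization_substitution:
  fixes f :: "real \<Rightarrow> real"
  assumes \<phi>: "reparametrization \<phi>" and f: "continuous_on UNIV f" and ab: "a \<le> b"
  shows "integral {a..b} (\<lambda>x. f (\<phi> x) * \<bar>Dx \<phi> x\<bar>) = integral {min (\<phi> a) (\<phi> b)..max (\<phi> a) (\<phi> b)} f"
proof -
  obtain \<sigma> where \<sigma>: "\<bar>\<sigma>\<bar> = 1" "\<And>x. Dx \<phi> x = \<sigma> * \<bar>Dx \<phi> x\<bar>" by (rule reparametrization_sign[OF \<phi>]) blast
  have sm: "smooth \<phi>" using \<phi> by (simp add: reparametrization_def)
  have "isCont f x" for x using f by (simp add: continuous_on_eq_continuous_at)
  then obtain P where P: "\<And>x. (P has_vector_derivative f x) (at x)"
    using einterval_antiderivative[of "-\<infinity>" "\<infinity>" f] by auto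
  have intf: "integral {u..w} f = P w - P u" if "u \<le> w" for u w
    using fundamental_theorem_of_calculus[OF that has_vector_derivative_at_within[OF P]] by (rule integral_unique)
  have "((\<lambda>x. P (\<phi> x)) has_vector_derivative Dx \<phi> x * f (\<phi> x)) (at x)" for x
    using vector_diff_chain_at[OF smooth_has_derivative[OF sm] P] by (simp add: o_def)
  then have "((\<lambda>x. Dx \<phi> x * f (\<phi> x)) has_integral P (\<phi> b) - P (\<phi> a)) {a..b}"
    using ab by (intro fundamental_theorem_of_calculus[OF ab has_vector_derivative_at_within])
  then have "((\<lambda>x. \<sigma> * (Dx \<phi> x * f (\<phi> x))) has_integral \<sigma> * (P (\<phi> b) - P (\<phi> a))) {a..b}"
    by (rule has_integral_mult_right)
  moreover have "\<sigma> * (Dx \<phi> x * f (\<phi> x)) = f (\<phi> x) * \<bar>Dx \<phi> x\<bar>" for x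
  proof -
    have "\<sigma> * \<sigma> = 1" using \<sigma>(1) by (metis abs_mult_self_eq mult_1)
    then have "\<sigma> * Dx \<phi> x = \<bar>Dx \<phi> x\<bar>" using \<sigma>(2)[of x] by (metis mult.assoc mult_1)
    then show ?thesis by (simp add: mult.assoc[symmetric] mult.commute)
  qed
  ultimately have I: "integral {a..b} (\<lambda>x. f (\<phi> x) * \<bar>Dx \<phi> x\<bar>) = \<sigma> * (P (\<phi> b) - P (\<phi> a))"
    by (simp add: integral_unique)
  have mono: "0 \<le> \<sigma> * (\<phi> b - \<phi> a)"
  proof -
    have "0 \<le> \<sigma> * Dx \<phi> x" for x 
      using \<sigma>(1) \<sigma>(2)[of x] by (metis abs_ge_zero abs_mult_self_eq mult.assoc mult_1)
    moreover have "((\<lambda>x. \<sigma> * Dx \<phi> x) has_integral \<sigma> * (\<phi> b - \<phi> a)) {a..b}"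
      by (intro has_integral_mult_right fundamental_theorem_of_calculus[OF ab has_vector_derivative_at_within[OF smooth_has_derivative[OF sm]]])
    ultimately show ?thesis using has_integral_nonneg by blast
  qed
  show ?thesis
  proof (cases "\<sigma> = 1")
    case True
    then show ?thesis using I mono intf[of "\<phi> a" "\<phi> b"] by (simp add: min_def max_def)
  next
    case False
    then have "\<sigma> = -1" using \<sigma>(1) by linarith
    then show ?thesis using I mono intf[of "\<phi> b" "\<phi> a"] by (auto simp: min_def max_def)
  qed
qed

locale isometric_pair = im: immersed_curve c + or: immersed_curve d
  for c d :: "real \<Rightarrow> 'a::euclidean_space" +
  fixes e :: 'a and \<alpha> m E0 K :: real
  assumes unit_e: "norm e = 1" and \<alpha>_pos: "0 < \<alpha>"
    and isometric: "isometric_curves c (\<lambda>x. \<alpha> *\<^sub>R d x)"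
    and m_pos: "0 < m" and speed_lower: "\<And>x. m \<le> norm (Dx c x)"
    and energy_c: "\<And>r. integral {-r..r} (im.density e) \<le> K"
    and energy_d: "\<And>r. integral {-r..r} (or.density e) \<le> E0"
begin

lemma geometry:
  obtains A \<sigma> \<phi> where "orthogonal_transformation A" "\<bar>\<sigma>\<bar> = 1" "reparametrization \<phi>"
    "\<And>x. norm (Dx c x) = \<bar>Dx \<phi> x\<bar> * (\<alpha> * norm (Dx d (\<phi> x)))"
    "\<And>x. Ds c c x = \<sigma> *\<^sub>R A (Ds d d (\<phi> x))"
    "\<And>x. curvature c x = (1 / \<alpha>) *\<^sub>R A (curvature d (\<phi> x))"
proof -
  obtain F \<phi> where F: "\<And>p q. dist (F p) (F q) = dist p q" and \<phi>: "reparametrization \<phi>"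
    and cF: "\<And>x. c x = F (\<alpha> *\<^sub>R d (\<phi> x))"
    using isometric unfolding isometric_curves_def by blast
  define A where "A = (\<lambda>p. F p - F 0)"
  have A: "orthogonal_transformation A"
    unfolding orthogonal_transformation_isometry A_def using F by (simp add: dist_norm)
  then have lin: "linear A" and nA: "\<And>p. norm (A p) = norm p"
    by (auto simp: orthogonal_transformation)
  note bl = linear_conv_bounded_linear[THEN iffD1, OF lin]
  obtain \<sigma> where \<sigma>: "\<bar>\<sigma>\<bar> = 1" "\<And>x. Dx \<phi> x = \<sigma> * \<bar>Dx \<phi> x\<bar>" by (rule reparametrization_sign[OF \<phi>]) blast
  have sm: "smooth \<phi>" using \<phi> by (simp add: reparametrization_def)
  have \<phi>nz: "Dx \<phi> x \<noteq> 0" for x using \<phi> by (simp add: reparametrization_def)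
  have c_eq: "c = (\<lambda>x. F 0 + A (\<alpha> *\<^sub>R d (\<phi> x)))" by (auto simp: cF A_def)
  have chain: "((\<lambda>x. f (\<phi> x)) has_vector_derivative Dx \<phi> x *\<^sub>R Dx f (\<phi> x)) (at x)" if "smooth f" for f :: "real \<Rightarrow> 'a" and x
    using vector_diff_chain_at[OF smooth_has_derivative[OF sm] smooth_has_derivative[OF that]] by (simp add: o_def)
  have "(c has_vector_derivative 0 + A (\<alpha> *\<^sub>R Dx \<phi> x *\<^sub>R Dx d (\<phi> x))) (at x)" for x
    unfolding c_eq
    by (intro has_vector_derivative_add has_vector_derivative_const bounded_linear.has_vector_derivative[OF bl]
       bounded_linear.has_vector_derivative[OF bounded_linear_scaleR_right] chain or.smooth_c)
  then have Dc: "Dx c x = (\<alpha> * Dx \<phi> x) *\<^sub>R A (Dx d (\<phi> x))" for x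
    by (simp add: Dx_eq linear_scale[OF lin])
  have g: "norm (Dx c x) = \<bar>Dx \<phi> x\<bar> * (\<alpha> * norm (Dx d (\<phi> x)))" for x
    unfolding Dc using \<alpha>_pos by (simp add: nA abs_mult)
  have tau: "Ds c c x = \<sigma> *\<^sub>R A (Ds d d (\<phi> x))" for x
  proof -
    have "A (Dx d (\<phi> x)) = norm (Dx d (\<phi> x)) *\<^sub>R A (Ds d d (\<phi> x))"
      using arg_cong[OF or.Dx_c[of "\<phi> x"], of A] by (simp only: linear_scale[OF lin])
    then have "Dx c x = (\<alpha> * Dx \<phi> x * norm (Dx d (\<phi> x))) *\<^sub>R A (Ds d d (\<phi> x))"
      unfolding Dc by simp
    also have "\<alpha> * Dx \<phi> x * norm (Dx d (\<phi> x)) = norm (Dx c x) * \<sigma>"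
      unfolding g by (subst \<sigma>(2)[of x]) (simp add: mult_ac)
    finally have eq: "Dx c x = (norm (Dx c x) * \<sigma>) *\<^sub>R A (Ds d d (\<phi> x))" .
    have "norm (Dx c x) *\<^sub>R Ds c c x = norm (Dx c x) *\<^sub>R (\<sigma> *\<^sub>R A (Ds d d (\<phi> x)))"
      unfolding scaleR_scaleR by (rule trans[OF im.Dx_c[symmetric] eq])
    then show ?thesis using im.immersed[of x] by (simp only: scaleR_cancel_left norm_eq_zero) simp
  qed
  have "curvature c x = (1 / \<alpha>) *\<^sub>R A (curvature d (\<phi> x))" for x
  proof -
    have "(Ds c c has_vector_derivative \<sigma> *\<^sub>R A (Dx \<phi> x *\<^sub>R Dx (Ds d d) (\<phi> x))) (at x)"
      using tau unfolding tau[abs_def]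
      by (intro bounded_linear.has_vector_derivative[OF bl]
         bounded_linear.has_vector_derivative[OF bounded_linear_scaleR_right] chain or.smooth_tau)
    then have "norm (Dx c x) *\<^sub>R curvature c x = \<sigma> *\<^sub>R A (Dx \<phi> x *\<^sub>R Dx (Ds d d) (\<phi> x))"
      using vector_derivative_unique_at im.tau_derivative by blast
    also have "Dx (Ds d d) (\<phi> x) = norm (Dx d (\<phi> x)) *\<^sub>R curvature d (\<phi> x)"
      using or.tau_derivative Dx_eq by blast
    also have "\<sigma> *\<^sub>R A (Dx \<phi> x *\<^sub>R norm (Dx d (\<phi> x)) *\<^sub>R curvature d (\<phi> x))
       = ((\<sigma> * Dx \<phi> x) * norm (Dx d (\<phi> x))) *\<^sub>R A (curvature d (\<phi> x))"
      by (simp add: linear_scale[OF lin])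
    also have "\<sigma> * Dx \<phi> x = \<bar>Dx \<phi> x\<bar>"
      using \<sigma>(1) \<sigma>(2)[of x] by (metis abs_mult_self_eq mult.assoc mult_1)
    finally have "norm (Dx c x) *\<^sub>R curvature c x = norm (Dx c x) *\<^sub>R ((1 / \<alpha>) *\<^sub>R A (curvature d (\<phi> x)))"
      unfolding g using \<alpha>_pos by simp
    then show ?thesis using im.immersed[of x] by (simp only: scaleR_cancel_left norm_eq_zero) simp
  qed
  with A \<sigma>(1) \<phi> g tau show ?thesis by (rule that)
qed

text \<open>The linear part \<open>A\<close> of the isometry fixes \<open>e\<close> up to the orientation \<open>\<sigma>\<close> of the parameter: otherwise the
  tangents of the two curves could not both be close to \<open>e\<close> on long pieces, since
  \<open>|\<sigma>Ae - e| \<le> |\<tau>\<^sub>d - e| + |\<tau>\<^sub>c - e|\<close>. So the second part of the energy, which is not invariant under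
  rotations, scales like a length.\<close>

lemma scaled_energy_le:
  "integral {-r..r} (\<lambda>y. (1/2 * (norm (curvature d y))\<^sup>2 / \<alpha> + \<alpha> * (1/2 * (norm (Ds d d y - e))\<^sup>2)) * norm (Dx d y)) \<le> K"
proof -
  obtain A \<sigma> \<phi> where A: "orthogonal_transformation A" and \<sigma>: "\<bar>\<sigma>\<bar> = 1" and \<phi>: "reparametrization \<phi>"
    and g: "\<And>x. norm (Dx c x) = \<bar>Dx \<phi> x\<bar> * (\<alpha> * norm (Dx d (\<phi> x)))"
    and tau: "\<And>x. Ds c c x = \<sigma> *\<^sub>R A (Ds d d (\<phi> x))"
    and kap: "\<And>x. curvature c x = (1 / \<alpha>) *\<^sub>R A (curvature d (\<phi> x))"
    by (rule geometry) blast
  have lin: "linear A" and nA: "\<And>p. norm (A p) = norm p"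
    using A by (auto simp: orthogonal_transformation)
  have iso: "norm (\<sigma> *\<^sub>R A p - \<sigma> *\<^sub>R A q) = norm (p - q)" for p q
  proof -
    have "\<sigma> *\<^sub>R A p - \<sigma> *\<^sub>R A q = \<sigma> *\<^sub>R A (p - q)" by (simp add: linear_diff[OF lin] scaleR_diff_right)
    then show ?thesis using \<sigma> by (simp add: nA)
  qed
  have sm: "smooth \<phi>" using \<phi> by (simp add: reparametrization_def)
  have contd: "continuous_on S (or.density e)" for S
    unfolding or.density_def[abs_def]
    by (intro continuous_intros smooth_continuous or.smooth_kap or.smooth_tau or.smooth_g)
  have contc: "continuous_on S (im.density e)" for S
    unfolding im.density_def[abs_def]
    by (intro continuous_intros smooth_continuous im.smooth_kap im.smooth_tau im.smooth_g)
  have contp: "continuous_on S (\<lambda>x. or.density e (\<phi> x) * \<bar>Dx \<phi> x\<bar>)" for S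
    by (intro continuous_intros continuous_on_compose2[OF contd[of UNIV]] smooth_continuous sm smooth_Dx) simp
  define \<delta> where "\<delta> = (norm (\<sigma> *\<^sub>R A e - e))\<^sup>2 / 4"
  \<comment> \<open>a fixed amount of energy per unit of the parameter, shared by the two curves, if \<open>\<sigma>Ae \<noteq> e\<close>\<close>
  have ptw: "\<delta> * m \<le> im.density e x + \<alpha> * (or.density e (\<phi> x) * \<bar>Dx \<phi> x\<bar>)" for x
  proof -
    define a b where "a = norm (Ds c c x - e)" and "b = norm (Ds d d (\<phi> x) - e)"
    have "norm (\<sigma> *\<^sub>R A e - e) \<le> norm (\<sigma> *\<^sub>R A e - Ds c c x) + norm (Ds c c x - e)"
      using norm_triangle_ineq[of "\<sigma> *\<^sub>R A e - Ds c c x" "Ds c c x - e"] by simp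
    also have "norm (\<sigma> *\<^sub>R A e - Ds c c x) = b" unfolding tau iso b_def by (rule norm_minus_commute)
    finally have "norm (\<sigma> *\<^sub>R A e - e) \<le> a + b" by (simp add: a_def)
    then have "(norm (\<sigma> *\<^sub>R A e - e))\<^sup>2 \<le> (a + b)\<^sup>2" by (intro power_mono) auto
    also have "\<dots> \<le> 2 * (a\<^sup>2 + b\<^sup>2)"
      using zero_le_power2[of "a - b"] by (simp add: power2_sum power2_diff)
    finally have "\<delta> \<le> 1/2 * a\<^sup>2 + 1/2 * b\<^sup>2" by (simp add: \<delta>_def)
    then have "\<delta> * m \<le> (1/2 * a\<^sup>2 + 1/2 * b\<^sup>2) * norm (Dx c x)"
      using speed_lower[of x] m_pos by (intro mult_mono) auto
    also have "\<dots> = 1/2 * a\<^sup>2 * norm (Dx c x) + \<alpha> * ((1/2 * b\<^sup>2 * norm (Dx d (\<phi> x))) * \<bar>Dx \<phi> x\<bar>)"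
      unfolding distrib_right by (subst (2) g) simp
    also have "\<dots> \<le> im.density e x + \<alpha> * (or.density e (\<phi> x) * \<bar>Dx \<phi> x\<bar>)"
      unfolding im.density_def or.density_def a_def b_def using \<alpha>_pos
      by (intro add_mono mult_left_mono mult_right_mono) auto
    finally show ?thesis .
  qed
  have sub_le: "integral {-s..s} (\<lambda>x. or.density e (\<phi> x) * \<bar>Dx \<phi> x\<bar>) \<le> E0" if "0 \<le> s" for s
  proof -
    define r where "r = max \<bar>\<phi> (-s)\<bar> \<bar>\<phi> s\<bar>"
    have "integral {-s..s} (\<lambda>x. or.density e (\<phi> x) * \<bar>Dx \<phi> x\<bar>) =
        integral {min (\<phi> (-s)) (\<phi> s)..max (\<phi> (-s)) (\<phi> s)} (or.density e)"
      using that by (intro reparametrization_substitution \<phi> contd) auto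
    also have "\<dots> \<le> integral {-r..r} (or.density e)"
      by (intro integral_subset_le integrable_continuous_interval contd) (auto simp: r_def or.density_nonneg)
    finally show ?thesis using energy_d[of r] by linarith
  qed
  have "2 * s * (\<delta> * m) \<le> K + \<alpha> * E0" if s: "0 \<le> s" for s
  proof -
    have "2 * s * (\<delta> * m) = integral {-s..s} (\<lambda>x. \<delta> * m)" using s by simp
    also have "\<dots> \<le> integral {-s..s} (\<lambda>x. im.density e x + \<alpha> * (or.density e (\<phi> x) * \<bar>Dx \<phi> x\<bar>))"
      by (intro integral_le integrable_continuous_interval continuous_intros contc contp ptw)
    also have "\<dots> = integral {-s..s} (im.density e) + \<alpha> * integral {-s..s} (\<lambda>x. or.density e (\<phi> x) * \<bar>Dx \<phi> x\<bar>)"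
      by (subst Henstock_Kurzweil_Integration.integral_add)
        (intro integrable_continuous_interval continuous_intros contc contp
          | rule integrable_on_mult_right | simp)+
    also have "\<dots> \<le> K + \<alpha> * E0"
      using energy_c[of s] sub_le[OF s] \<alpha>_pos by (intro add_mono mult_left_mono) auto
    finally show ?thesis .
  qed
  note lin_bound = this
  have "\<delta> = 0"
  proof (rule ccontr)
    assume "\<delta> \<noteq> 0"
    then have "\<delta> * m > 0" using m_pos by (simp add: \<delta>_def)
    moreover define s where "s = (\<bar>K + \<alpha> * E0\<bar> + 1) / (\<delta> * m)"
    ultimately have "0 \<le> s" "s * (\<delta> * m) = \<bar>K + \<alpha> * E0\<bar> + 1" by auto
    then show False using lin_bound[of s] by linarith
  qed
  then have Ae: "\<sigma> *\<^sub>R A e = e" by (simp add: \<delta>_def)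
  define f where "f = (\<lambda>y. (1/2 * (norm (curvature d y))\<^sup>2 / \<alpha> + \<alpha> * (1/2 * (norm (Ds d d y - e))\<^sup>2)) * norm (Dx d y))"
  have contf: "continuous_on S f" for S
  proof -
    note cont = smooth_continuous[OF or.smooth_kap] smooth_continuous[OF or.smooth_tau] smooth_continuous[OF or.smooth_g]
    show ?thesis unfolding f_def using \<alpha>_pos by (intro continuous_intros cont) auto
  qed
  have f0: "0 \<le> f y" for y using \<alpha>_pos by (simp add: f_def)
  have dens: "im.density e x = f (\<phi> x) * \<bar>Dx \<phi> x\<bar>" for x
  proof -
    have "norm (Ds c c x - e) = norm (Ds d d (\<phi> x) - e)"
      unfolding tau using iso[of _ e] by (simp add: Ae)
    then have "im.density e x = (1/2 * (norm (curvature d (\<phi> x)) / \<alpha>)\<^sup>2 + 1/2 * (norm (Ds d d (\<phi> x) - e))\<^sup>2)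
        * (\<bar>Dx \<phi> x\<bar> * (\<alpha> * norm (Dx d (\<phi> x))))"
      unfolding im.density_def g kap using \<alpha>_pos by (simp add: nA)
    also have "\<dots> = f (\<phi> x) * \<bar>Dx \<phi> x\<bar>"
    proof -
      have eq: "(1/2 * (k / \<alpha>)\<^sup>2 + 1/2 * n\<^sup>2) * (p * (\<alpha> * q)) = (1/2 * k\<^sup>2 / \<alpha> + \<alpha> * (1/2 * n\<^sup>2)) * q * p"
        for k n p q :: real
      proof -
        have 1: "(k / \<alpha>)\<^sup>2 * \<alpha> = k\<^sup>2 / \<alpha>" using \<alpha>_pos by (simp add: power2_eq_square)
        have "(1/2 * (k / \<alpha>)\<^sup>2 + 1/2 * n\<^sup>2) * (p * (\<alpha> * q)) = (1/2 * ((k / \<alpha>)\<^sup>2 * \<alpha>) + \<alpha> * (1/2 * n\<^sup>2)) * q * p"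
          by (simp only: distrib_left distrib_right mult_ac)
        then show ?thesis unfolding 1 by simp
      qed
      show ?thesis unfolding f_def by (rule eq)
    qed
    finally show ?thesis .
  qed
  have "surj \<phi>" using \<phi> by (simp add: reparametrization_def bij_def)
  then obtain u w where uw: "\<phi> u = - r" "\<phi> w = r" by (metis surj_def)
  define s where "s = max \<bar>u\<bar> \<bar>w\<bar>"
  show ?thesis
  proof (cases "0 \<le> r")
    case True
    have "integral {-r..r} f = integral {min (\<phi> (min u w)) (\<phi> (max u w))..max (\<phi> (min u w)) (\<phi> (max u w))} f"
      using True uw by (auto simp: min_def max_def)
    also have "\<dots> = integral {min u w..max u w} (\<lambda>x. f (\<phi> x) * \<bar>Dx \<phi> x\<bar>)"
      by (rule reparametrization_substitution[symmetric, OF \<phi> contf]) simp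
    also have "\<dots> = integral {min u w..max u w} (im.density e)" by (simp add: dens[abs_def])
    also have "\<dots> \<le> integral {-s..s} (im.density e)"
      by (intro integral_subset_le integrable_continuous_interval contc) (auto simp: s_def im.density_nonneg)
    finally show ?thesis using energy_c[of s] by (simp add: f_def)
  next
    case False
    then show ?thesis using energy_c[of r] by simp
  qed
qed

end

section \<open>Solitons of finite energy\<close>

lemma (in immersed_curve) energy_bounds_integral:
  assumes "energy e c < \<infinity>"
  shows "integral {-r..r} (density e) \<le> enn2real (energy e c)"
proof -
  have "continuous_on {-r..r} (density e)"
    unfolding density_def[abs_def]
    by (intro continuous_intros smooth_continuous smooth_kap smooth_tau smooth_g)
  then have "(density e has_integral integral {-r..r} (density e)) {-r..r}"
    by (intro integrable_integral integrable_continuous_interval)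
  then have "(\<integral>\<^sup>+x. indicator {-r..r} x * density e x \<partial>lborel) = integral {-r..r} (density e)"
    by (intro nn_integral_has_integral_lebesgue density_nonneg) 
  then have "ennreal (integral {-r..r} (density e)) = (\<integral>\<^sup>+x. ennreal (indicator {-r..r} x * density e x) \<partial>lborel)"
    by simp
  also have "\<dots> \<le> energy e c"
    unfolding energy_def density_def[symmetric]
    by (intro nn_integral_mono) (auto simp: indicator_def density_nonneg)
  finally have "ennreal (integral {-r..r} (density e)) \<le> ennreal (enn2real (energy e c))"
    using assms by (simp add: less_top)
  then show ?thesis by (simp add: ennreal_le_iff)
qed

lemma (in immersed_curve) stationary_iff: "stationary c \<longleftrightarrow> (\<forall>x. vel x = 0)"
proof -
  have "vel x = - (nabla_s c nk x + (1/2 * (norm (kap x))\<^sup>2) *\<^sub>R kap x - kap x)" for x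
    unfolding vel_def Ds_force by (simp add: power2_norm_eq_inner scaleR_diff_left)
  then show ?thesis unfolding stationary_def by (simp only: neg_equal_0_iff_equal)
qed

lemma (in immersed_curve) stationary_of_zero_curvature:
  assumes "\<And>x. kap x = 0"
  shows "stationary c"
proof -
  have k: "curvature c = (\<lambda>x. 0)" using assms by auto
  have n: "nabla_s c (\<lambda>x. 0) = (\<lambda>x. 0)"
    by (auto simp: nabla_s_def Ds_def Dx_def)
  show ?thesis unfolding stationary_def k n by simp
qed

lemma (in immersed_curve) constant_tangent_of_zero_curvature:
  assumes "\<And>x. kap x = 0"
  obtains w where "\<And>x. tau x = w"
proof -
  have "(tau has_vector_derivative 0) (at x)" for x using tau_derivative[of x] assms by simp
  then obtain w where "\<And>x. tau x = w"
    by (rule has_vector_derivative_zero_constant[OF convex_UNIV]) blast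
  then show ?thesis by (rule that)
qed

lemma vanishing_integrals:
  fixes f :: "real \<Rightarrow> real"
  assumes f: "continuous_on UNIV f" "\<And>x. 0 \<le> f x" and I: "\<And>r. integral {-r..r} f \<le> 0"
  shows "f x = 0"
proof -
  define r where "r = \<bar>x\<bar> + 1"
  have cont: "continuous_on {-r..r} f" using f(1) by (rule continuous_on_subset) simp
  have "integral {-r..r} f = 0"
    by (rule order_antisym[OF I integral_nonneg[OF integrable_continuous_interval[OF cont] f(2)]])
  moreover have "-r < r" "x \<in> {-r..r}" by (auto simp: r_def)
  ultimately show ?thesis using integral_eq_0_iff[OF cont _ f(2)] by blast
qed

context elastic_flow
begin

lemma energy_nonincreasing:
  assumes t: "t \<in> J" and E0: "\<And>r. integral {-r..r} (edens 0) \<le> E0"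
  shows "integral {-r..r} (edens t) \<le> E0"
proof (cases "0 \<le> r")
  case True
  have "integral {-r..r} (edens t) \<le> E0 - 0 * t"
  proof (rule energy_dissipation[OF t True order_refl _ E0])
    fix s assume "s \<in> {0..t}"
    then have "s \<in> J" using t by auto
    show "0 \<le> integral {-r..r} (\<lambda>x. speed s x * (velocity s x \<bullet> velocity s x))"
      by (intro integral_nonneg integrable_continuous_interval vel_sq_continuous[OF \<open>s \<in> J\<close>]) simp
  qed
  then show ?thesis by simp
next
  case False
  then show ?thesis using E0[of "-1"] by simp
qed

lemma zero_in_J: "0 \<in> J" using T_pos by simp

lemma profile_curve: "immersed_curve \<gamma>0"
  using curve[OF zero_in_J] by (simp add: initial)

lemma scaled_energy_bound:
  assumes t: "t \<in> J" and \<alpha>: "0 < \<alpha>" and iso: "isometric_curves (\<gamma> t) (\<lambda>x. \<alpha> *\<^sub>R \<gamma>0 x)"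
    and E0: "\<And>r. integral {-r..r} (edens 0) \<le> E0"
    and K: "\<And>r. integral {-r..r} (edens t) \<le> K"
  shows "integral {-r..r} (\<lambda>y. (1/2 * (norm (curvature \<gamma>0 y))\<^sup>2 / \<alpha> + \<alpha> * (1/2 * (norm (Ds \<gamma>0 \<gamma>0 y - e))\<^sup>2)) * norm (Dx \<gamma>0 y)) \<le> K"
proof -
  obtain m where m: "m > 0" "\<And>t x. t \<in> J \<Longrightarrow> m \<le> speed t x" using speed_lower by blast
  interpret im: immersed_curve "\<gamma> t" by (rule curve[OF t])
  interpret or: immersed_curve "\<gamma>0" by (rule profile_curve)
  interpret isometric_pair "\<gamma> t" \<gamma>0 e \<alpha> m E0 K
    by unfold_locales (use unit_e \<alpha> iso m t K E0 in \<open>auto simp: initial\<close>)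
  show ?thesis by (rule scaled_energy_le)
qed

text \<open>A velocity that does not vanish initially dissipates energy at a positive rate for a short time
  \<open>t\<close>. Conservation is expressed through bounded intervals: every bound for the energy at a
  later time also bounds the initial energy. So the supremum \<open>E0\<close> of the latter would not exceed
  \<open>E0\<close> minus the dissipated amount.\<close>

lemma stationary_of_constant_energy:
  assumes bounded: "\<And>r. integral {-r..r} (edens 0) \<le> E1"
    and conserved: "\<And>t K r. t \<in> J \<Longrightarrow> (\<And>r. integral {-r..r} (edens t) \<le> K) \<Longrightarrow> integral {-r..r} (edens 0) \<le> K"
  shows "velocity 0 x = 0"
proof (rule ccontr)
  assume nz: "velocity 0 x \<noteq> 0"
  define E0 where "E0 = (SUP r. integral {-r..r} (edens 0))"
  have E0: "integral {-r..r} (edens 0) \<le> E0" for r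
    unfolding E0_def by (rule cSUP_upper) (auto intro: bdd_aboveI[where M = E1] bounded)
  define R where "R = \<bar>x\<bar> + 1"
  define f where "f = (\<lambda>s x. speed s x * (velocity s x \<bullet> velocity s x))"
  define D where "D = (\<lambda>s. integral {-R..R} (f s))"
  have R: "-R < R" "x \<in> {-R..R}" by (auto simp: R_def)
  have f0: "0 \<le> f s y" for s y by (simp add: f_def)
  have int: "f s integrable_on {-r..r}" if "s \<in> J" for s r
    unfolding f_def by (rule integrable_continuous_interval[OF vel_sq_continuous[OF that]])
  have "continuous_on (J \<times> UNIV) (\<lambda>z. norm (case_prod (Dtx J 0 1 \<gamma>) z) *
      (case_prod (Dtx J 1 0 \<gamma>) z \<bullet> case_prod (Dtx J 1 0 \<gamma>) z))"
    by (intro continuous_intros smooth_strip_continuous[OF strip])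
  then have "continuous_on (J \<times> UNIV) (\<lambda>(s, x). f s x)"
    by (rule continuous_on_cong[THEN iffD1, OF refl, rotated])
      (auto simp: f_def curve_derivatives Dt_space_derivatives simp del: One_nat_def)
  then have "continuous_on (J \<times> cbox (-R) R) (\<lambda>(s, x). f s x)"
    by (rule continuous_on_subset) auto
  then have contD: "continuous_on J D"
    unfolding D_def using integral_continuous_on_param[of J "-R" R f] by simp
  have "D 0 > 0"
  proof -
    have "0 \<le> D 0" unfolding D_def by (rule integral_nonneg[OF int[OF zero_in_J] f0])
    moreover have "D 0 \<noteq> 0"
    proof
      assume "D 0 = 0"
      then have "f 0 x = 0"
        using integral_eq_0_iff[OF vel_sq_continuous[OF zero_in_J], of "-R" R] f0[of 0] R
        unfolding D_def f_def by blast
      then show False using nz immersed_curve.immersed[OF curve[OF zero_in_J]] by (simp add: f_def)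
    qed
    ultimately show ?thesis by simp
  qed
  then obtain \<delta> where \<delta>: "\<delta> > 0" "\<And>s. s \<in> J \<Longrightarrow> dist s 0 < \<delta> \<Longrightarrow> dist (D s) (D 0) < D 0 / 2"
    using contD zero_in_J unfolding continuous_on_iff by (metis half_gt_zero)
  define t where "t = min T (\<delta> / 2)"
  have t: "t \<in> J" "0 < t" using T_pos \<delta> by (auto simp: t_def)
  have low: "D 0 / 2 \<le> D s" if "s \<in> {0..t}" for s
  proof -
    have "s \<in> J" "dist s 0 < \<delta>" using that t \<delta> by (auto simp: t_def dist_real_def)
    then show ?thesis using \<delta>(2)[of s] unfolding dist_real_def by linarith
  qed
  have decay: "integral {-r..r} (edens t) \<le> E0 - D 0 / 2 * t" if r: "R \<le> r" for r
  proof (rule energy_dissipation[OF t(1) _ _ _ E0])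
    show "0 \<le> r" using r by (simp add: R_def)
    show "0 \<le> D 0 / 2" using \<open>D 0 > 0\<close> by simp
    fix s assume s: "s \<in> {0..t}"
    then have sJ: "s \<in> J" using t by auto
    have "D s \<le> integral {-r..r} (f s)"
      unfolding D_def using r by (intro integral_subset_le int sJ) (auto simp: f0)
    then show "D 0 / 2 \<le> integral {-r..r} (\<lambda>x. speed s x * (velocity s x \<bullet> velocity s x))"
      using low[OF s] by (simp add: f_def)
  qed
  have edens_nonneg: "0 \<le> edens s y" if "s \<in> J" for s y
    by (rule immersed_curve.density_nonneg[OF curve[OF that]])
  have "integral {-r..r} (edens t) \<le> E0 - D 0 / 2 * t" for r
  proof -
    have "integral {-r..r} (edens t) \<le> integral {-max r R..max r R} (edens t)"
      by (intro integral_subset_le integrable_continuous_interval edens_continuous t) (auto simp: edens_nonneg[OF t(1)])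
    then show ?thesis using decay[of "max r R"] by simp
  qed
  then have "integral {-r..r} (edens 0) \<le> E0 - D 0 / 2 * t" for r
    by (rule conserved[OF t(1)])
  then have "E0 \<le> E0 - D 0 / 2 * t" unfolding E0_def by (intro cSUP_least) auto
  moreover have "0 < D 0 / 2 * t" using \<open>D 0 > 0\<close> t by simp
  ultimately show False by linarith
qed

lemma profile_line_or_elastica:
  assumes E: "\<And>r. integral {-r..r} (edens 0) \<le> E0" and v: "\<And>x. velocity 0 x = 0"
  shows "straight_line \<gamma>0 \<or> borderline_elastica \<gamma>0"
proof -
  interpret immersed_curve \<gamma>0 by (rule profile_curve)
  obtain B where B:
    "\<And>t x. t \<in> J \<Longrightarrow> norm (curvature (\<gamma> t) x) \<le> B"
    "\<And>t x. t \<in> J \<Longrightarrow> norm (nabla_s (\<gamma> t) (curvature (\<gamma> t)) x) \<le> B"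
    by (rule uniform_bounds) (rule that, assumption+)
  obtain m where m: "m > 0" "\<And>t x. t \<in> J \<Longrightarrow> m \<le> speed t x" using speed_lower by blast
  obtain M where M: "\<forall>t\<in>J. \<forall>x. speed t x \<le> M" using derivative_bound[of 1, simplified] by blast
  interpret stationary_curve \<gamma>0 e m M B E0
    by unfold_locales
      (use unit_e m(1) m(2)[OF zero_in_J] B(1)[OF zero_in_J] B(2)[OF zero_in_J] M[rule_format, OF zero_in_J] E v in \<open>auto simp: initial\<close>)
  show ?thesis by (rule line_or_elastica)
qed

end

lemma elastic_flow_of_maximal_solution:
  assumes "maximal_solution \<gamma>0 T \<gamma>" "0 < t" "ereal t < T" "\<gamma>0 \<in> dot_Cinf" "norm e = 1"
  shows "elastic_flow \<gamma>0 t \<gamma> e"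
  using assms unfolding maximal_solution_def by unfold_locales auto

lemma times_towards:
  assumes "T > 0" "eventually P (towards T)"
  obtains t where "0 < t" "ereal t < T" "P t"
proof (cases "T = \<infinity>")
  case True
  then have "eventually (\<lambda>t. P t \<and> 0 < t) at_top"
    using assms(2) by (simp add: towards_def eventually_conj eventually_gt_at_top)
  then obtain t where "P t" "0 < t" using eventually_happens trivial_limit_at_top_linorder by blast
  then show ?thesis using True by (intro that[of t]) auto
next
  case False
  then obtain T' where T': "T = ereal T'" "0 < T'" using assms(1) by (cases T) auto
  then have "eventually P (at_left T')" using assms(2) False by (simp add: towards_def)
  moreover have "eventually (\<lambda>t. t \<in> {0<..<T'}) (at_left T')" by (rule eventually_at_left_real[OF T'(2)])
  ultimately have "eventually (\<lambda>t. P t \<and> t \<in> {0<..<T'}) (at_left T')" by (rule eventually_conj)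
  then obtain t where "P t" "t \<in> {0<..<T'}" using eventually_happens trivial_limit_at_left_real by blast
  then show ?thesis using T' by (intro that[of t]) auto
qed

lemma straight_profile:
  assumes c: "immersed_curve c" and m: "0 < m" "\<And>x. m \<le> norm (Dx c x)"
    and k: "\<And>x. curvature c x = 0"
  shows "stationary c \<and> (straight_line c \<or> borderline_elastica c)"
proof -
  interpret immersed_curve c by (rule c)
  obtain w where "\<And>x. tau x = w" using constant_tangent_of_zero_curvature k by blast
  then show ?thesis
    using straight_line_of_constant_tangent[OF m] stationary_of_zero_curvature k by blast
qed

theorem corollary8p3:
  fixes \<gamma>0 :: "real \<Rightarrow> real ^ 'n" and i1 :: 'n
  assumes "CARD('n) \<ge> 2"
    and "\<gamma>0 \<in> dot_Cinf"
    and "(INF x. norm (Dx \<gamma>0 x)) > 0"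
    and "non_scaling_profile \<gamma>0 \<or> expanding_profile \<gamma>0 \<or> shrinking_profile \<gamma>0"
    and "energy (axis i1 1) \<gamma>0 < \<infinity>"
  shows "stationary \<gamma>0 \<and> (straight_line \<gamma>0 \<or> borderline_elastica \<gamma>0)"
proof -
  define e :: "real ^ 'n" where "e = axis i1 1"
  have e: "norm e = 1" by (simp add: e_def norm_axis_1)
  define m where "m = (INF x. norm (Dx \<gamma>0 x))"
  have m: "0 < m" "m \<le> norm (Dx \<gamma>0 x)" for x
    using assms(3) by (auto simp: m_def intro!: cINF_lower bdd_belowI[where m = 0])
  interpret immersed_curve \<gamma>0
  proof
    show "smooth \<gamma>0" using assms(2) by (simp add: dot_Cinf_def)
    show "Dx \<gamma>0 x \<noteq> 0" for x using m(1) m(2)[of x] by auto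
  qed
  define E0 where "E0 = enn2real (energy e \<gamma>0)"
  have E0: "integral {-r..r} (density e) \<le> E0" for r
    unfolding E0_def by (rule energy_bounds_integral) (use assms(5) in \<open>simp add: e_def\<close>)
  define k where "k = (\<lambda>y. 1/2 * (norm (curvature \<gamma>0 y))\<^sup>2 * norm (Dx \<gamma>0 y))"
  define l where "l = (\<lambda>y. 1/2 * (norm (Ds \<gamma>0 \<gamma>0 y - e))\<^sup>2 * norm (Dx \<gamma>0 y))"
  have cont: "continuous_on S k" "continuous_on S l" for S
    unfolding k_def l_def
    by (intro continuous_intros smooth_continuous smooth_kap smooth_tau smooth_g)+
  have nonneg: "0 \<le> k y" "0 \<le> l y" for y by (auto simp: k_def l_def)
  have int: "k integrable_on {a..b}" "l integrable_on {a..b}" for a b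
    by (intro integrable_continuous_interval cont)+
  \<comment> \<open>the two parts of the energy of the profile, scaled by an admissible factor \<open>a\<close>, stay bounded;
    an unbounded \<open>a\<close> kills the tangent part, an \<open>a\<close> close to \<open>0\<close> the curvature part\<close>
  have scaled: "integral {-r..r} k / a \<le> E0 \<and> a * integral {-r..r} l \<le> E0"
    if sol: "maximal_solution \<gamma>0 T \<gamma>" and t: "0 < t" "ereal t < T" and a: "0 < a"
      and iso: "isometric_curves (\<gamma> t) (\<lambda>x. a *\<^sub>R \<gamma>0 x)" for T \<gamma> t a r
  proof -
    interpret F: elastic_flow \<gamma>0 t \<gamma> e
      by (rule elastic_flow_of_maximal_solution[OF sol t assms(2) e])
    have tJ: "t \<in> F.J" using t by simp
    have E: "integral {-r..r} (F.edens 0) \<le> E0" for r using E0 by (simp add: F.initial)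
    have "integral {-r..r} (\<lambda>y. (1/2 * (norm (curvature \<gamma>0 y))\<^sup>2 / a + a * (1/2 * (norm (Ds \<gamma>0 \<gamma>0 y - e))\<^sup>2)) * norm (Dx \<gamma>0 y)) \<le> E0"
      by (rule F.scaled_energy_bound[OF tJ a iso E F.energy_nonincreasing[OF tJ E]])
    also have "(\<lambda>y. (1/2 * (norm (curvature \<gamma>0 y))\<^sup>2 / a + a * (1/2 * (norm (Ds \<gamma>0 \<gamma>0 y - e))\<^sup>2)) * norm (Dx \<gamma>0 y))
       = (\<lambda>y. inverse a * k y + a * l y)"
    proof -
      have "(1/2 * p\<^sup>2 / a + a * (1/2 * q\<^sup>2)) * g = inverse a * (1/2 * p\<^sup>2 * g) + a * (1/2 * q\<^sup>2 * g)"
        for p q g :: real by (simp add: inverse_eq_divide distrib_right)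
      then show ?thesis unfolding k_def l_def by (rule ext)
    qed
    also have "integral {-r..r} (\<lambda>y. inverse a * k y + a * l y) = inverse a * integral {-r..r} k + a * integral {-r..r} l"
      by (subst Henstock_Kurzweil_Integration.integral_add) (auto intro!: integrable_on_mult_right int)
    finally have "inverse a * integral {-r..r} k + a * integral {-r..r} l \<le> E0" .
    moreover have "0 \<le> inverse a * integral {-r..r} k" "0 \<le> a * integral {-r..r} l"
      using a by (auto intro!: mult_nonneg_nonneg integral_nonneg int nonneg)
    ultimately show ?thesis by (simp add: inverse_eq_divide)
  qed
  have E0_nonneg: "0 \<le> E0" by (simp add: E0_def)
  from assms(4) show ?thesis
  proof (elim disjE)
    assume "expanding_profile \<gamma>0"
    then obtain T \<gamma> \<alpha> where sol: "maximal_solution \<gamma>0 T \<gamma>"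
      and pos: "\<forall>t\<in>times_before T. \<alpha> t > 0" and lim: "filterlim \<alpha> at_top (towards T)"
      and iso: "\<forall>t\<in>times_before T. isometric_curves (\<gamma> t) (\<lambda>x. (\<alpha> t :: real) *\<^sub>R \<gamma>0 x)"
      unfolding expanding_profile_def by blast
    have T: "T > 0" using sol unfolding maximal_solution_def by blast
    have "integral {-r..r} l \<le> 0" for r
    proof (rule ccontr)
      assume "\<not> ?thesis"
      then have I: "0 < integral {-r..r} l" by simp
      obtain t where t: "0 < t" "ereal t < T" "(E0 + 1) / integral {-r..r} l \<le> \<alpha> t"
        using times_towards[OF T] lim unfolding filterlim_at_top by blast
      then have tT: "t \<in> times_before T" by (simp add: times_before_def)
      have "E0 + 1 \<le> \<alpha> t * integral {-r..r} l" using t(3) I by (simp add: pos_divide_le_eq)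
      then show False using scaled[OF sol t(1,2), of "\<alpha> t" r] pos iso tT by auto
    qed
    then have "l x = 0" for x by (rule vanishing_integrals[OF cont(2) nonneg(2)])
    then have tau: "tau x = e" for x using immersed[of x] by (auto simp: l_def)
    have "curvature \<gamma>0 x = 0" for x
    proof -
      have "tau = (\<lambda>x. e)" using tau by auto
      then show ?thesis unfolding curvature_def by (simp add: Ds_def[of _ "\<lambda>x. e"] Dx_def[of "\<lambda>x. e"])
    qed
    then show ?thesis by (rule straight_profile[OF immersed_curve_axioms m])
  next
    assume "shrinking_profile \<gamma>0"
    then obtain T \<gamma> \<alpha> where sol: "maximal_solution \<gamma>0 T \<gamma>"
      and pos: "\<forall>t\<in>times_before T. \<alpha> t > 0" and lim: "(\<alpha> \<longlongrightarrow> 0) (towards T)"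
      and iso: "\<forall>t\<in>times_before T. isometric_curves (\<gamma> t) (\<lambda>x. (\<alpha> t :: real) *\<^sub>R \<gamma>0 x)"
      unfolding shrinking_profile_def by blast
    have T: "T > 0" using sol unfolding maximal_solution_def by blast
    have "integral {-r..r} k \<le> 0" for r
    proof (rule ccontr)
      assume "\<not> ?thesis"
      then have I: "0 < integral {-r..r} k" by simp
      have "0 < integral {-r..r} k / (E0 + 1)" using I E0_nonneg by simp
      then obtain t where t: "0 < t" "ereal t < T" "\<alpha> t < integral {-r..r} k / (E0 + 1)"
        using times_towards[OF T order_tendstoD(2)[OF lim]] by blast
      then have tT: "t \<in> times_before T" by (simp add: times_before_def)
      have a: "0 < \<alpha> t" using pos tT by blast
      have "\<alpha> t * (E0 + 1) < integral {-r..r} k" using t(3) E0_nonneg by (simp add: pos_less_divide_eq)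
      then have "E0 + 1 < integral {-r..r} k / \<alpha> t" using a by (simp add: pos_less_divide_eq mult.commute)
      then show False using scaled[OF sol t(1,2) a, of r] iso tT by auto
    qed
    then have "k x = 0" for x by (rule vanishing_integrals[OF cont(1) nonneg(1)])
    then have "curvature \<gamma>0 x = 0" for x using immersed[of x] by (auto simp: k_def)
    then show ?thesis by (rule straight_profile[OF immersed_curve_axioms m])
  next
    assume "non_scaling_profile \<gamma>0"
    then obtain \<gamma> where sol: "maximal_solution \<gamma>0 \<infinity> \<gamma>" and iso: "\<forall>t\<ge>0. isometric_curves (\<gamma> t) \<gamma>0"
      unfolding non_scaling_profile_def by blast
    interpret F: elastic_flow \<gamma>0 1 \<gamma> e
      by (rule elastic_flow_of_maximal_solution[OF sol _ _ assms(2) e]) auto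
    have E: "integral {-r..r} (F.edens 0) \<le> E0" for r using E0 by (simp add: F.initial)
    have "F.velocity 0 x = 0" for x
    proof (rule F.stationary_of_constant_energy[OF E])
      fix t K r assume t: "t \<in> F.J" and K: "\<And>r. integral {-r..r} (F.edens t) \<le> K"
      have iso1: "isometric_curves (\<gamma> t) (\<lambda>x. 1 *\<^sub>R \<gamma>0 x)" using iso t by simp
      show "integral {-r..r} (F.edens 0) \<le> K"
        using F.scaled_energy_bound[OF t zero_less_one iso1 E K, of r]
        by (simp add: F.initial density_def[abs_def])
    qed
    then show ?thesis
      using F.profile_line_or_elastica[OF E] stationary_iff by (simp add: F.initial)
  qed
qed

end
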